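(* Let $X$ be a hyperbolic sheaf on the site of complex spaces with the strong topology, with a base point $x:\mathrm{pt}\to X$. Then the groups $\pi^{par}_{i,j}(X,x)$ vanish for $i-j>0$ (with $i\ge j\ge 0$), and the groups $\pi^{iper}_{n,m}(z_1,z_2)(X,x)$ vanish for any $m>0$ (with $n\geq 0$ and $z_1\neq z_2$ points of the unit disc).
   Context: $\mathcal S_T$ is the site of complex spaces and holomorphic maps with the strong topology (coverings are open coverings in the classical topology). $\mathcal F_T(\mathcal S)$ is the category of sheaves of sets on it and $\Delta^{op}\mathcal F_T(\mathcal S)$ the category of simplicial sheaves. A complex space is identified with the sheaf it represents, and a sheaf with a constant simplicial sheaf; $\mathrm{pt}$ is the final sheaf. A morphism of simplicial sheaves is a simplicial weak equivalence if it induces weak equivalences of simplicial sets on all stalks; $\mathcal H_s$ is the localization of $\Delta^{op}\mathcal F_T(\mathcal S)$ at the simplicial weak equivalences. A simplicial sheaf $\mathcal X$ (in particular a sheaf) is hyperbolic (equivalently, $\mathbb C$-local) if for every simplicial sheaf $\mathcal Y$ the projection $\mathcal Y\times\mathbb C\to\mathcal Y$ induces a bijection $\mathrm{Hom}_{\mathcal H_s}(\mathcal Y,\mathcal X)\to\mathrm{Hom}_{\mathcal H_s}(\mathcal Y\times\mathbb C,\mathcal X)$. A morphism $f:\mathcal X\to\mathcal Y$ is a $\mathbb C$-weak equivalence if for every $\mathbb C$-local $\mathcal Z$ composition with $f$ is a bijection between $\mathrm{Hom}_{\mathcal H_s}(\mathcal Y,\mathcal Z)$ and $\mathrm{Hom}_{\mathcal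 H_s}(\mathcal X,\mathcal Z)$. $\mathcal H$ is the localization of $\Delta^{op}\mathcal F_T(\mathcal S)$ at the $\mathbb C$-weak equivalences, and $\mathcal H_\bullet$ its pointed version (the localization of pointed simplicial sheaves at the pointed maps that are $\mathbb C$-weak equivalences). For pointed simplicial sheaves, $\mathcal X\wedge\mathcal Y=(\mathcal X\times\mathcal Y)/(\mathcal X\vee\mathcal Y)$, where $\mathcal X\vee\mathcal Y$ is the colimit of $\mathcal X\leftarrow\mathrm{pt}\to\mathcal Y$; quotients are colimits taken in (simplicial) sheaves, pointed by the image of the collapsed subobject. The parabolic circle is the sheaf $S^1_{par}=\mathbb C/(\{0\}\amalg\{1\})$, and $S^n_{par}$ is its $n$-fold smash power. With $D\subset\mathbb C$ the unit disc and $z_1\ne z_2$ in $D$, the hyperbolic circle is the sheaf $S^1_{iper}(z_1,z_2)=D/(\{z_1\}\amalg\{z_2\})$, and $S^n_{iper}(z_1,z_2)$ is its $n$-fold smash power. (A $0$-fold smash power is $\mathrm{pt}\amalg\mathrm{pt}$; $\mathbb C\setminus 0$ is pointed by $1$.) For a pointed simplicial sheaf $(\mathcal X,x)$: $$\pi^{par}_{i,j}(\mathcal X,x)=\mathrm{Hom}_{\mathcal H_\bullet}\big((\mathbb C\setminus 0)^{\wedge j}\wedge S^{i-j}_{par},(\mathcal X,x)\big),\quad i\ge j\ge 0,$$ $$\pi^{iper}_{n,m}(z_1,z_2)(\mathcal X,x)=\mathrm{Hom}_{\mathcal H_\bullet}\big(S^n_{iper}(z_1,z_2)\wedge S^m_{par},(\mathcal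 X,x)\big),\quad n,m\ge 0.$$ These are the (parabolic, hyperbolic) holotopy pointed sets (or groups). "Vanish" means that the set consists only of the class of the constant map to the base point. *)

theory Defs
  imports "HOL-Homology.Simplices" "HOL-Analysis.Analysis" "HOL-Algebra.Ring"
begin

section \<open>Complex spaces\<close>

subsection \<open>Ringed spaces over the complex numbers\<close>

text \<open>
  Only the values of \<open>sections\<close>, \<open>res\<close> and \<open>scalar\<close> on open sets matter;
  \<open>res X V W\<close> is the restriction from \<open>V\<close> to \<open>W\<close>, and \<open>scalar X V\<close> is the structure
  homomorphism of the complex algebra of sections over \<open>V\<close>.
\<close>

record ('p, 'r) cringed =
  space_top :: "'p topology"
  sections :: "'p set \<Rightarrow> 'r ring"
  res :: "'p set \<Rightarrow> 'p set \<Rightarrow> 'r \<Rightarrow> 'r"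
  scalar :: "'p set \<Rightarrow> complex \<Rightarrow> 'r"

definition complex_ring :: "complex ring" where
  "complex_ring = \<lparr>carrier = UNIV, monoid.mult = (*), monoid.one = 1, ring.zero = 0, ring.add = (+)\<rparr>"

abbreviation opens :: "('p, 'r) cringed \<Rightarrow> 'p set set" where
  "opens X \<equiv> {V. openin (space_top X) V}"

abbreviation points :: "('p, 'r) cringed \<Rightarrow> 'p set" where
  "points X \<equiv> topspace (space_top X)"

definition cringed_space :: "('p, 'r) cringed \<Rightarrow> bool" where
  "cringed_space X \<longleftrightarrow>
     (\<forall>V\<in>opens X. cring (sections X V) \<and> scalar X V \<in> ring_hom complex_ring (sections X V)) \<and>
     (\<forall>V\<in>opens X. \<forall>W\<in>opens X. W \<subseteq> V \<longrightarrow>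
        res X V W \<in> ring_hom (sections X V) (sections X W) \<and>
        (\<forall>c. res X V W (scalar X V c) = scalar X W c)) \<and>
     (\<forall>V\<in>opens X. \<forall>r\<in>carrier (sections X V). res X V V r = r) \<and>
     (\<forall>V\<in>opens X. \<forall>W\<in>opens X. \<forall>W'\<in>opens X. W' \<subseteq> W \<and> W \<subseteq> V \<longrightarrow>
        (\<forall>r\<in>carrier (sections X V). res X W W' (res X V W r) = res X V W' r)) \<and>
     (\<forall>\<V> s. \<V> \<subseteq> opens X \<and> (\<forall>V\<in>\<V>. s V \<in> carrier (sections X V)) \<and>
        (\<forall>V\<in>\<V>. \<forall>W\<in>\<V>. res X V (V \<inter> W) (s V) = res X W (V \<inter> W) (s W)) \<longrightarrow>
        (\<exists>!r. r \<in> carrier (sections X (\<Union>\<V>)) \<and> (\<forall>V\<in>\<V>. res X (\<Union>\<V>) V r = s V)))"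

text \<open>
  Morphisms are pairs of a continuous map and a homomorphism of sheaves of complex algebras.
  Both components are normalised outside their domains, so that equality of morphisms is HOL
  equality.  On complex spaces the stalks are local algebras with residue field the complex
  numbers, so that the maps induced on stalks are automatically local.
\<close>

type_synonym ('p, 'q, 'r, 's) rmap = "('p \<Rightarrow> 'q) \<times> ('q set \<Rightarrow> 's \<Rightarrow> 'r)"

definition preim :: "('p, 'r) cringed \<Rightarrow> ('p \<Rightarrow> 'q) \<Rightarrow> 'q set \<Rightarrow> 'p set" where
  "preim X f W = {p \<in> points X. f p \<in> W}"

definition rhom :: "('p, 'r) cringed \<Rightarrow> ('q, 's) cringed \<Rightarrow> ('p, 'q, 'r, 's) rmap set" where
  "rhom X Y = {(f, \<phi>).
     f \<in> extensional (points X) \<and> continuous_map (space_top X) (space_top Y) f \<and>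
     \<phi> \<in> extensional (opens Y) \<and>
     (\<forall>W\<in>opens Y. \<phi> W \<in> extensional (carrier (sections Y W)) \<and>
        \<phi> W \<in> ring_hom (sections Y W) (sections X (preim X f W)) \<and>
        (\<forall>c. \<phi> W (scalar Y W c) = scalar X (preim X f W) c)) \<and>
     (\<forall>W\<in>opens Y. \<forall>W'\<in>opens Y. W' \<subseteq> W \<longrightarrow> (\<forall>r\<in>carrier (sections Y W).
        \<phi> W' (res Y W W' r) = res X (preim X f W) (preim X f W') (\<phi> W r)))}"

definition rid :: "('p, 'r) cringed \<Rightarrow> ('p, 'p, 'r, 'r) rmap" where
  "rid X = (\<lambda>p\<in>points X. p, \<lambda>W\<in>opens X. \<lambda>r\<in>carrier (sections X W). r)"

text \<open>\<open>rcomp X Y Z g f\<close> is the composite of \<open>f\<close> from \<open>X\<close> to \<open>Y\<close> and \<open>g\<close> from \<open>Y\<close> to \<open>Z\<close>.\<close>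

definition rcomp :: "('p, 'r) cringed \<Rightarrow> ('q, 's) cringed \<Rightarrow> ('o, 't) cringed \<Rightarrow>
    ('q, 'o, 's, 't) rmap \<Rightarrow> ('p, 'q, 'r, 's) rmap \<Rightarrow> ('p, 'o, 'r, 't) rmap" where
  "rcomp X Y Z g f =
     (\<lambda>p\<in>points X. fst g (fst f p),
      \<lambda>W\<in>opens Z. \<lambda>r\<in>carrier (sections Z W). snd f (preim Y (fst g) W) (snd g W r))"

definition riso :: "('p, 'r) cringed \<Rightarrow> ('q, 's) cringed \<Rightarrow> bool" where
  "riso X Y \<longleftrightarrow> (\<exists>f\<in>rhom X Y. \<exists>g\<in>rhom Y X. rcomp X Y X g f = rid X \<and> rcomp Y X Y f g = rid Y)"

definition open_sub :: "('p, 'r) cringed \<Rightarrow> 'p set \<Rightarrow> ('p, 'r) cringed" where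
  "open_sub X V = X\<lparr>space_top := subtopology (space_top X) V\<rparr>"

text \<open>\<open>incl X V V'\<close> is the inclusion of \<open>open_sub X V\<close> in \<open>open_sub X V'\<close>, for open
  \<open>V \<subseteq> V'\<close>.  Note that \<open>open_sub X (points X) = X\<close>.\<close>

definition incl :: "('p, 'r) cringed \<Rightarrow> 'p set \<Rightarrow> 'p set \<Rightarrow> ('p, 'p, 'r, 'r) rmap" where
  "incl X V V' =
     (\<lambda>p\<in>V. p,
      \<lambda>W\<in>opens (open_sub X V'). \<lambda>r\<in>carrier (sections X W). res X W (W \<inter> V) r)"

subsection \<open>Local models\<close>

text \<open>The space of \<open>n\<close>-tuples of complex numbers, with the topology induced by the product
  topology of sequences.\<close>

definition Cn :: "nat \<Rightarrow> (nat \<Rightarrow> complex) set" where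
  "Cn n = {z. \<forall>i\<ge>n. z i = 0}"

definition open_Cn :: "nat \<Rightarrow> (nat \<Rightarrow> complex) set \<Rightarrow> bool" where
  "open_Cn n N \<longleftrightarrow> openin (top_of_set (Cn n)) N"

text \<open>Holomorphic in \<open>n\<close> variables: complex (Frechet) differentiable at every point.\<close>

definition holo_Cn :: "nat \<Rightarrow> (nat \<Rightarrow> complex) set \<Rightarrow> ((nat \<Rightarrow> complex) \<Rightarrow> complex) \<Rightarrow> bool" where
  "holo_Cn n N f \<longleftrightarrow> (\<forall>z\<in>N. \<exists>c. \<forall>e>0. \<exists>d>0. \<forall>w\<in>N. (\<forall>i<n. norm (w i - z i) < d) \<longrightarrow>
     norm (f w - f z - (\<Sum>i<n. c i * (w i - z i))) \<le> e * (\<Sum>i<n. norm (w i - z i)))"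

text \<open>
  \<open>germ_mod n \<Omega> fs a g\<close> is the class of \<open>g\<close> in the quotient of the ring of germs of holomorphic
  functions at \<open>a\<close> by the ideal generated by the germs of \<open>fs\<close>.
\<close>

definition germ_mod :: "nat \<Rightarrow> (nat \<Rightarrow> complex) set \<Rightarrow> ((nat \<Rightarrow> complex) \<Rightarrow> complex) list \<Rightarrow>
    (nat \<Rightarrow> complex) \<Rightarrow> ((nat \<Rightarrow> complex) \<Rightarrow> complex) \<Rightarrow> ((nat \<Rightarrow> complex) \<Rightarrow> complex) set" where
  "germ_mod n \<Omega> fs a g = {h. \<exists>N c. open_Cn n N \<and> a \<in> N \<and> N \<subseteq> \<Omega> \<and> holo_Cn n N g \<and> holo_Cn n N h \<and>
     (\<forall>i<length fs. holo_Cn n N (c i)) \<and>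
     (\<forall>z\<in>N. g z - h z = (\<Sum>i<length fs. c i z * (fs ! i) z))}"

definition model_sections :: "nat \<Rightarrow> (nat \<Rightarrow> complex) set \<Rightarrow> ((nat \<Rightarrow> complex) \<Rightarrow> complex) list \<Rightarrow>
    (nat \<Rightarrow> complex) set \<Rightarrow> ((nat \<Rightarrow> complex) \<Rightarrow> ((nat \<Rightarrow> complex) \<Rightarrow> complex) set) ring" where
  "model_sections n \<Omega> fs V = \<lparr>
     carrier = {s \<in> extensional V. \<forall>a\<in>V. \<exists>N g. open_Cn n N \<and> a \<in> N \<and> N \<subseteq> \<Omega> \<and> holo_Cn n N g \<and>
       (\<forall>b\<in>N \<inter> V. s b = germ_mod n \<Omega> fs b g)},
     monoid.mult = (\<lambda>s t. \<lambda>a\<in>V. \<Union>g\<in>s a. \<Union>h\<in>t a. germ_mod n \<Omega> fs a (\<lambda>z. g z * h z)),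
     monoid.one = (\<lambda>a\<in>V. germ_mod n \<Omega> fs a (\<lambda>z. 1)),
     ring.zero = (\<lambda>a\<in>V. germ_mod n \<Omega> fs a (\<lambda>z. 0)),
     ring.add = (\<lambda>s t. \<lambda>a\<in>V. \<Union>g\<in>s a. \<Union>h\<in>t a. germ_mod n \<Omega> fs a (\<lambda>z. g z + h z))\<rparr>"

text \<open>The common zero locus of \<open>fs\<close> in the open set \<open>\<Omega>\<close>, with the restriction of the quotient
  sheaf as structure sheaf.\<close>

definition local_model :: "nat \<Rightarrow> (nat \<Rightarrow> complex) set \<Rightarrow> ((nat \<Rightarrow> complex) \<Rightarrow> complex) list \<Rightarrow>
    (nat \<Rightarrow> complex, (nat \<Rightarrow> complex) \<Rightarrow> ((nat \<Rightarrow> complex) \<Rightarrow> complex) set) cringed" where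
  "local_model n \<Omega> fs = \<lparr>
     space_top = top_of_set {z \<in> \<Omega>. \<forall>f\<in>set fs. f z = 0},
     sections = model_sections n \<Omega> fs,
     res = (\<lambda>V W s. restrict s W),
     scalar = (\<lambda>V c. \<lambda>a\<in>V. germ_mod n \<Omega> fs a (\<lambda>z. c))\<rparr>"

subsection \<open>The objects of the site\<close>

text \<open>
  Complex spaces are Hausdorff with a countable base; they may be non-reduced.  Such a space and
  each of its rings of sections have at most the cardinality of the continuum, hence the two
  carrier types below contain every complex space up to isomorphism.
\<close>

type_synonym cspace = "(complex, complex \<Rightarrow> complex) cringed"
type_synonym cmap = "(complex, complex, complex \<Rightarrow> complex, complex \<Rightarrow> complex) rmap"

definition complex_space :: "cspace \<Rightarrow> bool" where
  "complex_space X \<longleftrightarrow> cringed_space X \<and>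
     Hausdorff_space (space_top X) \<and> second_countable (space_top X) \<and>
     (\<forall>p\<in>points X. \<exists>V n \<Omega> fs. V \<in> opens X \<and> p \<in> V \<and> open_Cn n \<Omega> \<and> (\<forall>f\<in>set fs. holo_Cn n \<Omega> f) \<and>
        riso (open_sub X V) (local_model n \<Omega> fs))"

text \<open>An open subset of the complex plane with its sheaf of holomorphic functions.\<close>

definition plane :: "complex set \<Rightarrow> cspace" where
  "plane A = \<lparr>
     space_top = top_of_set A,
     sections = (\<lambda>V. \<lparr>carrier = {g \<in> extensional V. g holomorphic_on V},
        monoid.mult = (\<lambda>g h. \<lambda>z\<in>V. g z * h z), monoid.one = (\<lambda>z\<in>V. 1),
        ring.zero = (\<lambda>z\<in>V. 0), ring.add = (\<lambda>g h. \<lambda>z\<in>V. g z + h z)\<rparr>),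
     res = (\<lambda>V W g. restrict g W),
     scalar = (\<lambda>V c. \<lambda>z\<in>V. c)\<rparr>"

text \<open>The constant map from \<open>U\<close> to \<open>plane A\<close> with value \<open>c\<close>.\<close>

definition const_cmap :: "complex set \<Rightarrow> complex \<Rightarrow> cspace \<Rightarrow> cmap" where
  "const_cmap A c U =
     (\<lambda>p\<in>points U. c,
      \<lambda>W\<in>opens (plane A). \<lambda>g\<in>carrier (sections (plane A) W).
        scalar U (preim U (\<lambda>p. c) W) (g c))"

section \<open>Sheaves of sets\<close>

text \<open>
  Sets of sections are subsets of a fixed type that serves as the universe of small sets.  It has
  to contain the morphisms of the (essentially small) site and to be closed under families indexed
  by the open sets of a complex space; then the category of sheaves contains the representable
  sheaves and is closed under finite products, sheafification and finite colimits.  Every type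
  embeds into a universe, as the type \<open>univ\<close> shows.
\<close>

class universe =
  assumes ex_code: "\<exists>code :: cmap + (complex set \<Rightarrow> 'a) \<Rightarrow> 'a. inj code"

datatype 'a univ = Atom 'a | Code "cmap + (complex set \<Rightarrow> 'a univ)"

instance univ :: (type) universe
  by standard (rule exI[of _ Code], simp add: inj_def)

definition ucode :: "cmap + (complex set \<Rightarrow> 'u) \<Rightarrow> 'u::universe" where
  "ucode = (SOME code. inj code)"

lemma inj_ucode: "inj (ucode :: cmap + (complex set \<Rightarrow> 'u) \<Rightarrow> 'u::universe)"
  unfolding ucode_def by (rule someI_ex[OF ex_code])

definition upair :: "'u::universe \<Rightarrow> 'u \<Rightarrow> 'u" where
  "upair a b = ucode (Inr (\<lambda>V. if V = {} then a else b))"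

lemma upair_inject: "upair a b = upair a' b' \<longleftrightarrow> a = a' \<and> b = b'"
proof
  assume "upair a b = upair a' b'"
  then have "(\<lambda>V::complex set. if V = {} then a else b) = (\<lambda>V. if V = {} then a' else b')"
    unfolding upair_def by (auto dest: injD[OF inj_ucode])
  from fun_cong[OF this, of "{}"] fun_cong[OF this, of UNIV] show "a = a' \<and> b = b'" by simp
qed simp

definition ufst :: "'u::universe \<Rightarrow> 'u" where "ufst z = (THE a. \<exists>b. z = upair a b)"
definition usnd :: "'u::universe \<Rightarrow> 'u" where "usnd z = (THE b. \<exists>a. z = upair a b)"

lemma ufst_upair [simp]: "ufst (upair a b) = a"
  unfolding ufst_def by (rule the_equality) (auto simp: upair_inject)

lemma usnd_upair [simp]: "usnd (upair a b) = b"
  unfolding usnd_def by (rule the_equality) (auto simp: upair_inject)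

text \<open>\<open>rst F U V f\<close> is the map from \<open>val F V\<close> to \<open>val F U\<close> induced by \<open>f\<close> from \<open>U\<close> to \<open>V\<close>.\<close>

record 'u presheaf =
  val :: "cspace \<Rightarrow> 'u set"
  rst :: "cspace \<Rightarrow> cspace \<Rightarrow> cmap \<Rightarrow> 'u \<Rightarrow> 'u"

definition is_presheaf :: "'u presheaf \<Rightarrow> bool" where
  "is_presheaf F \<longleftrightarrow>
     (\<forall>U V f. complex_space U \<and> complex_space V \<and> f \<in> rhom U V \<longrightarrow> rst F U V f \<in> val F V \<rightarrow> val F U) \<and>
     (\<forall>U. complex_space U \<longrightarrow> (\<forall>a\<in>val F U. rst F U U (rid U) a = a)) \<and>
     (\<forall>U V W f g. complex_space U \<and> complex_space V \<and> complex_space W \<and>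
        f \<in> rhom U V \<and> g \<in> rhom V W \<longrightarrow>
        (\<forall>a\<in>val F W. rst F U W (rcomp U V W g f) a = rst F U V f (rst F V W g a)))"

abbreviation rst_open :: "'u presheaf \<Rightarrow> cspace \<Rightarrow> complex set \<Rightarrow> complex set \<Rightarrow> 'u \<Rightarrow> 'u" where
  "rst_open F U V V' \<equiv> rst F (open_sub U V) (open_sub U V') (incl U V V')"

definition sheaf :: "'u presheaf \<Rightarrow> bool" where
  "sheaf F \<longleftrightarrow> is_presheaf F \<and>
     (\<forall>U \<V> s. complex_space U \<and> \<V> \<subseteq> opens U \<and> \<Union>\<V> = points U \<and>
        (\<forall>V\<in>\<V>. s V \<in> val F (open_sub U V)) \<and>
        (\<forall>V\<in>\<V>. \<forall>W\<in>\<V>. rst_open F U (V \<inter> W) V (s V) = rst_open F U (V \<inter> W) W (s W)) \<longrightarrow>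
        (\<exists>!a. a \<in> val F U \<and> (\<forall>V\<in>\<V>. rst_open F U V (points U) a = s V)))"

definition representable :: "cspace \<Rightarrow> 'u::universe presheaf" where
  "representable M = \<lparr>
     val = (\<lambda>U. (\<lambda>h. ucode (Inl h)) ` rhom U M),
     rst = (\<lambda>U V f a. ucode (Inl (rcomp U V M (THE h. a = ucode (Inl h)) f)))\<rparr>"

definition final_sheaf :: "'u presheaf" where
  "final_sheaf = \<lparr>val = (\<lambda>U. {undefined}), rst = (\<lambda>U V f a. a)\<rparr>"

section \<open>Categories and localization\<close>

record ('o, 'a) category =
  Obj :: "'o set"
  Arr :: "'a set"
  Dom :: "'a \<Rightarrow> 'o"
  Cod :: "'a \<Rightarrow> 'o"
  Ide :: "'o \<Rightarrow> 'a"
  Comp :: "'a \<Rightarrow> 'a \<Rightarrow> 'a"  \<comment> \<open>\<open>Comp \<C> g f\<close> is \<open>f\<close> followed by \<open>g\<close>\<close>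

definition is_coproduct :: "('o, 'a) category \<Rightarrow> 'a \<Rightarrow> 'a \<Rightarrow> bool" where
  "is_coproduct \<C> i j \<longleftrightarrow> i \<in> Arr \<C> \<and> j \<in> Arr \<C> \<and> Cod \<C> i = Cod \<C> j \<and>
     (\<forall>f g. f \<in> Arr \<C> \<and> g \<in> Arr \<C> \<and> Dom \<C> f = Dom \<C> i \<and> Dom \<C> g = Dom \<C> j \<and> Cod \<C> f = Cod \<C> g \<longrightarrow>
        (\<exists>!h. h \<in> Arr \<C> \<and> Dom \<C> h = Cod \<C> i \<and> Cod \<C> h = Cod \<C> f \<and>
              Comp \<C> h i = f \<and> Comp \<C> h j = g))"

text \<open>\<open>is_pushout \<C> f g p q\<close>: the arrows \<open>p\<close> and \<open>q\<close>, with \<open>p\<close> following \<open>f\<close> and \<open>q\<close> following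
  \<open>g\<close>, are a colimit cocone of the span formed by \<open>f\<close> and \<open>g\<close>.\<close>

definition is_pushout :: "('o, 'a) category \<Rightarrow> 'a \<Rightarrow> 'a \<Rightarrow> 'a \<Rightarrow> 'a \<Rightarrow> bool" where
  "is_pushout \<C> f g p q \<longleftrightarrow>
     f \<in> Arr \<C> \<and> g \<in> Arr \<C> \<and> p \<in> Arr \<C> \<and> q \<in> Arr \<C> \<and> Dom \<C> f = Dom \<C> g \<and>
     Dom \<C> p = Cod \<C> f \<and> Dom \<C> q = Cod \<C> g \<and> Cod \<C> p = Cod \<C> q \<and> Comp \<C> p f = Comp \<C> q g \<and>
     (\<forall>r s. r \<in> Arr \<C> \<and> s \<in> Arr \<C> \<and> Dom \<C> r = Cod \<C> f \<and> Dom \<C> s = Cod \<C> g \<and> Cod \<C> r = Cod \<C> s \<and>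
        Comp \<C> r f = Comp \<C> s g \<longrightarrow>
        (\<exists>!h. h \<in> Arr \<C> \<and> Dom \<C> h = Cod \<C> p \<and> Cod \<C> h = Cod \<C> r \<and>
              Comp \<C> h p = r \<and> Comp \<C> h q = s))"

text \<open>
  The localization of \<open>\<C>\<close> at a set \<open>\<W>\<close> of arrows has the objects of \<open>\<C>\<close>; its morphisms are
  zigzags of arrows of \<open>\<C>\<close> and formal inverses of arrows in \<open>\<W>\<close>, written from left to right,
  modulo the congruence generated by the relations \<open>loc_basic\<close>.
\<close>

datatype 'a zstep = Fwd 'a | Inv 'a

inductive zigzag :: "('o, 'a) category \<Rightarrow> 'a set \<Rightarrow> 'o \<Rightarrow> 'a zstep list \<Rightarrow> 'o \<Rightarrow> bool"
  for \<C> \<W> where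
  zigzag_nil: "X \<in> Obj \<C> \<Longrightarrow> zigzag \<C> \<W> X [] X"
| zigzag_fwd: "f \<in> Arr \<C> \<Longrightarrow> zigzag \<C> \<W> (Cod \<C> f) p Y \<Longrightarrow> zigzag \<C> \<W> (Dom \<C> f) (Fwd f # p) Y"
| zigzag_inv: "w \<in> \<W> \<Longrightarrow> zigzag \<C> \<W> (Dom \<C> w) p Y \<Longrightarrow> zigzag \<C> \<W> (Cod \<C> w) (Inv w # p) Y"

inductive loc_basic :: "('o, 'a) category \<Rightarrow> 'a set \<Rightarrow> 'a zstep list \<Rightarrow> 'a zstep list \<Rightarrow> bool"
  for \<C> \<W> where
  "X \<in> Obj \<C> \<Longrightarrow> loc_basic \<C> \<W> [Fwd (Ide \<C> X)] []"
| "f \<in> Arr \<C> \<Longrightarrow> g \<in> Arr \<C> \<Longrightarrow> Dom \<C> g = Cod \<C> f \<Longrightarrow>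
     loc_basic \<C> \<W> [Fwd f, Fwd g] [Fwd (Comp \<C> g f)]"
| "w \<in> \<W> \<Longrightarrow> loc_basic \<C> \<W> [Fwd w, Inv w] []"
| "w \<in> \<W> \<Longrightarrow> loc_basic \<C> \<W> [Inv w, Fwd w] []"

definition loc_step :: "('o, 'a) category \<Rightarrow> 'a set \<Rightarrow> 'o \<Rightarrow> 'o \<Rightarrow> ('a zstep list \<times> 'a zstep list) set" where
  "loc_step \<C> \<W> X Y = {(p @ a @ q, p @ b @ q) | p q a b.
     loc_basic \<C> \<W> a b \<and> zigzag \<C> \<W> X (p @ a @ q) Y \<and> zigzag \<C> \<W> X (p @ b @ q) Y}"

definition loc_rel :: "('o, 'a) category \<Rightarrow> 'a set \<Rightarrow> 'o \<Rightarrow> 'o \<Rightarrow> ('a zstep list \<times> 'a zstep list) set" where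
  "loc_rel \<C> \<W> X Y = {(p, q). zigzag \<C> \<W> X p Y \<and> zigzag \<C> \<W> X q Y \<and>
     (p, q) \<in> (loc_step \<C> \<W> X Y \<union> (loc_step \<C> \<W> X Y)\<inverse>)\<^sup>*}"

definition loc_hom :: "('o, 'a) category \<Rightarrow> 'a set \<Rightarrow> 'o \<Rightarrow> 'o \<Rightarrow> 'a zstep list set set" where
  "loc_hom \<C> \<W> X Y = {p. zigzag \<C> \<W> X p Y} // loc_rel \<C> \<W> X Y"

definition loc_class :: "('o, 'a) category \<Rightarrow> 'a set \<Rightarrow> 'a \<Rightarrow> 'a zstep list set" where
  "loc_class \<C> \<W> f = loc_rel \<C> \<W> (Dom \<C> f) (Cod \<C> f) `` {[Fwd f]}"

text \<open>Precomposition with \<open>f\<close> on morphisms to \<open>Z\<close> in the localization.\<close>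

definition loc_precomp :: "('o, 'a) category \<Rightarrow> 'a set \<Rightarrow> 'a \<Rightarrow> 'o \<Rightarrow>
    'a zstep list set \<Rightarrow> 'a zstep list set" where
  "loc_precomp \<C> \<W> f Z c = (\<Union>p\<in>c. loc_rel \<C> \<W> (Dom \<C> f) Z `` {Fwd f # p})"

section \<open>Weak equivalences of simplicial sets\<close>

text \<open>The monotone maps from \<open>{0..m}\<close> to \<open>{0..n}\<close>.\<close>

definition Delta :: "nat \<Rightarrow> nat \<Rightarrow> (nat \<Rightarrow> nat) set" where
  "Delta m n = {\<theta> \<in> {..m} \<rightarrow>\<^sub>E {..n}. mono_on {..m} \<theta>}"

text \<open>\<open>act K m n \<theta>\<close> is the map from \<open>n\<close>-simplices to \<open>m\<close>-simplices induced by
  \<open>\<theta> \<in> Delta m n\<close>.\<close>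

record 'a sset =
  simp :: "nat \<Rightarrow> 'a set"
  act :: "nat \<Rightarrow> nat \<Rightarrow> (nat \<Rightarrow> nat) \<Rightarrow> 'a \<Rightarrow> 'a"

definition quotient_top :: "'a topology \<Rightarrow> ('a \<Rightarrow> 'b) \<Rightarrow> 'b topology" where
  "quotient_top X q =
     topology (\<lambda>S. S \<subseteq> q ` topspace X \<and> openin X {p \<in> topspace X. q p \<in> S})"

definition cells :: "'a sset \<Rightarrow> ((nat \<times> 'a) \<times> (nat \<Rightarrow> real)) topology" where
  "cells K = sum_topology (\<lambda>(n, x). subtopology (powertop_real UNIV) (standard_simplex n))
     (SIGMA n:UNIV. simp K n)"

definition push_simplex :: "nat \<Rightarrow> (nat \<Rightarrow> nat) \<Rightarrow> (nat \<Rightarrow> real) \<Rightarrow> nat \<Rightarrow> real" where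
  "push_simplex m \<theta> t = (\<lambda>i. \<Sum>j | j \<le> m \<and> \<theta> j = i. t j)"

definition glue :: "'a sset \<Rightarrow> (((nat \<times> 'a) \<times> (nat \<Rightarrow> real)) \<times> ((nat \<times> 'a) \<times> (nat \<Rightarrow> real))) set" where
  "glue K = {(((m, act K m n \<theta> x), t), ((n, x), push_simplex m \<theta> t)) | m n \<theta> x t.
     \<theta> \<in> Delta m n \<and> x \<in> simp K n \<and> t \<in> standard_simplex m}"

definition cell_class :: "'a sset \<Rightarrow> (nat \<times> 'a) \<times> (nat \<Rightarrow> real) \<Rightarrow> ((nat \<times> 'a) \<times> (nat \<Rightarrow> real)) set" where
  "cell_class K p = (glue K \<union> (glue K)\<inverse>)\<^sup>* `` {p}"

definition realization :: "'a sset \<Rightarrow> ((nat \<times> 'a) \<times> (nat \<Rightarrow> real)) set topology" where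
  "realization K = quotient_top (cells K) (cell_class K)"

definition realization_map :: "'b sset \<Rightarrow> (nat \<Rightarrow> 'a \<Rightarrow> 'b) \<Rightarrow>
    ((nat \<times> 'a) \<times> (nat \<Rightarrow> real)) set \<Rightarrow> ((nat \<times> 'b) \<times> (nat \<Rightarrow> real)) set" where
  "realization_map L g c = (\<Union>((n, x), t)\<in>c. cell_class L ((n, g n x), t))"

definition cube :: "nat \<Rightarrow> (nat \<Rightarrow> real) set" where
  "cube n = {t. (\<forall>i<n. 0 \<le> t i \<and> t i \<le> 1) \<and> (\<forall>i\<ge>n. t i = 0)}"

definition cube_boundary :: "nat \<Rightarrow> (nat \<Rightarrow> real) set" where
  "cube_boundary n = {t \<in> cube n. \<exists>i<n. t i = 0 \<or> t i = 1}"

abbreviation cube_top :: "nat \<Rightarrow> (nat \<Rightarrow> real) topology" where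
  "cube_top n \<equiv> subtopology (powertop_real UNIV) (cube n)"

definition spheroids :: "nat \<Rightarrow> 'a topology \<Rightarrow> 'a \<Rightarrow> ((nat \<Rightarrow> real) \<Rightarrow> 'a) set" where
  "spheroids n X x = {g. continuous_map (cube_top n) X g \<and> g ` cube_boundary n \<subseteq> {x}}"

definition spheroid_rel :: "nat \<Rightarrow> 'a topology \<Rightarrow> 'a \<Rightarrow> (((nat \<Rightarrow> real) \<Rightarrow> 'a) \<times> ((nat \<Rightarrow> real) \<Rightarrow> 'a)) set" where
  "spheroid_rel n X x =
     {(g, h). homotopic_with (\<lambda>k. k ` cube_boundary n \<subseteq> {x}) (cube_top n) X g h}"

definition pi_top :: "nat \<Rightarrow> 'a topology \<Rightarrow> 'a \<Rightarrow> ((nat \<Rightarrow> real) \<Rightarrow> 'a) set set" where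
  "pi_top n X x = spheroids n X x // spheroid_rel n X x"

definition pi_top_map :: "nat \<Rightarrow> 'b topology \<Rightarrow> ('a \<Rightarrow> 'b) \<Rightarrow> 'a \<Rightarrow>
    ((nat \<Rightarrow> real) \<Rightarrow> 'a) set \<Rightarrow> ((nat \<Rightarrow> real) \<Rightarrow> 'b) set" where
  "pi_top_map n Y f x c = (\<Union>g\<in>c. spheroid_rel n Y (f x) `` {f \<circ> g})"

text \<open>Induced maps of homotopy groups are homomorphisms, so bijectivity says that they are
  isomorphisms.\<close>

definition weak_homotopy_equivalence :: "'a topology \<Rightarrow> 'b topology \<Rightarrow> ('a \<Rightarrow> 'b) \<Rightarrow> bool" where
  "weak_homotopy_equivalence X Y f \<longleftrightarrow> continuous_map X Y f \<and>
     bij_betw (\<lambda>c. \<Union>a\<in>c. path_component_of_set Y (f a)) (path_components_of X) (path_components_of Y) \<and>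
     (\<forall>n\<ge>1. \<forall>x\<in>topspace X. bij_betw (pi_top_map n Y f x) (pi_top n X x) (pi_top n Y (f x)))"

definition sset_weak_equivalence :: "'a sset \<Rightarrow> 'b sset \<Rightarrow> (nat \<Rightarrow> 'a \<Rightarrow> 'b) \<Rightarrow> bool" where
  "sset_weak_equivalence K L g \<longleftrightarrow>
     weak_homotopy_equivalence (realization K) (realization L) (realization_map L g)"

section \<open>Simplicial sheaves\<close>

text \<open>\<open>sop F m n \<theta> U\<close> is the simplicial operator from level \<open>n\<close> to level \<open>m\<close> on sections over
  \<open>U\<close>, for \<open>\<theta> \<in> Delta m n\<close>.\<close>

record 'u ssheaf =
  lvl :: "nat \<Rightarrow> 'u presheaf"
  sop :: "nat \<Rightarrow> nat \<Rightarrow> (nat \<Rightarrow> nat) \<Rightarrow> cspace \<Rightarrow> 'u \<Rightarrow> 'u"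

definition simplicial_sheaf :: "'u ssheaf \<Rightarrow> bool" where
  "simplicial_sheaf F \<longleftrightarrow>
     (\<forall>n. sheaf (lvl F n)) \<and>
     (\<forall>m n \<theta> U. \<theta> \<in> Delta m n \<and> complex_space U \<longrightarrow>
        sop F m n \<theta> U \<in> val (lvl F n) U \<rightarrow> val (lvl F m) U) \<and>
     (\<forall>m n \<theta> U V f. \<theta> \<in> Delta m n \<and> complex_space U \<and> complex_space V \<and> f \<in> rhom U V \<longrightarrow>
        (\<forall>a\<in>val (lvl F n) V.
           sop F m n \<theta> U (rst (lvl F n) U V f a) = rst (lvl F m) U V f (sop F m n \<theta> V a))) \<and>
     (\<forall>n U. complex_space U \<longrightarrow> (\<forall>a\<in>val (lvl F n) U. sop F n n (\<lambda>i\<in>{..n}. i) U a = a)) \<and>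
     (\<forall>l m n \<theta> \<psi> U. \<psi> \<in> Delta l m \<and> \<theta> \<in> Delta m n \<and> complex_space U \<longrightarrow>
        (\<forall>a\<in>val (lvl F n) U.
           sop F l n (\<lambda>i\<in>{..l}. \<theta> (\<psi> i)) U a = sop F l m \<psi> U (sop F m n \<theta> U a)))"

type_synonym 'u sarrow = "'u ssheaf \<times> 'u ssheaf \<times> (nat \<Rightarrow> cspace \<Rightarrow> 'u \<Rightarrow> 'u)"

abbreviation cmp :: "'u sarrow \<Rightarrow> nat \<Rightarrow> cspace \<Rightarrow> 'u \<Rightarrow> 'u" where
  "cmp f \<equiv> snd (snd f)"

text \<open>Normalisation of the components of a transformation with source \<open>F\<close>.\<close>

definition extend :: "'u ssheaf \<Rightarrow> (nat \<Rightarrow> cspace \<Rightarrow> 'u \<Rightarrow> 'u) \<Rightarrow> nat \<Rightarrow> cspace \<Rightarrow> 'u \<Rightarrow> 'u" where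
  "extend F \<eta> = (\<lambda>n. \<lambda>U\<in>{U. complex_space U}. \<lambda>a\<in>val (lvl F n) U. \<eta> n U a)"

definition simplicial_map :: "'u sarrow \<Rightarrow> bool" where
  "simplicial_map = (\<lambda>(F, G, \<eta>). simplicial_sheaf F \<and> simplicial_sheaf G \<and> extend F \<eta> = \<eta> \<and>
     (\<forall>n U. complex_space U \<longrightarrow> \<eta> n U \<in> val (lvl F n) U \<rightarrow> val (lvl G n) U) \<and>
     (\<forall>n U V f. complex_space U \<and> complex_space V \<and> f \<in> rhom U V \<longrightarrow>
        (\<forall>a\<in>val (lvl F n) V.
           \<eta> n U (rst (lvl F n) U V f a) = rst (lvl G n) U V f (\<eta> n V a))) \<and>
     (\<forall>m n \<theta> U. \<theta> \<in> Delta m n \<and> complex_space U \<longrightarrow>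
        (\<forall>a\<in>val (lvl F n) U. \<eta> m U (sop F m n \<theta> U a) = sop G m n \<theta> U (\<eta> n U a))))"

definition sSh :: "('u ssheaf, 'u sarrow) category" where
  "sSh = \<lparr>
     Obj = {F. simplicial_sheaf F},
     Arr = {f. simplicial_map f},
     Dom = fst,
     Cod = (\<lambda>f. fst (snd f)),
     Ide = (\<lambda>F. (F, F, extend F (\<lambda>n U a. a))),
     Comp = (\<lambda>g f. (fst f, fst (snd g), extend (fst f) (\<lambda>n U a. cmp g n U (cmp f n U a))))\<rparr>"

definition const_ssheaf :: "'u presheaf \<Rightarrow> 'u ssheaf" where
  "const_ssheaf F = \<lparr>lvl = (\<lambda>n. F), sop = (\<lambda>m n \<theta> U a. a)\<rparr>"

definition pt :: "'u ssheaf" where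
  "pt = const_ssheaf final_sheaf"

definition to_pt :: "'u ssheaf \<Rightarrow> 'u sarrow" where
  "to_pt F = (F, pt, extend F (\<lambda>n U a. undefined))"

definition sprod :: "'u::universe ssheaf \<Rightarrow> 'u ssheaf \<Rightarrow> 'u ssheaf" where
  "sprod F G = \<lparr>
     lvl = (\<lambda>n. \<lparr>
       val = (\<lambda>U. {upair a b | a b. a \<in> val (lvl F n) U \<and> b \<in> val (lvl G n) U}),
       rst = (\<lambda>U V f z. upair (rst (lvl F n) U V f (ufst z)) (rst (lvl G n) U V f (usnd z)))\<rparr>),
     sop = (\<lambda>m n \<theta> U z. upair (sop F m n \<theta> U (ufst z)) (sop G m n \<theta> U (usnd z)))\<rparr>"

definition proj1 :: "'u::universe ssheaf \<Rightarrow> 'u ssheaf \<Rightarrow> 'u sarrow" where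
  "proj1 F G = (sprod F G, F, extend (sprod F G) (\<lambda>n U. ufst))"

definition proj2 :: "'u::universe ssheaf \<Rightarrow> 'u ssheaf \<Rightarrow> 'u sarrow" where
  "proj2 F G = (sprod F G, G, extend (sprod F G) (\<lambda>n U. usnd))"

subsection \<open>Stalks and simplicial weak equivalences\<close>

text \<open>The germ at \<open>u\<close> of a section \<open>s\<close> over the open neighbourhood \<open>V\<close> of \<open>u\<close> in \<open>U\<close>.\<close>

definition germ :: "'u presheaf \<Rightarrow> cspace \<Rightarrow> complex \<Rightarrow> complex set \<Rightarrow> 'u \<Rightarrow> (complex set \<times> 'u) set" where
  "germ F U u V s = {(V', s'). V' \<in> opens U \<and> u \<in> V' \<and> s' \<in> val F (open_sub U V') \<and>
     (\<exists>W\<in>opens U. u \<in> W \<and> W \<subseteq> V \<inter> V' \<and> rst_open F U W V s = rst_open F U W V' s')}"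

definition stalk :: "'u ssheaf \<Rightarrow> cspace \<Rightarrow> complex \<Rightarrow> (complex set \<times> 'u) set sset" where
  "stalk F U u = \<lparr>
     simp = (\<lambda>n. {germ (lvl F n) U u V s | V s.
       V \<in> opens U \<and> u \<in> V \<and> s \<in> val (lvl F n) (open_sub U V)}),
     act = (\<lambda>m n \<theta> c. \<Union>(V, s)\<in>c. germ (lvl F m) U u V (sop F m n \<theta> (open_sub U V) s))\<rparr>"

definition stalk_map :: "'u sarrow \<Rightarrow> cspace \<Rightarrow> complex \<Rightarrow>
    nat \<Rightarrow> (complex set \<times> 'u) set \<Rightarrow> (complex set \<times> 'u) set" where
  "stalk_map f U u n c =
     (\<Union>(V, s)\<in>c. germ (lvl (Cod sSh f) n) U u V (cmp f n (open_sub U V) s))"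

definition simplicial_weq :: "'u sarrow set" where
  "simplicial_weq = {f \<in> Arr sSh. \<forall>U u. complex_space U \<and> u \<in> points U \<longrightarrow>
     sset_weak_equivalence (stalk (Dom sSh f) U u) (stalk (Cod sSh f) U u) (stalk_map f U u)}"

subsection \<open>Hyperbolic simplicial sheaves and the holotopy category\<close>

abbreviation Hs_hom :: "'u ssheaf \<Rightarrow> 'u ssheaf \<Rightarrow> 'u sarrow zstep list set set" where
  "Hs_hom \<equiv> loc_hom sSh simplicial_weq"

abbreviation Hs_precomp :: "'u sarrow \<Rightarrow> 'u ssheaf \<Rightarrow>
    'u sarrow zstep list set \<Rightarrow> 'u sarrow zstep list set" where
  "Hs_precomp \<equiv> loc_precomp sSh simplicial_weq"

definition plane_sheaf :: "complex set \<Rightarrow> 'u::universe ssheaf" where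
  "plane_sheaf A = const_ssheaf (representable (plane A))"

definition hyperbolic :: "'u::universe ssheaf \<Rightarrow> bool" where
  "hyperbolic X \<longleftrightarrow> simplicial_sheaf X \<and> (\<forall>Y. simplicial_sheaf Y \<longrightarrow>
     bij_betw (Hs_precomp (proj1 Y (plane_sheaf UNIV)) X)
       (Hs_hom Y X) (Hs_hom (sprod Y (plane_sheaf UNIV)) X))"

definition C_weq :: "'u::universe sarrow set" where
  "C_weq = {f \<in> Arr sSh. \<forall>Z. hyperbolic Z \<longrightarrow>
     bij_betw (Hs_precomp f Z) (Hs_hom (Cod sSh f) Z) (Hs_hom (Dom sSh f) Z)}"

text \<open>A pointed simplicial sheaf is given by its base point, an arrow with source \<open>pt\<close>.  An arrow
  of pointed simplicial sheaves consists of its source, its target and the underlying arrow.\<close>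

definition pointed :: "'u sarrow \<Rightarrow> bool" where
  "pointed a \<longleftrightarrow> a \<in> Arr sSh \<and> Dom sSh a = pt"

definition sSh_pointed :: "('u sarrow, 'u sarrow \<times> 'u sarrow \<times> 'u sarrow) category" where
  "sSh_pointed = \<lparr>
     Obj = {a. pointed a},
     Arr = {(a, b, f). pointed a \<and> pointed b \<and> f \<in> Arr sSh \<and> Dom sSh f = Cod sSh a \<and>
       Cod sSh f = Cod sSh b \<and> Comp sSh f a = b},
     Dom = fst,
     Cod = (\<lambda>f. fst (snd f)),
     Ide = (\<lambda>a. (a, a, Ide sSh (Cod sSh a))),
     Comp = (\<lambda>g f. (fst f, fst (snd g), Comp sSh (snd (snd g)) (snd (snd f))))\<rparr>"

definition pointed_weq :: "('u::universe sarrow \<times> 'u sarrow \<times> 'u sarrow) set" where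
  "pointed_weq = {f \<in> Arr sSh_pointed. snd (snd f) \<in> C_weq}"

definition H_pointed_hom :: "'u::universe sarrow \<Rightarrow> 'u sarrow \<Rightarrow>
    ('u sarrow \<times> 'u sarrow \<times> 'u sarrow) zstep list set set" where
  "H_pointed_hom = loc_hom sSh_pointed pointed_weq"

text \<open>The class of the constant map to the base point.\<close>

definition H_trivial :: "'u::universe sarrow \<Rightarrow> 'u sarrow \<Rightarrow>
    ('u sarrow \<times> 'u sarrow \<times> 'u sarrow) zstep list set" where
  "H_trivial a x = loc_class sSh_pointed pointed_weq (a, x, Comp sSh x (to_pt (Cod sSh a)))"

section \<open>Spheres\<close>

text \<open>Colimits are determined only up to isomorphism; the following predicates recognise all
  models of the respective pointed simplicial sheaf.\<close>

text \<open>\<open>b\<close> is the quotient of the target of \<open>i\<close> by the source of \<open>i\<close>, pointed by the image of the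
  collapsed subobject.\<close>

definition is_quotient :: "'u sarrow \<Rightarrow> 'u sarrow \<Rightarrow> bool" where
  "is_quotient i b \<longleftrightarrow> (\<exists>p. is_pushout sSh i (to_pt (Dom sSh i)) p b)"

definition is_smash :: "'u::universe sarrow \<Rightarrow> 'u sarrow \<Rightarrow> 'u sarrow \<Rightarrow> bool" where
  "is_smash a b c \<longleftrightarrow> pointed a \<and> pointed b \<and>
     (let A = Cod sSh a; B = Cod sSh b in
      \<exists>i j w. is_pushout sSh a b i j \<and>
        w \<in> Arr sSh \<and> Dom sSh w = Cod sSh i \<and> Cod sSh w = sprod A B \<and>
        Comp sSh (proj1 A B) (Comp sSh w i) = Ide sSh A \<and>
        Comp sSh (proj2 A B) (Comp sSh w i) = Comp sSh b (to_pt A) \<and>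
        Comp sSh (proj1 A B) (Comp sSh w j) = Comp sSh a (to_pt B) \<and>
        Comp sSh (proj2 A B) (Comp sSh w j) = Ide sSh B \<and>
        is_quotient w c)"

inductive is_smash_power :: "'u::universe sarrow \<Rightarrow> nat \<Rightarrow> 'u sarrow \<Rightarrow> bool" for a where
  smash_power_0: "is_coproduct sSh i j \<Longrightarrow> Dom sSh i = pt \<Longrightarrow> Dom sSh j = pt \<Longrightarrow> is_smash_power a 0 i"
| smash_power_Suc: "is_smash_power a n b \<Longrightarrow> is_smash b a c \<Longrightarrow> is_smash_power a (Suc n) c"

definition plane_point :: "complex set \<Rightarrow> complex \<Rightarrow> 'u::universe sarrow" where
  "plane_point A z = (pt, plane_sheaf A, extend pt (\<lambda>n U a. ucode (Inl (const_cmap A z U))))"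

text \<open>The quotient of \<open>plane A\<close> by the coproduct of two of its points.\<close>

definition is_circle :: "complex set \<Rightarrow> complex \<Rightarrow> complex \<Rightarrow> 'u::universe sarrow \<Rightarrow> bool" where
  "is_circle A z z' s \<longleftrightarrow> (\<exists>i j k. is_coproduct sSh i j \<and> Dom sSh i = pt \<and> Dom sSh j = pt \<and>
     k \<in> Arr sSh \<and> Dom sSh k = Cod sSh i \<and> Cod sSh k = plane_sheaf A \<and>
     Comp sSh k i = plane_point A z \<and> Comp sSh k j = plane_point A z' \<and> is_quotient k s)"

definition is_par_sphere :: "nat \<Rightarrow> 'u::universe sarrow \<Rightarrow> bool" where
  "is_par_sphere n a \<longleftrightarrow> (\<exists>s. is_circle UNIV 0 1 s \<and> is_smash_power s n a)"

definition is_iper_sphere :: "complex \<Rightarrow> complex \<Rightarrow> nat \<Rightarrow> 'u::universe sarrow \<Rightarrow> bool" where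
  "is_iper_sphere z1 z2 n a \<longleftrightarrow> (\<exists>s. is_circle (ball 0 1) z1 z2 s \<and> is_smash_power s n a)"

text \<open>The sources of the morphisms that form the parabolic and hyperbolic holotopy sets.\<close>

definition is_par_source :: "nat \<Rightarrow> nat \<Rightarrow> 'u::universe sarrow \<Rightarrow> bool" where
  "is_par_source i j c \<longleftrightarrow> (\<exists>a b. is_smash_power (plane_point (- {0}) 1) j a \<and>
     is_par_sphere (i - j) b \<and> is_smash a b c)"

definition is_iper_source :: "complex \<Rightarrow> complex \<Rightarrow> nat \<Rightarrow> nat \<Rightarrow> 'u::universe sarrow \<Rightarrow> bool" where
  "is_iper_source z1 z2 n m c \<longleftrightarrow> (\<exists>a b. is_iper_sphere z1 z2 n a \<and>
     is_par_sphere m b \<and> is_smash a b c)"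

end

theory Submission
  imports Defs
begin

text \<open>
  Weak equivalences induce bijections on the connected components of the stalks, and a map to a
  constant simplicial sheaf \<open>X\<close> depends only on connected components; hence such maps extend
  uniquely along simplicial weak equivalences, and morphisms to \<open>X\<close> in the simplicial homotopy
  category are the same as maps of simplicial sheaves.  If \<open>X\<close> is hyperbolic, maps to \<open>X\<close> therefore
  also extend uniquely along \<open>C_weq\<close>, so that the pointed homotopy classes are pointed maps, and
  every map from a product of some \<open>Y\<close> with the complex line to \<open>X\<close> is independent of the second
  variable.  This independence passes from the line to its quotient, the parabolic circle, and from
  \<open>B\<close> to \<open>A \<and> B\<close>: the part of a quotient on which a given map equals its value at the base point is a
  simplicial subsheaf through which the colimit cocone factors, hence everything.  So all
  pointed maps from the spheres in question to \<open>X\<close> are constant.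
\<close>

section \<open>Open subspaces and restrictions of morphisms\<close>

text \<open>The notions come without a model structure: localizations are bare zigzags, and weak
  equivalences are read off realizations of stalks. No fibrant replacement of \<open>X\<close> is
  made; a constant simplicial sheaf is itself orthogonal to simplicial weak equivalences, and unique
  extension along arrows is all that the zigzag arguments consume. An extension can be found only
  near a point and must then be glued. As every axiom on presheaves is guarded by
  \<open>complex_space\<close>, this forces a proof that open subspaces of complex spaces are
  complex spaces, charts included. The invariant that is propagated, \<open>insensitive\<close>,
  keeps an arbitrary extra factor \<open>Y\<close>: hyperbolicity supplies it, and for a smash
  product of \<open>A\<close> and \<open>B\<close> the factor \<open>A\<close> is absorbed into it.
  Quotients are known only through their universal property, so no explicit description of their
  sections is at hand. A statement on these sections is proved by building the subobject where it
  holds and splitting its inclusion.\<close>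

lemma open_sub_simps [simp]:
  "space_top (open_sub X V) = subtopology (space_top X) V"
  "sections (open_sub X V) = sections X" "res (open_sub X V) = res X" "scalar (open_sub X V) = scalar X"
  by (simp_all add: open_sub_def)

lemma open_sub_points [simp]: "open_sub X (points X) = X"
  by (simp add: open_sub_def subtopology_topspace)

lemma open_sub_open_sub [simp]: "open_sub (open_sub X V) W = open_sub X (V \<inter> W)"
  by (simp add: open_sub_def subtopology_subtopology)

lemma points_open_sub: "V \<in> opens X \<Longrightarrow> points (open_sub X V) = V"
  using openin_subset by fastforce

lemma opens_open_sub: "V \<in> opens X \<Longrightarrow> opens (open_sub X V) = {W \<in> opens X. W \<subseteq> V}"
  by (auto simp: openin_open_subtopology)

lemma preim_open:
  assumes "continuous_map (space_top X) (space_top Y) f" "W \<in> opens Y"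
  shows "preim X f W \<in> opens X"
  using assms by (auto simp: preim_def continuous_map)

lemma rhomD:
  assumes "g \<in> rhom X Y"
  shows rhom_ext: "fst g \<in> extensional (points X)"
    and rhom_continuous: "continuous_map (space_top X) (space_top Y) (fst g)"
    and rhom_snd_ext: "snd g \<in> extensional (opens Y)"
    and rhom_snd_ext2: "W \<in> opens Y \<Longrightarrow> snd g W \<in> extensional (carrier (sections Y W))"
    and rhom_hom: "W \<in> opens Y \<Longrightarrow> snd g W \<in> ring_hom (sections Y W) (sections X (preim X (fst g) W))"
    and rhom_scalar: "W \<in> opens Y \<Longrightarrow> snd g W (scalar Y W c) = scalar X (preim X (fst g) W) c"
    and rhom_res: "W \<in> opens Y \<Longrightarrow> W' \<in> opens Y \<Longrightarrow> W' \<subseteq> W \<Longrightarrow> r \<in> carrier (sections Y W) \<Longrightarrow>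
      snd g W' (res Y W W' r) = res X (preim X (fst g) W) (preim X (fst g) W') (snd g W r)"
  using assms unfolding rhom_def by (auto simp: case_prod_unfold)

lemma rhom_preim_open: "g \<in> rhom X Y \<Longrightarrow> W \<in> opens Y \<Longrightarrow> preim X (fst g) W \<in> opens X"
  by (rule preim_open[OF rhom_continuous])

lemma rhom_section:
  "g \<in> rhom X Y \<Longrightarrow> W \<in> opens Y \<Longrightarrow> r \<in> carrier (sections Y W) \<Longrightarrow>
    snd g W r \<in> carrier (sections X (preim X (fst g) W))"
  using rhom_hom ring_hom_closed by metis

lemma rhom_eqI:
  assumes "g \<in> rhom X Y" "h \<in> rhom X Y"
    and "\<And>p. p \<in> points X \<Longrightarrow> fst g p = fst h p"
    and "\<And>W r. W \<in> opens Y \<Longrightarrow> r \<in> carrier (sections Y W) \<Longrightarrow> snd g W r = snd h W r"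
  shows "g = h"
proof (rule prod_eqI)
  show "fst g = fst h"
    by (rule extensionalityI[OF rhom_ext[OF assms(1)] rhom_ext[OF assms(2)] assms(3)])
  show "snd g = snd h"
  proof (rule extensionalityI[OF rhom_snd_ext[OF assms(1)] rhom_snd_ext[OF assms(2)]])
    fix W assume "W \<in> opens Y"
    then show "snd g W = snd h W"
      using extensionalityI[OF rhom_snd_ext2[OF assms(1)] rhom_snd_ext2[OF assms(2)]] assms(4) by blast
  qed
qed

section \<open>Ringed spaces with weakened axioms\<close>

lemma
  assumes "cringed_space X"
  shows cringed_algebra: "\<forall>V\<in>opens X. cring (sections X V) \<and> scalar X V \<in> ring_hom complex_ring (sections X V)"
    and cringed_res: "\<forall>V\<in>opens X. \<forall>W\<in>opens X. W \<subseteq> V \<longrightarrow>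
        res X V W \<in> ring_hom (sections X V) (sections X W) \<and> (\<forall>c. res X V W (scalar X V c) = scalar X W c)"
    and cringed_id: "\<forall>V\<in>opens X. \<forall>r\<in>carrier (sections X V). res X V V r = r"
    and cringed_trans: "\<forall>V\<in>opens X. \<forall>W\<in>opens X. \<forall>W'\<in>opens X. W' \<subseteq> W \<and> W \<subseteq> V \<longrightarrow>
        (\<forall>r\<in>carrier (sections X V). res X W W' (res X V W r) = res X V W' r)"
    and cringed_glue: "\<forall>\<V> s. \<V> \<subseteq> opens X \<and> (\<forall>V\<in>\<V>. s V \<in> carrier (sections X V)) \<and>
        (\<forall>V\<in>\<V>. \<forall>W\<in>\<V>. res X V (V \<inter> W) (s V) = res X W (V \<inter> W) (s W)) \<longrightarrow>
        (\<exists>!r. r \<in> carrier (sections X (\<Union>\<V>)) \<and> (\<forall>V\<in>\<V>. res X (\<Union>\<V>) V r = s V))"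
  using assms[unfolded cringed_space_def]
  by - (elim conjE, assumption)+

text \<open>Exactly the closure that lets a homomorphism be cut down to the carrier and stay in
  \<open>ring_hom\<close>, which speaks of products, sums and one.\<close>

definition ring_closed :: "'r ring \<Rightarrow> bool" where
  "ring_closed R \<longleftrightarrow> \<one>\<^bsub>R\<^esub> \<in> carrier R \<and>
     (\<forall>x\<in>carrier R. \<forall>y\<in>carrier R. x \<otimes>\<^bsub>R\<^esub> y \<in> carrier R \<and> x \<oplus>\<^bsub>R\<^esub> y \<in> carrier R)"

text \<open>A weakening of \<open>cringed_space\<close> that, unlike the ring axioms for the zero element, is
  visibly invariant under \<open>riso\<close>.\<close>

definition precringed :: "('p, 'r) cringed \<Rightarrow> bool" where
  "precringed X \<longleftrightarrow>
     (\<forall>V\<in>opens X. ring_closed (sections X V) \<and> (\<forall>c. scalar X V c \<in> carrier (sections X V))) \<and>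
     (\<forall>V\<in>opens X. \<forall>W\<in>opens X. W \<subseteq> V \<longrightarrow>
        res X V W \<in> ring_hom (sections X V) (sections X W) \<and> (\<forall>c. res X V W (scalar X V c) = scalar X W c)) \<and>
     (\<forall>V\<in>opens X. \<forall>r\<in>carrier (sections X V). res X V V r = r) \<and>
     (\<forall>V\<in>opens X. \<forall>W\<in>opens X. \<forall>W'\<in>opens X. W' \<subseteq> W \<and> W \<subseteq> V \<longrightarrow>
        (\<forall>r\<in>carrier (sections X V). res X W W' (res X V W r) = res X V W' r))"

lemma precringed_if_cringed_space: "cringed_space X \<Longrightarrow> precringed X"
proof -
  assume X: "cringed_space X"
  have "ring_closed (sections X V) \<and> (\<forall>c. scalar X V c \<in> carrier (sections X V))" if V: "V \<in> opens X" for V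
  proof -
    interpret cring "sections X V" using cringed_algebra[OF X] V by blast
    show ?thesis
      using cringed_algebra[OF X] V ring_hom_closed[of "scalar X V" complex_ring "sections X V"]
      by (auto simp: ring_closed_def complex_ring_def)
  qed
  then have "\<forall>V\<in>opens X. ring_closed (sections X V) \<and> (\<forall>c. scalar X V c \<in> carrier (sections X V))"
    by blast
  then show ?thesis
    unfolding precringed_def by (intro conjI cringed_res[OF X] cringed_id[OF X] cringed_trans[OF X])
qed

lemma
  assumes "precringed X"
  shows precringed_algebra: "\<forall>V\<in>opens X. ring_closed (sections X V) \<and> (\<forall>c. scalar X V c \<in> carrier (sections X V))"
    and precringed_res: "\<forall>V\<in>opens X. \<forall>W\<in>opens X. W \<subseteq> V \<longrightarrow>
        res X V W \<in> ring_hom (sections X V) (sections X W) \<and> (\<forall>c. res X V W (scalar X V c) = scalar X W c)"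
    and precringed_id: "\<forall>V\<in>opens X. \<forall>r\<in>carrier (sections X V). res X V V r = r"
    and precringed_trans: "\<forall>V\<in>opens X. \<forall>W\<in>opens X. \<forall>W'\<in>opens X. W' \<subseteq> W \<and> W \<subseteq> V \<longrightarrow>
        (\<forall>r\<in>carrier (sections X V). res X W W' (res X V W r) = res X V W' r)"
  using assms[unfolded precringed_def]
  by - (elim conjE, assumption)+

lemma res_hom:
  "precringed X \<Longrightarrow> V \<in> opens X \<Longrightarrow> W \<in> opens X \<Longrightarrow> W \<subseteq> V \<Longrightarrow>
    res X V W \<in> ring_hom (sections X V) (sections X W)"
  using precringed_res by blast

lemma res_section:
  "precringed X \<Longrightarrow> V \<in> opens X \<Longrightarrow> W \<in> opens X \<Longrightarrow> W \<subseteq> V \<Longrightarrow> r \<in> carrier (sections X V) \<Longrightarrow>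
    res X V W r \<in> carrier (sections X W)"
  by (rule ring_hom_closed[OF res_hom])

lemma res_scalar:
  "precringed X \<Longrightarrow> V \<in> opens X \<Longrightarrow> W \<in> opens X \<Longrightarrow> W \<subseteq> V \<Longrightarrow>
    res X V W (scalar X V c) = scalar X W c"
  using precringed_res by blast

lemma res_id:
  "precringed X \<Longrightarrow> V \<in> opens X \<Longrightarrow> r \<in> carrier (sections X V) \<Longrightarrow> res X V V r = r"
  using precringed_id by blast

lemma res_res:
  "precringed X \<Longrightarrow> V \<in> opens X \<Longrightarrow> W \<in> opens X \<Longrightarrow> W' \<in> opens X \<Longrightarrow> W' \<subseteq> W \<Longrightarrow> W \<subseteq> V \<Longrightarrow>
    r \<in> carrier (sections X V) \<Longrightarrow> res X W W' (res X V W r) = res X V W' r"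
  using precringed_trans by blast

lemma sections_closed: "precringed X \<Longrightarrow> V \<in> opens X \<Longrightarrow> ring_closed (sections X V)"
  using precringed_algebra by blast

lemma scalar_section: "precringed X \<Longrightarrow> V \<in> opens X \<Longrightarrow> scalar X V c \<in> carrier (sections X V)"
  using precringed_algebra by blast

lemma ring_hom_restrict':
  assumes "ring_closed R" "h \<in> ring_hom R S"
  shows "restrict h (carrier R) \<in> ring_hom R S"
  using assms by (auto simp: ring_hom_def ring_closed_def)

section \<open>Restriction of spaces and morphisms to open subspaces\<close>

lemma cringed_space_open_sub:
  assumes X: "cringed_space X" and V: "V \<in> opens X"
  shows "cringed_space (open_sub X V)"
proof -
  have ops: "opens (open_sub X V) \<subseteq> opens X" using opens_open_sub[OF V] by blast
  show ?thesis
    unfolding cringed_space_def open_sub_simps(2-4)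
  proof (intro conjI, goal_cases)
    case 1
    then show ?case using cringed_algebra[OF X] ops by blast
  next
    case 2
    then show ?case using cringed_res[OF X] ops by blast
  next
    case 3
    then show ?case using cringed_id[OF X] ops by blast
  next
    case 4
    show ?case
    proof (intro ballI impI, elim conjE)
      fix V' W W' r
      assume "V' \<in> opens (open_sub X V)" "W \<in> opens (open_sub X V)" "W' \<in> opens (open_sub X V)"
        "r \<in> carrier (sections X V')" "W' \<subseteq> W" "W \<subseteq> V'"
      then show "res X W W' (res X V' W r) = res X V' W' r"
        using ops by (intro cringed_trans[OF X, rule_format]) blast+
    qed
  next
    case 5
    show ?case
    proof (intro allI impI, elim conjE)
      fix \<V> s
      assume *: "\<V> \<subseteq> opens (open_sub X V)" "\<forall>V\<in>\<V>. s V \<in> carrier (sections X V)"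
        "\<forall>V\<in>\<V>. \<forall>W\<in>\<V>. res X V (V \<inter> W) (s V) = res X W (V \<inter> W) (s W)"
      have "\<V> \<subseteq> opens X" using ops *(1) by blast
      then show "\<exists>!r. r \<in> carrier (sections X (\<Union>\<V>)) \<and> (\<forall>V\<in>\<V>. res X (\<Union>\<V>) V r = s V)"
        using cringed_glue[OF X, rule_format, of \<V> s] *(2,3) by blast
    qed
  qed
qed

text \<open>This is a morphism from \<open>open_sub X V\<close> to \<open>open_sub Y V'\<close> if \<open>V\<close> lies in the preimage of \<open>V'\<close>;
  \<open>incl\<close> is the special case of the identity.\<close>

definition rrestr :: "('p, 'r) cringed \<Rightarrow> ('q, 's) cringed \<Rightarrow> ('p, 'q, 'r, 's) rmap \<Rightarrow>
    'p set \<Rightarrow> 'q set \<Rightarrow> ('p, 'q, 'r, 's) rmap" where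
  "rrestr X Y g V V' =
     (\<lambda>p\<in>V. fst g p,
      \<lambda>W\<in>opens (open_sub Y V'). \<lambda>r\<in>carrier (sections Y W).
        res X (preim X (fst g) W) (preim X (fst g) W \<inter> V) (snd g W r))"

lemma preim_rrestr:
  "V \<in> opens X \<Longrightarrow> preim (open_sub X V) (fst (rrestr X Y g V V')) W = preim X (fst g) W \<inter> V"
  using points_open_sub[of V X] unfolding preim_def rrestr_def by auto

lemma rrestr_in_rhom:
  assumes X: "precringed X" and Y: "precringed Y" and g: "g \<in> rhom X Y" and V: "V \<in> opens X" and V': "V' \<in> opens Y"
    and sub: "V \<subseteq> preim X (fst g) V'"
  shows "rrestr X Y g V V' \<in> rhom (open_sub X V) (open_sub Y V')"
proof -
  let ?h = "rrestr X Y g V V'"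
  have ops: "opens (open_sub Y V') \<subseteq> opens Y" using opens_open_sub[OF V'] by blast
  note [simp del] = Int_iff
  have pi: "preim X (fst g) W \<inter> V \<in> opens X" if "W \<in> opens Y" for W
    using rhom_preim_open[OF g that] V by auto
  have 1: "fst ?h \<in> extensional (points (open_sub X V))"
    unfolding points_open_sub[OF V] rrestr_def by simp
  have "continuous_map (subtopology (space_top X) V) (subtopology (space_top Y) V') (fst g)"
    using rhom_continuous[OF g] sub
    by (auto simp: continuous_map_in_subtopology preim_def intro: continuous_map_from_subtopology)
  then have 2: "continuous_map (space_top (open_sub X V)) (space_top (open_sub Y V')) (fst ?h)"
    unfolding open_sub_simps
    by (rule continuous_map_eq) (auto simp: rrestr_def Int_iff)
  have 3: "snd ?h \<in> extensional (opens (open_sub Y V'))"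
    unfolding rrestr_def snd_conv by (rule restrict_extensional)
  have sndh: "snd ?h W = (\<lambda>r\<in>carrier (sections Y W).
        res X (preim X (fst g) W) (preim X (fst g) W \<inter> V) (snd g W r))" if "W \<in> opens (open_sub Y V')" for W
    unfolding rrestr_def snd_conv using that by (rule restrict_apply')
  have 4: "snd ?h W \<in> extensional (carrier (sections (open_sub Y V') W)) \<and>
      snd ?h W \<in> ring_hom (sections (open_sub Y V') W) (sections (open_sub X V) (preim (open_sub X V) (fst ?h) W)) \<and>
      (\<forall>c. snd ?h W (scalar (open_sub Y V') W c) = scalar (open_sub X V) (preim (open_sub X V) (fst ?h) W) c)"
    if W: "W \<in> opens (open_sub Y V')" for W
  proof (intro conjI allI)
    have WY: "W \<in> opens Y" using W ops by blast
    let ?P = "preim X (fst g) W"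
    have P: "?P \<in> opens X" using rhom_preim_open[OF g WY] .
    show "snd ?h W \<in> extensional (carrier (sections (open_sub Y V') W))"
      unfolding sndh[OF W] by simp
    have rh: "res X ?P (?P \<inter> V) \<in> ring_hom (sections X ?P) (sections X (?P \<inter> V))"
      by (rule res_hom[OF X P pi[OF WY]]) auto
    have "(\<lambda>r. res X ?P (?P \<inter> V) (snd g W r)) \<in> ring_hom (sections Y W) (sections X (?P \<inter> V))"
      using ring_hom_trans[OF rhom_hom[OF g WY] rh] by (simp add: o_def)
    then show "snd ?h W \<in> ring_hom (sections (open_sub Y V') W) (sections (open_sub X V) (preim (open_sub X V) (fst ?h) W))"
      unfolding sndh[OF W] preim_rrestr[OF V] open_sub_simps
      by (rule ring_hom_restrict'[OF sections_closed[OF Y WY]])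
    show "snd ?h W (scalar (open_sub Y V') W c) = scalar (open_sub X V) (preim (open_sub X V) (fst ?h) W) c" for c
      unfolding sndh[OF W] preim_rrestr[OF V] open_sub_simps restrict_apply'[OF scalar_section[OF Y WY]]
        rhom_scalar[OF g WY]
      by (rule res_scalar[OF X P pi[OF WY]]) auto
  qed
  have 5: "snd ?h W' (res (open_sub Y V') W W' r) =
      res (open_sub X V) (preim (open_sub X V) (fst ?h) W) (preim (open_sub X V) (fst ?h) W') (snd ?h W r)"
    if W: "W \<in> opens (open_sub Y V')" "W' \<in> opens (open_sub Y V')" "W' \<subseteq> W"
      "r \<in> carrier (sections (open_sub Y V') W)" for W W' r
  proof -
    have WY: "W \<in> opens Y" "W' \<in> opens Y" "r \<in> carrier (sections Y W)" using W ops by auto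
    let ?P = "preim X (fst g) W" and ?P' = "preim X (fst g) W'"
    have P: "?P \<in> opens X" "?P' \<in> opens X" using rhom_preim_open[OF g] WY by auto
    have PP: "?P' \<subseteq> ?P" using W(3) by (auto simp: preim_def)
    have PPV: "?P' \<inter> V \<subseteq> ?P \<inter> V" using PP by blast
    have s: "snd g W r \<in> carrier (sections X ?P)" by (rule rhom_section[OF g WY(1,3)])
    have "snd ?h W' (res Y W W' r) = res X ?P' (?P' \<inter> V) (snd g W' (res Y W W' r))"
      unfolding sndh[OF W(2)] by (rule restrict_apply', rule res_section[OF Y WY(1,2) W(3) WY(3)])
    also have "\<dots> = res X ?P' (?P' \<inter> V) (res X ?P ?P' (snd g W r))"
      unfolding rhom_res[OF g WY(1,2) W(3) WY(3)] ..
    also have "\<dots> = res X ?P (?P' \<inter> V) (snd g W r)"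
      by (rule res_res[OF X P pi[OF WY(2)] _ PP s]) simp
    also have "\<dots> = res X (?P \<inter> V) (?P' \<inter> V) (res X ?P (?P \<inter> V) (snd g W r))"
      by (rule res_res[OF X P(1) pi[OF WY(1)] pi[OF WY(2)] PPV _ s, symmetric]) simp
    also have "res X ?P (?P \<inter> V) (snd g W r) = snd ?h W r"
      unfolding sndh[OF W(1)] using WY(3) by simp
    finally show ?thesis unfolding preim_rrestr[OF V] open_sub_simps .
  qed
  show ?thesis unfolding rhom_def using 1 2 3 4 5 by (auto simp: case_prod_unfold simp del: open_sub_simps)
qed

lemma rhom_id: "precringed X \<Longrightarrow> rid X \<in> rhom X X"
proof -
  assume X: "precringed X"
  have p: "preim X (\<lambda>p\<in>points X. p) W = W" if "W \<in> opens X" for W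
    using that openin_subset by (fastforce simp: preim_def)
  have "(\<lambda>r. r) \<in> ring_hom (sections X W) (sections X W)" for W by (simp add: ring_hom_def)
  then have "restrict (\<lambda>r. r) (carrier (sections X W)) \<in> ring_hom (sections X W) (sections X W)"
    if "W \<in> opens X" for W
    by (rule ring_hom_restrict'[OF sections_closed[OF X that]])
  moreover have "continuous_map (space_top X) (space_top X) (\<lambda>p\<in>points X. p)"
    by (rule continuous_map_eq[of _ _ "\<lambda>p. p"]) auto
  ultimately show ?thesis
    using scalar_section[OF X] res_section[OF X]
    unfolding rhom_def rid_def by (auto simp: p)
qed

lemma rcomp_in_rhom:
  assumes X: "precringed X" and Y: "precringed Y" and Z: "precringed Z"
    and f: "f \<in> rhom X Y" and g: "g \<in> rhom Y Z"
  shows "rcomp X Y Z g f \<in> rhom X Z"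
proof -
  let ?h = "rcomp X Y Z g f"
  have fst_h: "fst ?h = (\<lambda>p\<in>points X. fst g (fst f p))" by (simp add: rcomp_def)
  have pre: "preim X (fst ?h) W = preim X (fst f) (preim Y (fst g) W)" for W
    using rhom_continuous[OF f] unfolding fst_h preim_def by (auto simp: continuous_map_def)
  have sndh: "snd ?h W = (\<lambda>r\<in>carrier (sections Z W). snd f (preim Y (fst g) W) (snd g W r))"
    if "W \<in> opens Z" for W
    unfolding rcomp_def snd_conv using that by (rule restrict_apply')
  have 1: "fst ?h \<in> extensional (points X)" unfolding fst_h by simp
  have 2: "continuous_map (space_top X) (space_top Z) (fst ?h)"
    unfolding fst_h
    by (rule continuous_map_eq[OF continuous_map_compose[OF rhom_continuous[OF f] rhom_continuous[OF g]]]) auto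
  have 3: "snd ?h \<in> extensional (opens Z)"
    unfolding rcomp_def snd_conv by (rule restrict_extensional)
  have 4: "snd ?h W \<in> extensional (carrier (sections Z W)) \<and>
      snd ?h W \<in> ring_hom (sections Z W) (sections X (preim X (fst ?h) W)) \<and>
      (\<forall>c. snd ?h W (scalar Z W c) = scalar X (preim X (fst ?h) W) c)" if W: "W \<in> opens Z" for W
  proof (intro conjI allI)
    let ?P = "preim Y (fst g) W"
    have P: "?P \<in> opens Y" by (rule rhom_preim_open[OF g W])
    show "snd ?h W \<in> extensional (carrier (sections Z W))" unfolding sndh[OF W] by simp
    have "(\<lambda>r. snd f ?P (snd g W r)) \<in> ring_hom (sections Z W) (sections X (preim X (fst f) ?P))"
      using ring_hom_trans[OF rhom_hom[OF g W] rhom_hom[OF f P]] by (simp add: o_def)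
    then show "snd ?h W \<in> ring_hom (sections Z W) (sections X (preim X (fst ?h) W))"
      unfolding sndh[OF W] pre by (rule ring_hom_restrict'[OF sections_closed[OF Z W]])
    show "snd ?h W (scalar Z W c) = scalar X (preim X (fst ?h) W) c" for c
      unfolding sndh[OF W] pre restrict_apply'[OF scalar_section[OF Z W]] rhom_scalar[OF g W]
      by (rule rhom_scalar[OF f P])
  qed
  have 5: "snd ?h W' (res Z W W' r) = res X (preim X (fst ?h) W) (preim X (fst ?h) W') (snd ?h W r)"
    if W: "W \<in> opens Z" "W' \<in> opens Z" "W' \<subseteq> W" "r \<in> carrier (sections Z W)" for W W' r
  proof -
    let ?P = "preim Y (fst g) W" and ?P' = "preim Y (fst g) W'"
    have P: "?P \<in> opens Y" "?P' \<in> opens Y" using rhom_preim_open[OF g] W by auto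
    have PP: "?P' \<subseteq> ?P" using W(3) by (auto simp: preim_def)
    have "snd ?h W' (res Z W W' r) = snd f ?P' (snd g W' (res Z W W' r))"
      unfolding sndh[OF W(2)] by (rule restrict_apply', rule res_section[OF Z W(1-4)])
    also have "\<dots> = snd f ?P' (res Y ?P ?P' (snd g W r))" unfolding rhom_res[OF g W] ..
    also have "\<dots> = res X (preim X (fst f) ?P) (preim X (fst f) ?P') (snd f ?P (snd g W r))"
      by (rule rhom_res[OF f P PP rhom_section[OF g W(1,4)]])
    also have "snd f ?P (snd g W r) = snd ?h W r" unfolding sndh[OF W(1)] using W(4) by simp
    finally show ?thesis unfolding pre .
  qed
  show ?thesis unfolding rhom_def using 1 2 3 4 5 by (auto simp: case_prod_unfold)
qed

text \<open>Restriction of morphisms is functorial. This yields restricted isomorphisms as well as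
  the composition law for pulled back sections.\<close>

lemma rcomp_rrestr:
  assumes X: "precringed X" and Y: "precringed Y" and Z: "precringed Z"
    and g: "g \<in> rhom X Y" and h: "h \<in> rhom Y Z"
    and V: "V \<in> opens X" "V' \<in> opens Y" "V'' \<in> opens Z"
    and sub: "V \<subseteq> preim X (fst g) V'" "V' \<subseteq> preim Y (fst h) V''"
  shows "rcomp (open_sub X V) (open_sub Y V') (open_sub Z V'') (rrestr Y Z h V' V'') (rrestr X Y g V V') =
    rrestr X Z (rcomp X Y Z h g) V V''"
proof -
  let ?g = "rrestr X Y g V V'" and ?h = "rrestr Y Z h V' V''" and ?k = "rcomp X Y Z h g"
  have gV: "fst g p \<in> V'" if "p \<in> V" for p using that sub(1) by (auto simp: preim_def)
  have pre: "preim X (fst ?k) W = preim X (fst g) (preim Y (fst h) W)" for W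
    using rhom_continuous[OF g] by (auto simp: continuous_map_def preim_def rcomp_def)
  have VX: "p \<in> points X" if "p \<in> V" for p using that V(1) openin_subset by blast
  show ?thesis
  proof (rule prod_eqI)
    show "fst (rcomp (open_sub X V) (open_sub Y V') (open_sub Z V'') ?h ?g) = fst (rrestr X Z ?k V V'')"
      unfolding rcomp_def fst_conv points_open_sub[OF V(1)]
      by (auto simp: rrestr_def gV VX intro!: restrict_ext)
    have "snd ?g (preim (open_sub Y V') (fst ?h) W) (snd ?h W r) =
        res X (preim X (fst ?k) W) (preim X (fst ?k) W \<inter> V) (snd ?k W r)"
      if W: "W \<in> opens (open_sub Z V'')" "r \<in> carrier (sections Z W)" for W r
    proof -
      have WZ: "W \<in> opens Z" using W opens_open_sub[OF V(3)] by blast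
      let ?P = "preim Y (fst h) W"
      let ?Q = "preim X (fst g) ?P"
      have P: "?P \<in> opens Y" "?P \<inter> V' \<in> opens Y" "?P \<inter> V' \<subseteq> ?P" "?P \<inter> V' \<in> opens (open_sub Y V')"
        using rhom_preim_open[OF h WZ] V(2) opens_open_sub[OF V(2)] by auto
      have s: "snd h W r \<in> carrier (sections Y ?P)" by (rule rhom_section[OF h WZ W(2)])
      let ?R = "preim X (fst g) (?P \<inter> V')"
      have Q: "?Q \<in> opens X" "?R \<in> opens X" "?R \<subseteq> ?Q" "?R \<inter> V \<subseteq> ?R" "?R \<inter> V \<in> opens X"
        using rhom_preim_open[OF g P(1)] rhom_preim_open[OF g P(2)] V(1) by (auto simp: preim_def)
      \<comment> \<open>The cut-down by \<open>V'\<close> is invisible inside \<open>V\<close>,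
        because \<open>g\<close> maps \<open>V\<close> into \<open>V'\<close>.\<close>
      have RV: "?R \<inter> V = ?Q \<inter> V" using gV by (auto simp: preim_def)
      have h1: "snd ?h W r = res Y ?P (?P \<inter> V') (snd h W r)"
        unfolding rrestr_def snd_conv restrict_apply'[OF W(1)] using W(2) by simp
      have g1: "snd ?g (?P \<inter> V') t = res X ?R (?R \<inter> V) (snd g (?P \<inter> V') t)" if "t \<in> carrier (sections Y (?P \<inter> V'))" for t
        unfolding rrestr_def snd_conv restrict_apply'[OF P(4)] using that by simp
      have "snd ?g (preim (open_sub Y V') (fst ?h) W) (snd ?h W r) = snd ?g (?P \<inter> V') (res Y ?P (?P \<inter> V') (snd h W r))"
        unfolding preim_rrestr[OF V(2)] h1 ..
      also have "\<dots> = res X ?R (?R \<inter> V) (snd g (?P \<inter> V') (res Y ?P (?P \<inter> V') (snd h W r)))"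
        by (rule g1, rule res_section[OF Y P(1-3) s])
      also have "\<dots> = res X ?R (?R \<inter> V) (res X ?Q ?R (snd g ?P (snd h W r)))"
        unfolding rhom_res[OF g P(1-3) s] ..
      also have "\<dots> = res X ?Q (?R \<inter> V) (snd g ?P (snd h W r))"
        by (rule res_res[OF X Q(1,2,5,4,3) rhom_section[OF g P(1) s]])
      also have "snd g ?P (snd h W r) = snd ?k W r"
        unfolding rcomp_def snd_conv restrict_apply'[OF WZ] using W(2) by simp
      finally show ?thesis unfolding pre RV .
    qed
    then show "snd (rcomp (open_sub X V) (open_sub Y V') (open_sub Z V'') ?h ?g) = snd (rrestr X Z ?k V V'')"
      unfolding rcomp_def[of "open_sub X V"] rrestr_def[of X Z] snd_conv open_sub_simps(2)
      by (intro restrict_ext) blast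
  qed
qed

lemma incl_eq_rrestr:
  assumes V: "V \<in> opens X" "V' \<in> opens X"
  shows "incl X V V' = rrestr X X (rid X) V V'"
proof -
  have p: "preim X (\<lambda>p\<in>points X. p) W = W" if "W \<in> opens X" for W
    using that openin_subset by (fastforce simp: preim_def)
  have sub: "opens (open_sub X V') \<subseteq> opens X" using opens_open_sub[OF V(2)] by blast
  have "V \<subseteq> points X" using V openin_subset by auto
  then have "(\<lambda>p\<in>V. p) = (\<lambda>p\<in>V. (\<lambda>p\<in>points X. p) p)" by (intro restrict_ext) auto
  then show ?thesis unfolding incl_def rrestr_def rid_def fst_conv snd_conv
    using sub by (auto intro!: restrict_ext simp: p subset_iff)
qed

lemma rrestr_points: "g \<in> rhom X Y \<Longrightarrow> precringed X \<Longrightarrow> precringed Y \<Longrightarrow> rrestr X Y g (points X) (points Y) = g"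
proof -
  assume g: "g \<in> rhom X Y" and X: "precringed X" and Y: "precringed Y"
  have "rrestr X Y g (points X) (points Y) \<in> rhom (open_sub X (points X)) (open_sub Y (points Y))"
    by (rule rrestr_in_rhom[OF X Y g])
      (use rhom_continuous[OF g] in \<open>auto simp: preim_def continuous_map_def\<close>)
  then have r: "rrestr X Y g (points X) (points Y) \<in> rhom X Y" by simp
  show ?thesis
  proof (rule rhom_eqI[OF r g])
    fix W s assume W: "W \<in> opens Y" "s \<in> carrier (sections Y W)"
    have "preim X (fst g) W \<inter> points X = preim X (fst g) W" by (auto simp: preim_def)
    then show "snd (rrestr X Y g (points X) (points Y)) W s = snd g W s"
      using W res_id[OF X rhom_preim_open[OF g W(1)] rhom_section[OF g W]]
      by (simp add: rrestr_def)
  qed (simp add: rrestr_def)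
qed

lemma
  assumes "g \<in> rhom X Y" "precringed X" "precringed Y"
  shows rcomp_rid: "rcomp X X Y g (rid X) = g" and rid_rcomp: "rcomp X Y Y (rid Y) g = g"
proof -
  have p: "preim Y (\<lambda>p\<in>points Y. p) W = W" if "W \<in> opens Y" for W
    using that openin_subset by (fastforce simp: preim_def)
  show "rcomp X X Y g (rid X) = g"
    by (rule rhom_eqI[OF rcomp_in_rhom[OF assms(2,2,3) rhom_id[OF assms(2)] assms(1)] assms(1)])
      (use rhom_preim_open[OF assms(1)] rhom_section[OF assms(1)] in \<open>auto simp: rcomp_def rid_def\<close>)
  have "fst g p \<in> points Y" if "p \<in> points X" for p
    using rhom_continuous[OF assms(1)] that by (auto simp: continuous_map_def)
  then show "rcomp X Y Y (rid Y) g = g"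
    by (intro rhom_eqI[OF rcomp_in_rhom[OF assms(2,3,3) assms(1) rhom_id[OF assms(3)]] assms(1)])
      (auto simp: rcomp_def rid_def p)
qed

section \<open>Isomorphisms and open subspaces\<close>

lemma rid_open_sub:
  assumes X: "precringed X" and V: "V \<in> opens X"
  shows "rid (open_sub X V) = incl X V V"
proof -
  have "(\<lambda>W\<in>opens (open_sub X V). \<lambda>r\<in>carrier (sections X W). r) =
      (\<lambda>W\<in>opens (open_sub X V). \<lambda>r\<in>carrier (sections X W). res X W (W \<inter> V) r)"
    using res_id[OF X] opens_open_sub[OF V]
    by (auto intro!: restrict_ext simp: Int_absorb2)
  then show ?thesis unfolding rid_def incl_def using points_open_sub[OF V] by simp
qed

text \<open>Restrict both inverse morphisms; by \<open>rcomp_rrestr\<close> their composites are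
  restricted identities, which are the identities of the open subspaces.\<close>

lemma riso_open_sub:
  assumes X: "precringed X" and Y: "precringed Y"
    and f: "f \<in> rhom X Y" and g: "g \<in> rhom Y X"
    and gf: "rcomp X Y X g f = rid X" and fg: "rcomp Y X Y f g = rid Y"
    and W: "W \<in> opens Y"
  shows "riso (open_sub X (preim X (fst f) W)) (open_sub Y W)"
proof -
  let ?V = "preim X (fst f) W"
  have V: "?V \<in> opens X" by (rule rhom_preim_open[OF f W])
  have gfp: "fst g (fst f p) = p" if "p \<in> points X" for p
    using fun_cong[OF arg_cong[OF gf, of fst], of p] that by (simp add: rcomp_def rid_def)
  have fgp: "fst f (fst g p) = p" if "p \<in> points Y" for p
    using fun_cong[OF arg_cong[OF fg, of fst], of p] that by (simp add: rcomp_def rid_def)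
  have WY: "W \<subseteq> points Y" using W openin_subset by auto
  have sub: "?V \<subseteq> preim X (fst f) W" "W \<subseteq> preim Y (fst g) ?V"
    using WY fgp rhom_continuous[OF g] by (auto simp: preim_def continuous_map_def)
  have "rrestr X Y f ?V W \<in> rhom (open_sub X ?V) (open_sub Y W)"
    by (rule rrestr_in_rhom[OF X Y f V W sub(1)])
  moreover have "rrestr Y X g W ?V \<in> rhom (open_sub Y W) (open_sub X ?V)"
    by (rule rrestr_in_rhom[OF Y X g W V sub(2)])
  moreover have "rcomp (open_sub X ?V) (open_sub Y W) (open_sub X ?V) (rrestr Y X g W ?V) (rrestr X Y f ?V W) = rid (open_sub X ?V)"
    unfolding rcomp_rrestr[OF X Y X f g V W V sub] gf rid_open_sub[OF X V] incl_eq_rrestr[OF V V] ..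
  moreover have "rcomp (open_sub Y W) (open_sub X ?V) (open_sub Y W) (rrestr X Y f ?V W) (rrestr Y X g W ?V) = rid (open_sub Y W)"
    unfolding rcomp_rrestr[OF Y X Y g f W V W sub(2,1)] fg rid_open_sub[OF Y W] incl_eq_rrestr[OF W W] ..
  ultimately show ?thesis unfolding riso_def by blast
qed

text \<open>Transport of structure: restrictions in \<open>Y\<close> are those of \<open>X\<close>
  conjugated by the isomorphism. It provides the axioms for a local model, as the image of an open
  piece of a complex space, without any computation with \<open>germ_mod\<close>.\<close>

lemma precringed_riso:
  assumes X: "precringed X" and f: "f \<in> rhom X Y" and g: "g \<in> rhom Y X"
    and gf: "rcomp X Y X g f = rid X" and fg: "rcomp Y X Y f g = rid Y"
  shows "precringed Y"
proof -
  have fgp: "fst f (fst g p) = p" if "p \<in> points Y" for p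
    using fun_cong[OF arg_cong[OF fg, of fst], of p] that by (simp add: rcomp_def rid_def)
  define pf where "pf W = preim X (fst f) W" for W
  have pf: "pf W \<in> opens X" if "W \<in> opens Y" for W
    using rhom_preim_open[OF f that] by (simp add: pf_def)
  have pg: "preim Y (fst g) (pf W) = W" if "W \<in> opens Y" for W
    using that openin_subset[of "space_top Y" W] fgp rhom_continuous[OF g]
    by (auto simp: pf_def preim_def continuous_map_def)
  have pf_mono: "pf W' \<subseteq> pf W" if "W' \<subseteq> W" for W W' using that by (auto simp: pf_def preim_def)
  define \<phi> where "\<phi> = snd f"
  \<comment> \<open>Indexed by open sets of \<open>Y\<close> through \<open>pf\<close>, the maps
    \<open>\<phi> W\<close> and \<open>\<gamma> W\<close> are inverse to each other between the
    sections over \<open>W\<close> and those over its preimage.\<close>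
  define \<gamma> where "\<gamma> W = snd g (pf W)" for W
  have gam_phi: "\<gamma> W (\<phi> W s) = s" if "W \<in> opens Y" "s \<in> carrier (sections Y W)" for W s
    using fun_cong[OF fun_cong[OF arg_cong[OF fg, of snd], of W], of s] that
    by (simp add: rcomp_def rid_def \<phi>_def \<gamma>_def pf_def)
  have phi_gam: "\<phi> W (\<gamma> W r) = r" if "W \<in> opens Y" "r \<in> carrier (sections X (pf W))" for W r
    using fun_cong[OF fun_cong[OF arg_cong[OF gf, of snd], of "pf W"], of r] that pf[OF that(1)] pg[OF that(1)]
    by (simp add: rcomp_def rid_def \<phi>_def \<gamma>_def)
  have phi: "\<phi> W \<in> ring_hom (sections Y W) (sections X (pf W))" if "W \<in> opens Y" for W
    using rhom_hom[OF f that] by (simp add: \<phi>_def pf_def)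
  have gam: "\<gamma> W \<in> ring_hom (sections X (pf W)) (sections Y W)" if "W \<in> opens Y" for W
    using rhom_hom[OF g pf[OF that]] pg[OF that] by (simp add: \<gamma>_def)
  have gam_scalar: "\<gamma> W (scalar X (pf W) c) = scalar Y W c" if "W \<in> opens Y" for W c
    using rhom_scalar[OF g pf[OF that]] pg[OF that] by (simp add: \<gamma>_def)
  have gam_res: "\<gamma> W' (res X (pf W) (pf W') r) = res Y W W' (\<gamma> W r)"
    if "W \<in> opens Y" "W' \<in> opens Y" "W' \<subseteq> W" "r \<in> carrier (sections X (pf W))" for W W' r
    using rhom_res[OF g pf[OF that(1)] pf[OF that(2)] pf_mono[OF that(3)] that(4)] pg that by (simp add: \<gamma>_def)
  have phiC: "\<phi> W s \<in> carrier (sections X (pf W))" if "W \<in> opens Y" "s \<in> carrier (sections Y W)" for W s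
    by (rule ring_hom_closed[OF phi[OF that(1)] that(2)])
  have gamC: "\<gamma> W s \<in> carrier (sections Y W)" if "W \<in> opens Y" "s \<in> carrier (sections X (pf W))" for W s
    by (rule ring_hom_closed[OF gam[OF that(1)] that(2)])
  have resY: "res Y W W' s = \<gamma> W' (res X (pf W) (pf W') (\<phi> W s))"
    if "W \<in> opens Y" "W' \<in> opens Y" "W' \<subseteq> W" "s \<in> carrier (sections Y W)" for W W' s
    using gam_res[OF that(1-3) phiC[OF that(1,4)]] gam_phi[OF that(1,4)] by simp
  have resXC: "res X (pf W) (pf W') (\<phi> W s) \<in> carrier (sections X (pf W'))"
    if "W \<in> opens Y" "W' \<in> opens Y" "W' \<subseteq> W" "s \<in> carrier (sections Y W)" for W W' s
    by (rule res_section[OF X pf[OF that(1)] pf[OF that(2)] pf_mono[OF that(3)] phiC[OF that(1,4)]])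
  have alg: "ring_closed (sections Y W) \<and> (\<forall>c. scalar Y W c \<in> carrier (sections Y W))" if W: "W \<in> opens Y" for W
  proof -
    have c: "ring_closed (sections X (pf W))" by (rule sections_closed[OF X pf[OF W]])
    have "\<one>\<^bsub>sections Y W\<^esub> = \<gamma> W \<one>\<^bsub>sections X (pf W)\<^esub>" using ring_hom_one[OF gam[OF W]] by simp
    then have one: "\<one>\<^bsub>sections Y W\<^esub> \<in> carrier (sections Y W)"
      using c gamC[OF W] by (simp add: ring_closed_def)
    have "x \<otimes>\<^bsub>sections Y W\<^esub> y \<in> carrier (sections Y W) \<and> x \<oplus>\<^bsub>sections Y W\<^esub> y \<in> carrier (sections Y W)"
      if xy: "x \<in> carrier (sections Y W)" "y \<in> carrier (sections Y W)" for x y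
    proof
      note p = phiC[OF W xy(1)] phiC[OF W xy(2)]
      have "x \<otimes>\<^bsub>sections Y W\<^esub> y = \<gamma> W (\<phi> W x \<otimes>\<^bsub>sections X (pf W)\<^esub> \<phi> W y)"
        using ring_hom_mult[OF gam[OF W] p] gam_phi[OF W] xy by simp
      also have "\<dots> \<in> carrier (sections Y W)" by (rule gamC[OF W]) (use c p in \<open>auto simp: ring_closed_def\<close>)
      finally show "x \<otimes>\<^bsub>sections Y W\<^esub> y \<in> carrier (sections Y W)" .
      have "x \<oplus>\<^bsub>sections Y W\<^esub> y = \<gamma> W (\<phi> W x \<oplus>\<^bsub>sections X (pf W)\<^esub> \<phi> W y)"
        using ring_hom_add[OF gam[OF W] p] gam_phi[OF W] xy by simp
      also have "\<dots> \<in> carrier (sections Y W)" by (rule gamC[OF W]) (use c p in \<open>auto simp: ring_closed_def\<close>)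
      finally show "x \<oplus>\<^bsub>sections Y W\<^esub> y \<in> carrier (sections Y W)" .
    qed
    moreover have "scalar Y W c \<in> carrier (sections Y W)" for c
      using gamC[OF W scalar_section[OF X pf[OF W]]] unfolding gam_scalar[OF W] .
    ultimately show ?thesis using one by (simp add: ring_closed_def)
  qed
  have rs: "res Y W W' \<in> ring_hom (sections Y W) (sections Y W') \<and> (\<forall>c. res Y W W' (scalar Y W c) = scalar Y W' c)"
    if W: "W \<in> opens Y" "W' \<in> opens Y" "W' \<subseteq> W" for W W'
  proof
    have "(\<gamma> W' \<circ> (res X (pf W) (pf W') \<circ> \<phi> W)) \<in> ring_hom (sections Y W) (sections Y W')"
      by (rule ring_hom_trans[OF ring_hom_trans[OF phi[OF W(1)]
        res_hom[OF X pf[OF W(1)] pf[OF W(2)] pf_mono[OF W(3)]]] gam[OF W(2)]])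
    moreover have "ring_closed (sections Y W)" using alg W by blast
    ultimately show "res Y W W' \<in> ring_hom (sections Y W) (sections Y W')"
      using resY[OF W] by (auto simp: ring_hom_def ring_closed_def)
    show "\<forall>c. res Y W W' (scalar Y W c) = scalar Y W' c"
    proof
      fix c
      have "\<gamma> W' (res X (pf W) (pf W') (scalar X (pf W) c)) = res Y W W' (\<gamma> W (scalar X (pf W) c))"
        by (rule gam_res[OF W scalar_section[OF X pf[OF W(1)]]])
      then show "res Y W W' (scalar Y W c) = scalar Y W' c"
        unfolding res_scalar[OF X pf[OF W(1)] pf[OF W(2)] pf_mono[OF W(3)]] gam_scalar[OF W(1)] gam_scalar[OF W(2)] ..
    qed
  qed
  have ident: "res Y W W s = s" if W: "W \<in> opens Y" "s \<in> carrier (sections Y W)" for W s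
    using resY[OF W(1,1) subset_refl W(2)] res_id[OF X pf[OF W(1)] phiC[OF W]] gam_phi[OF W] by simp
  have comp: "res Y W' W'' (res Y W W' s) = res Y W W'' s"
    if W: "W \<in> opens Y" "W' \<in> opens Y" "W'' \<in> opens Y" "W'' \<subseteq> W'" "W' \<subseteq> W" "s \<in> carrier (sections Y W)" for W W' W'' s
  proof -
    have "W'' \<subseteq> W" using W by blast
    have "\<phi> W' (res Y W W' s) = res X (pf W) (pf W') (\<phi> W s)"
      unfolding resY[OF W(1,2,5,6)] by (rule phi_gam[OF W(2) resXC[OF W(1,2,5,6)]])
    moreover have "res Y W W' s \<in> carrier (sections Y W')"
      by (rule ring_hom_closed[OF conjunct1[OF rs[OF W(1,2,5)]] W(6)])
    moreover have "res X (pf W') (pf W'') (res X (pf W) (pf W') (\<phi> W s)) = res X (pf W) (pf W'') (\<phi> W s)"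
      by (rule res_res[OF X pf[OF W(1)] pf[OF W(2)] pf[OF W(3)] pf_mono[OF W(4)] pf_mono[OF W(5)] phiC[OF W(1,6)]])
    ultimately show ?thesis
      using resY[OF W(2,3,4)] resY[OF W(1,3) \<open>W'' \<subseteq> W\<close> W(6)] by simp
  qed
  show ?thesis
    unfolding precringed_def
  proof (intro conjI, goal_cases)
    case 1 show ?case by (intro ballI alg)
  next
    case 2 show ?case by (intro ballI impI rs)
  next
    case 3 show ?case by (intro ballI ident)
  next
    case 4 show ?case by (intro ballI impI, elim conjE) (rule comp)
  qed
qed

text \<open>Records may differ at sets that are not open although they describe the same space. Such
  differences do arise between an open piece of a local model and the local model on a smaller
  domain, so equality of records cannot serve.\<close>

lemma riso_cong:
  assumes XY: "riso X Y" and X: "precringed X"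
    and eq: "space_top Z = space_top Y" "\<And>V. V \<in> opens Y \<Longrightarrow> sections Z V = sections Y V"
      "\<And>V c. V \<in> opens Y \<Longrightarrow> scalar Z V c = scalar Y V c"
      "\<And>V W r. V \<in> opens Y \<Longrightarrow> W \<in> opens Y \<Longrightarrow> res Z V W r = res Y V W r"
  shows "riso X Z"
proof -
  obtain f g where fg: "f \<in> rhom X Y" "g \<in> rhom Y X" "rcomp X Y X g f = rid X" "rcomp Y X Y f g = rid Y"
    using XY unfolding riso_def by blast
  have p: "preim Z = preim Y" by (auto simp: preim_def eq fun_eq_iff)
  have f: "f \<in> rhom X Z" using fg(1) unfolding rhom_def by (auto simp: eq case_prod_unfold)
  have pg: "preim Y (fst g) W \<in> opens Y" if "W \<in> opens X" for W using rhom_preim_open[OF fg(2) that] .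
  have g: "g \<in> rhom Z X" using fg(2) pg unfolding rhom_def by (auto simp: eq p case_prod_unfold)
  have "rcomp X Z X g f = rid X" using fg(3) unfolding rcomp_def p by simp
  moreover have "rcomp Z X Z f g = rid Z"
  proof -
    have "rcomp Z X Z f g = rcomp Y X Y f g"
      unfolding rcomp_def p eq(1) by (simp add: eq(2) cong: restrict_cong)
    moreover have "rid Z = rid Y"
      unfolding rid_def eq(1) by (simp add: eq(2) cong: restrict_cong)
    ultimately show ?thesis using fg(4) by simp
  qed
  ultimately show ?thesis unfolding riso_def using f g by blast
qed

section \<open>Shrinking local models; open subspaces of complex spaces\<close>

lemma open_Cn_Int: "open_Cn n N \<Longrightarrow> open_Cn n N' \<Longrightarrow> open_Cn n (N \<inter> N')"
  unfolding open_Cn_def by (rule openin_Int)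

lemma holo_Cn_mono: "holo_Cn n N f \<Longrightarrow> N' \<subseteq> N \<Longrightarrow> holo_Cn n N' f"
  unfolding holo_Cn_def
proof (intro ballI, goal_cases)
  case (1 z)
  then obtain c where c: "\<forall>e>0. \<exists>d>0. \<forall>w\<in>N. (\<forall>i<n. norm (w i - z i) < d) \<longrightarrow>
     norm (f w - f z - (\<Sum>i<n. c i * (w i - z i))) \<le> e * (\<Sum>i<n. norm (w i - z i))" by (auto dest!: bspec)
  show ?case
  proof (intro exI[of _ c] allI impI)
    fix e :: real assume "e > 0"
    with c obtain d where "d > 0" and d: "\<forall>w\<in>N. (\<forall>i<n. norm (w i - z i) < d) \<longrightarrow>
     norm (f w - f z - (\<Sum>i<n. c i * (w i - z i))) \<le> e * (\<Sum>i<n. norm (w i - z i))" by auto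
    have "\<forall>w\<in>N'. (\<forall>i<n. norm (w i - z i) < d) \<longrightarrow>
     norm (f w - f z - (\<Sum>i<n. c i * (w i - z i))) \<le> e * (\<Sum>i<n. norm (w i - z i))"
      by (rule ballI, rule bspec[OF d], rule subsetD[OF 1(2)])
    with \<open>d > 0\<close> show "\<exists>d>0. \<forall>w\<in>N'. (\<forall>i<n. norm (w i - z i) < d) \<longrightarrow>
     norm (f w - f z - (\<Sum>i<n. c i * (w i - z i))) \<le> e * (\<Sum>i<n. norm (w i - z i))" by (intro exI[of _ d] conjI)
  qed
qed

text \<open>A congruence of germs that is witnessed on \<open>N\<close> is also witnessed on the
  intersection of \<open>N\<close> with the smaller domain.\<close>

lemma germ_mod_subset:
  assumes "a \<in> \<Omega>'" "\<Omega>' \<subseteq> \<Omega>" "open_Cn n \<Omega>'"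
  shows "germ_mod n \<Omega>' fs a g = germ_mod n \<Omega> fs a g"
proof
  show "germ_mod n \<Omega>' fs a g \<subseteq> germ_mod n \<Omega> fs a g"
  proof
    fix h assume "h \<in> germ_mod n \<Omega>' fs a g"
    then obtain N c where N: "open_Cn n N \<and> a \<in> N \<and> N \<subseteq> \<Omega>' \<and> holo_Cn n N g \<and> holo_Cn n N h \<and>
      (\<forall>i<length fs. holo_Cn n N (c i)) \<and> (\<forall>z\<in>N. g z - h z = (\<Sum>i<length fs. c i z * (fs ! i) z))"
      unfolding germ_mod_def by (elim CollectE exE) (rule that)
    have "N \<subseteq> \<Omega>" using N assms(2) by (meson order_trans)
    with N show "h \<in> germ_mod n \<Omega> fs a g"
      unfolding germ_mod_def by (intro CollectI exI[of _ N] exI[of _ c]) simp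
  qed
  show "germ_mod n \<Omega> fs a g \<subseteq> germ_mod n \<Omega>' fs a g"
  proof
    fix h assume "h \<in> germ_mod n \<Omega> fs a g"
    then obtain N c where N': "open_Cn n N \<and> a \<in> N \<and> N \<subseteq> \<Omega> \<and> holo_Cn n N g \<and> holo_Cn n N h \<and>
      (\<forall>i<length fs. holo_Cn n N (c i)) \<and> (\<forall>z\<in>N. g z - h z = (\<Sum>i<length fs. c i z * (fs ! i) z))"
      unfolding germ_mod_def by (elim CollectE exE) (rule that)
    then have N: "open_Cn n N" "a \<in> N" "holo_Cn n N g" "holo_Cn n N h"
      "\<forall>i<length fs. holo_Cn n N (c i)" "\<forall>z\<in>N. g z - h z = (\<Sum>i<length fs. c i z * (fs ! i) z)"
      by simp_all
    have sub: "N \<inter> \<Omega>' \<subseteq> N" by simp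
    have "\<forall>i<length fs. holo_Cn n (N \<inter> \<Omega>') (c i)" using N(5) holo_Cn_mono[OF _ sub] by metis
    then have "open_Cn n (N \<inter> \<Omega>') \<and> a \<in> N \<inter> \<Omega>' \<and> N \<inter> \<Omega>' \<subseteq> \<Omega>' \<and> holo_Cn n (N \<inter> \<Omega>') g \<and> holo_Cn n (N \<inter> \<Omega>') h \<and>
      (\<forall>i<length fs. holo_Cn n (N \<inter> \<Omega>') (c i)) \<and> (\<forall>z\<in>N \<inter> \<Omega>'. g z - h z = (\<Sum>i<length fs. c i z * (fs ! i) z))"
      using N(2,6) assms(1) open_Cn_Int[OF N(1) assms(3)] holo_Cn_mono[OF N(3) sub] holo_Cn_mono[OF N(4) sub]
      by simp
    then show "h \<in> germ_mod n \<Omega>' fs a g"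
      unfolding germ_mod_def by (intro CollectI exI[of _ "N \<inter> \<Omega>'"] exI[of _ c])
  qed
qed

lemma model_sections_subset:
  assumes "V \<subseteq> \<Omega>'" "\<Omega>' \<subseteq> \<Omega>" "open_Cn n \<Omega>'"
  shows "model_sections n \<Omega>' fs V = model_sections n \<Omega> fs V"
proof -
  have gm: "germ_mod n \<Omega>' fs a g = germ_mod n \<Omega> fs a g" if "a \<in> V" for a g
    using germ_mod_subset assms that by blast
  have "(\<exists>N g. open_Cn n N \<and> a \<in> N \<and> N \<subseteq> \<Omega>' \<and> holo_Cn n N g \<and> (\<forall>b\<in>N \<inter> V. s b = germ_mod n \<Omega>' fs b g)) \<longleftrightarrow>
      (\<exists>N g. open_Cn n N \<and> a \<in> N \<and> N \<subseteq> \<Omega> \<and> holo_Cn n N g \<and> (\<forall>b\<in>N \<inter> V. s b = germ_mod n \<Omega> fs b g))"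
    (is "?L \<longleftrightarrow> ?R") if "a \<in> V" for a s
  proof
    assume ?L then show ?R using assms(2) gm by (metis IntD2 order_trans)
  next
    assume ?R
    then obtain N g where N: "open_Cn n N" "a \<in> N" "N \<subseteq> \<Omega>" "holo_Cn n N g" "\<forall>b\<in>N \<inter> V. s b = germ_mod n \<Omega> fs b g"
      by blast
    have sub: "N \<inter> \<Omega>' \<subseteq> N" by simp
    have "open_Cn n (N \<inter> \<Omega>') \<and> a \<in> N \<inter> \<Omega>' \<and> N \<inter> \<Omega>' \<subseteq> \<Omega>' \<and> holo_Cn n (N \<inter> \<Omega>') g \<and>
      (\<forall>b\<in>N \<inter> \<Omega>' \<inter> V. s b = germ_mod n \<Omega>' fs b g)"
      using N(2,5) assms(1) that gm open_Cn_Int[OF N(1) assms(3)] holo_Cn_mono[OF N(4) sub] by auto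
    then show ?L by blast
  qed
  then show ?thesis
    unfolding model_sections_def using gm
    by (intro cringed.equality monoid.equality ring.equality) (auto intro!: restrict_ext simp: fun_eq_iff)
qed

lemma complex_space_precringed: "complex_space X \<Longrightarrow> precringed X"
  by (simp add: complex_space_def precringed_if_cringed_space)

text \<open>The charts are the work: a chart of \<open>X\<close> at \<open>p\<close> is cut down to
  \<open>V\<close>, and the corresponding open piece of the local model is presented as a local
  model with the same equations on a smaller domain.\<close>

lemma complex_space_open_sub:
  assumes X: "complex_space X" and V: "V \<in> opens X"
  shows "complex_space (open_sub X V)"
  unfolding complex_space_def
proof (intro conjI ballI)
  have X': "precringed X" by (rule complex_space_precringed[OF X])
  show "cringed_space (open_sub X V)" using X V cringed_space_open_sub by (auto simp: complex_space_def)
  show "Hausdorff_space (space_top (open_sub X V))"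
    using X by (auto simp: complex_space_def intro: Hausdorff_space_subtopology)
  show "second_countable (space_top (open_sub X V))"
    using X by (auto simp: complex_space_def intro: second_countable_subtopology)
  fix p assume "p \<in> points (open_sub X V)"
  then have p: "p \<in> points X" "p \<in> V" using points_open_sub[OF V] V openin_subset by auto
  then obtain U n \<Omega> fs where U: "U \<in> opens X" "p \<in> U" and \<Omega>: "open_Cn n \<Omega>" "\<forall>f\<in>set fs. holo_Cn n \<Omega> f"
    and iso: "riso (open_sub X U) (local_model n \<Omega> fs)"
    using X unfolding complex_space_def by blast
  let ?X = "open_sub X U" and ?Y = "local_model n \<Omega> fs"
  let ?Z = "{z \<in> \<Omega>. \<forall>f\<in>set fs. f z = 0}"
  have pX: "precringed ?X"
    using cringed_space_open_sub[OF _ U(1)] X precringed_if_cringed_space unfolding complex_space_def by blast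
  obtain f g where fg: "f \<in> rhom ?X ?Y" "g \<in> rhom ?Y ?X" "rcomp ?X ?Y ?X g f = rid ?X" "rcomp ?Y ?X ?Y f g = rid ?Y"
    using iso unfolding riso_def by blast
  have pY: "precringed ?Y" by (rule precringed_riso[OF pX fg])
  have UV: "U \<inter> V \<in> opens ?X" using U V opens_open_sub[OF U(1)] by auto
  \<comment> \<open>The open set of the model that corresponds to the part of the chart inside
    \<open>V\<close>.\<close>
  define W where "W = preim ?Y (fst g) (U \<inter> V)"
  have W: "W \<in> opens ?Y" unfolding W_def by (rule rhom_preim_open[OF fg(2) UV])
  have gfp: "fst g (fst f q) = q" if "q \<in> points ?X" for q
    using fun_cong[OF arg_cong[OF fg(3), of fst], of q] that by (simp add: rcomp_def rid_def)
  have pre: "preim ?X (fst f) W = U \<inter> V"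
    using UV openin_subset[of "space_top ?X" "U \<inter> V"] gfp rhom_continuous[OF fg(1)]
    by (auto simp: W_def preim_def continuous_map_def)
  have iso': "riso (open_sub ?X (U \<inter> V)) (open_sub ?Y W)"
    using riso_open_sub[OF pX pY fg W] unfolding pre .
  obtain T where T: "open T" "W = ?Z \<inter> T"
    using W by (auto simp: local_model_def openin_open)
  \<comment> \<open>The zero locus carries the topology of the ambient space, so removing everything
    outside \<open>T\<close> from the domain leaves \<open>W\<close> as the zero locus of the
    unchanged \<open>fs\<close>.\<close>
  define \<Omega>' where "\<Omega>' = \<Omega> \<inter> T"
  have O': "open_Cn n \<Omega>'" "\<Omega>' \<subseteq> \<Omega>"
    using \<Omega>(1) T(1) unfolding \<Omega>'_def open_Cn_def by (auto intro: openin_Int_open)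
  have Z': "{z \<in> \<Omega>'. \<forall>f\<in>set fs. f z = 0} = W" using T(2) by (auto simp: \<Omega>'_def)
  have "riso (open_sub ?X (U \<inter> V)) (local_model n \<Omega>' fs)"
  proof (rule riso_cong[OF iso'])
    show "precringed (open_sub ?X (U \<inter> V))"
      using cringed_space_open_sub[of X "U \<inter> V"] X U(1) V precringed_if_cringed_space
      unfolding complex_space_def by (auto simp: Int_absorb1)
    have WZ: "W \<subseteq> ?Z" using T(2) by blast
    show st: "space_top (local_model n \<Omega>' fs) = space_top (open_sub ?Y W)"
      unfolding local_model_def open_sub_simps using Z' WZ by (simp add: subtopology_subtopology Int_absorb1)
    fix V' assume "V' \<in> opens (open_sub ?Y W)"
    then have V': "V' \<subseteq> \<Omega>'" using opens_open_sub[OF W] Z' by blast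
    show "sections (local_model n \<Omega>' fs) V' = sections (open_sub ?Y W) V'"
      unfolding open_sub_simps using model_sections_subset[OF V' O'(2,1)] by (simp add: local_model_def)
    show "scalar (local_model n \<Omega>' fs) V' c = scalar (open_sub ?Y W) V' c" for c
      unfolding open_sub_simps using germ_mod_subset[OF _ O'(2,1)] V'
      by (auto simp: local_model_def intro!: restrict_ext)
  qed (simp add: local_model_def)
  moreover have "open_sub (open_sub X V) (U \<inter> V) = open_sub ?X (U \<inter> V)"
    unfolding open_sub_open_sub by (rule arg_cong[of _ _ "open_sub X"]) blast
  ultimately have "riso (open_sub (open_sub X V) (U \<inter> V)) (local_model n \<Omega>' fs)" by simp
  moreover have "U \<inter> V \<in> opens (open_sub X V)" using U V opens_open_sub[OF V] by auto
  moreover have "\<forall>f\<in>set fs. holo_Cn n \<Omega>' f" using \<Omega>(2) O'(2) holo_Cn_mono by blast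
  ultimately show "\<exists>V' n \<Omega> fs. V' \<in> opens (open_sub X V) \<and> p \<in> V' \<and> open_Cn n \<Omega> \<and> (\<forall>f\<in>set fs. holo_Cn n \<Omega> f) \<and>
      riso (open_sub (open_sub X V) V') (local_model n \<Omega> fs)"
    using p U(2) O'(1) by blast
qed

section \<open>Connected components of simplicial sets\<close>

text \<open>Ties a simplex to its images under all simplicial operators; the classes of the
  generated equivalence \<open>slinked\<close> are the connected components of \<open>K\<close>.
  Taking simplices of every dimension together spares the choice of vertices.\<close>

definition slink :: "'a sset \<Rightarrow> ((nat \<times> 'a) \<times> (nat \<times> 'a)) set" where
  "slink K = {((m, act K m n \<theta> x), (n, x)) | m n \<theta> x. \<theta> \<in> Delta m n \<and> x \<in> simp K n}"

definition slinked :: "'a sset \<Rightarrow> ((nat \<times> 'a) \<times> (nat \<times> 'a)) set" where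
  "slinked K = (slink K \<union> (slink K)\<inverse>)\<^sup>*"

definition act_closed :: "'a sset \<Rightarrow> bool" where
  "act_closed K \<longleftrightarrow> (\<forall>m n \<theta> x. \<theta> \<in> Delta m n \<and> x \<in> simp K n \<longrightarrow> act K m n \<theta> x \<in> simp K m)"

lemma slinked_refl: "(p, p) \<in> slinked K"
  by (simp add: slinked_def)

lemma slinked_sym: "(p, q) \<in> slinked K \<Longrightarrow> (q, p) \<in> slinked K"
  unfolding slinked_def
  by (metis converse_Un converse_converse rtrancl_converseI sup_commute)

lemma slinked_trans: "(p, q) \<in> slinked K \<Longrightarrow> (q, r) \<in> slinked K \<Longrightarrow> (p, r) \<in> slinked K"
  unfolding slinked_def by (rule rtrancl_trans)

lemma slinked_act:
  "\<theta> \<in> Delta m n \<Longrightarrow> x \<in> simp K n \<Longrightarrow> ((m, act K m n \<theta> x), (n, x)) \<in> slinked K"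
  unfolding slinked_def slink_def by (intro r_into_rtrancl) blast

lemma slinked_induct [consumes 1, case_names base down up]:
  assumes "((n, x), (m, y)) \<in> slinked K"
    and "P n x"
    and "\<And>k l \<theta> z. \<theta> \<in> Delta k l \<Longrightarrow> z \<in> simp K l \<Longrightarrow> P l z \<Longrightarrow> P k (act K k l \<theta> z)"
    and "\<And>k l \<theta> z. \<theta> \<in> Delta k l \<Longrightarrow> z \<in> simp K l \<Longrightarrow> P k (act K k l \<theta> z) \<Longrightarrow> P l z"
  shows "P m y"
proof -
  have "case q of (k, z) \<Rightarrow> P k z" if "((n, x), q) \<in> slinked K" for q
    using that unfolding slinked_def
  proof (induction rule: rtrancl_induct)
    case (step y z)
    then show ?case by (auto simp: slink_def intro: assms)
  qed (simp add: assms(2))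
  from this[OF assms(1)] show ?thesis by simp
qed

section \<open>Path components of the geometric realization\<close>

lemma istopology_quotient:
  "istopology (\<lambda>S. S \<subseteq> q ` topspace X \<and> openin X {p \<in> topspace X. q p \<in> S})"
proof -
  have 1: "{p \<in> topspace X. q p \<in> S \<inter> T} = {p \<in> topspace X. q p \<in> S} \<inter> {p \<in> topspace X. q p \<in> T}" for S T
    by auto
  have 2: "{p \<in> topspace X. q p \<in> \<Union>\<K>} = \<Union>((\<lambda>S. {p \<in> topspace X. q p \<in> S}) ` \<K>)" for \<K>
    by auto
  show ?thesis unfolding istopology_def 1 2
    by (auto intro!: openin_Int openin_Union)
qed

lemma openin_quotient_top:
  "openin (quotient_top X q) S \<longleftrightarrow> S \<subseteq> q ` topspace X \<and> openin X {p \<in> topspace X. q p \<in> S}"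
  unfolding quotient_top_def using istopology_quotient[of q X] by (simp add: topology_inverse')

lemma topspace_quotient_top [simp]: "topspace (quotient_top X q) = q ` topspace X"
proof (rule antisym)
  show "topspace (quotient_top X q) \<subseteq> q ` topspace X"
    using openin_quotient_top[of X q "topspace (quotient_top X q)"] by simp
  have "{p \<in> topspace X. q p \<in> q ` topspace X} = topspace X" by auto
  then have "openin (quotient_top X q) (q ` topspace X)" by (simp add: openin_quotient_top)
  then show "q ` topspace X \<subseteq> topspace (quotient_top X q)" by (rule openin_subset)
qed

lemma continuous_map_quotient_top: "continuous_map X (quotient_top X q) q"
  by (auto simp: continuous_map openin_quotient_top)

lemma topspace_cells:
  "topspace (cells K) = {((n, x), t). x \<in> simp K n \<and> t \<in> standard_simplex n}"
  unfolding cells_def by (auto simp: topspace_sum_topology)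

lemma topspace_realization: "topspace (realization K) = cell_class K ` topspace (cells K)"
  by (simp add: realization_def)

lemma cell_class_eq_iff:
  "cell_class K p = cell_class K q \<longleftrightarrow> (p, q) \<in> (glue K \<union> (glue K)\<inverse>)\<^sup>*"
proof -
  let ?R = "(glue K \<union> (glue K)\<inverse>)\<^sup>*"
  have "sym ?R" by (intro sym_rtrancl sym_Un_converse)
  then show ?thesis unfolding cell_class_def
    by (auto dest: symD intro: rtrancl_trans)
qed

lemma slinked_if_glued:
  assumes "(p, q) \<in> (glue K \<union> (glue K)\<inverse>)\<^sup>*"
  shows "(fst p, fst q) \<in> slinked K"
  using assms
proof (induction rule: rtrancl_induct)
  case (step y z)
  then have "(fst y, fst z) \<in> slink K \<union> (slink K)\<inverse>" by (fastforce simp: glue_def slink_def)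
  with step.IH show ?case unfolding slinked_def by (rule rtrancl_into_rtrancl)
qed (simp add: slinked_refl)

text \<open>The component of the carrying simplex is constant on each cell and respected by gluing,
  so it is a continuous map from the realization to a discrete space. A path has connected image and
  cannot change it.\<close>

lemma slinked_if_path_component_of:
  assumes pc: "path_component_of (realization K) (cell_class K p) (cell_class K q)"
  shows "(fst p, fst q) \<in> slinked K"
proof -
  \<comment> \<open>A point of the realization is a set of cell points, so its component is read off
    a chosen representative; the next fact shows that the choice does not matter.\<close>
  define label where "label c = slinked K `` {fst (SOME p. p \<in> c)}" for c :: "((nat \<times> 'a) \<times> (nat \<Rightarrow> real)) set"
  have label: "label (cell_class K p) = slinked K `` {fst p}" for p
  proof -
    have "p \<in> cell_class K p" by (simp add: cell_class_def)
    then have "(SOME p'. p' \<in> cell_class K p) \<in> cell_class K p" by (rule someI)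
    then have "(fst p, fst (SOME p'. p' \<in> cell_class K p)) \<in> slinked K"
      by (intro slinked_if_glued) (simp add: cell_class_def)
    then show ?thesis unfolding label_def using slinked_sym slinked_trans by blast
  qed
  have open_if: "openin X (if b then topspace X else {})" for X :: "'c topology" and b by simp
  have "continuous_map (realization K) (discrete_topology UNIV) label"
    unfolding continuous_map
  proof (intro conjI allI impI)
    fix V
    have eq: "{p \<in> topspace (cells K). cell_class K p \<in> {c \<in> topspace (realization K). label c \<in> V}}
      = {p \<in> topspace (cells K). slinked K `` {fst p} \<in> V}" (is "_ = ?S")
      by (auto simp: topspace_realization label)
    \<comment> \<open>Within one cell the component does not vary, so the trace on it is the whole
      cell or empty.\<close>
    have "openin (cells K) ?S"
      unfolding cells_def openin_sum_topology
    proof (intro conjI ballI)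
      fix i assume i: "i \<in> (SIGMA n:UNIV. simp K n)"
      let ?T = "\<lambda>i. case i of (n, x) \<Rightarrow> subtopology (powertop_real UNIV) (standard_simplex n)"
      have "{t. (i, t) \<in> {p \<in> topspace (sum_topology ?T (SIGMA n:UNIV. simp K n)). slinked K `` {fst p} \<in> V}} =
        (if slinked K `` {i} \<in> V then topspace (?T i) else {})"
        using i by (auto simp: topspace_sum_topology)
      then show "openin (?T i) {t. (i, t) \<in> {p \<in> topspace (sum_topology ?T (SIGMA n:UNIV. simp K n)). slinked K `` {fst p} \<in> V}}"
        by (simp only: open_if)
    qed auto
    then show "openin (realization K) {c \<in> topspace (realization K). label c \<in> V}"
      unfolding realization_def openin_quotient_top
      using eq by (auto simp: realization_def)
  qed auto
  moreover obtain T where T: "connectedin (realization K) T" "cell_class K p \<in> T" "cell_class K q \<in> T"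
    using pc unfolding path_component_of by (meson path_connectedin_imp_connectedin)
  ultimately have "connectedin (discrete_topology UNIV) (label ` T)"
    by (metis connectedin_continuous_map_image)
  then have "label (cell_class K p) = label (cell_class K q)"
    using T(2,3) by (auto simp: connectedin_discrete_topology)
  then have "fst q \<in> slinked K `` {fst p}" unfolding label using slinked_refl by blast
  then show ?thesis by (rule ImageE) simp
qed

lemma path_component_of_cell:
  assumes x: "x \<in> simp K n" and t: "t \<in> standard_simplex n" "t' \<in> standard_simplex n"
  shows "path_component_of (realization K) (cell_class K ((n, x), t)) (cell_class K ((n, x), t'))"
proof -
  let ?D = "subtopology (powertop_real UNIV) (standard_simplex n)"
  let ?T = "\<lambda>i. case i of (n, x) \<Rightarrow> subtopology (powertop_real UNIV) (standard_simplex n)"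
  have "continuous_map (?T (n, x)) (cells K) (\<lambda>t. ((n, x), t))"
    unfolding cells_def by (rule continuous_map_component_injection) (use x in auto)
  then have "continuous_map ?D (realization K) (cell_class K \<circ> (\<lambda>t. ((n, x), t)))"
    unfolding realization_def by (intro continuous_map_compose) (auto intro: continuous_map_quotient_top)
  moreover have "path_connected_space ?D"
    using path_connectedin_standard_simplex by (simp add: path_connectedin_def)
  then have "path_connectedin ?D (standard_simplex n)"
    by (metis path_connectedin_topspace topspace_standard_simplex)
  ultimately have "path_connectedin (realization K) ((cell_class K \<circ> (\<lambda>t. ((n, x), t))) ` standard_simplex n)"
    by (rule path_connectedin_continuous_map_image)
  then show ?thesis using t unfolding path_component_of by (auto simp: o_def)
qed

text \<open>\<open>push_simplex\<close> is the affine map of standard simplices given by a map of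
  vertices. Its coordinates are sums over fibres, so the total remains 1.\<close>

lemma push_simplex_in:
  assumes \<theta>: "\<theta> \<in> Delta m n" and t: "t \<in> standard_simplex m"
  shows "push_simplex m \<theta> t \<in> standard_simplex n"
proof -
  have nn: "0 \<le> t j" for j using t by (simp add: standard_simplex_def)
  have th: "\<theta> j \<le> n" if "j \<le> m" for j using \<theta> that by (auto simp: Delta_def PiE_iff)
  have tot: "(\<Sum>j\<le>m. t j) = 1" using t by (simp add: standard_simplex_def)
  have "push_simplex m \<theta> t i \<le> (\<Sum>j\<le>m. t j)" for i
    unfolding push_simplex_def by (rule sum_mono2) (use nn in auto)
  moreover have "(\<Sum>i\<le>n. push_simplex m \<theta> t i) = (\<Sum>j\<le>m. t j)"
  proof -
    have "(\<Sum>i\<le>n. push_simplex m \<theta> t i) = (\<Sum>i\<in>{..n}. \<Sum>j | j \<in> {..m} \<and> \<theta> j = i. t j)"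
      by (simp add: push_simplex_def)
    also have "\<dots> = (\<Sum>j\<le>m. t j)" by (rule sum.group) (use th in auto)
    finally show ?thesis .
  qed
  moreover have "push_simplex m \<theta> t i = 0" if "i > n" for i
  proof -
    have "{j. j \<le> m \<and> \<theta> j = i} = {}" using th that by fastforce
    then show ?thesis by (simp only: push_simplex_def sum.empty)
  qed
  ultimately show ?thesis using tot nn
    by (auto simp: standard_simplex_def push_simplex_def intro!: sum_nonneg)
qed

text \<open>A simplicial operator glues each point of one cell to some point of the other, and every
  cell is path connected.\<close>

lemma path_component_of_if_slinked:
  assumes K: "act_closed K" and l: "((m, x), (n, y)) \<in> slinked K" and x: "x \<in> simp K m"
    and s: "s \<in> standard_simplex m" and t: "t \<in> standard_simplex n"
  shows "path_component_of (realization K) (cell_class K ((m, x), s)) (cell_class K ((n, y), t))"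
proof -
  have glue: "path_component_of (realization K) (cell_class K ((k, act K k l \<theta> z), u)) (cell_class K ((l, z), v))"
    if "\<theta> \<in> Delta k l" "z \<in> simp K l" "u \<in> standard_simplex k" "v \<in> standard_simplex l" for k l \<theta> z u v
  proof -
    have "cell_class K ((k, act K k l \<theta> z), u) = cell_class K ((l, z), push_simplex k \<theta> u)"
      unfolding cell_class_eq_iff using that by (auto simp: glue_def intro!: r_into_rtrancl)
    then show ?thesis using path_component_of_cell[OF that(2) push_simplex_in[OF that(1,3)] that(4)] by simp
  qed
  \<comment> \<open>Quantified over the whole last cell, since gluing reaches just the points in the
    image of \<open>push_simplex\<close> and the next link may start elsewhere.\<close>
  have "\<forall>t\<in>standard_simplex n. path_component_of (realization K) (cell_class K ((m, x), s)) (cell_class K ((n, y), t))"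
    using l
  proof (induction rule: slinked_induct)
    case base
    show ?case by (intro ballI path_component_of_cell x s)
  next
    case (down k l \<theta> z)
    obtain v where "v \<in> standard_simplex l" using nonempty_standard_simplex by blast
    then show ?case using down glue by (meson path_component_of_sym path_component_of_trans)
  next
    case (up k l \<theta> z)
    obtain v where "v \<in> standard_simplex k" using nonempty_standard_simplex by blast
    then show ?case using up glue by (meson path_component_of_trans)
  qed
  then show ?thesis using t by blast
qed

text \<open>The union that defines \<open>realization_map\<close> ranges over all representatives of
  a point; compatibility with simplicial operators carries gluing to gluing, so all its members are
  one and the same class.\<close>

lemma realization_map_cell_class:
  assumes K: "act_closed K"
    and comm: "\<And>m n \<theta> x. \<theta> \<in> Delta m n \<Longrightarrow> x \<in> simp K n \<Longrightarrow> g m (act K m n \<theta> x) = act L m n \<theta> (g n x)"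
    and g: "\<And>n x. x \<in> simp K n \<Longrightarrow> g n x \<in> simp L n"
  shows "realization_map L g (cell_class K ((n, x), t)) = cell_class L ((n, g n x), t)"
proof -
  have eq: "cell_class L ((n', g n' x'), t') = cell_class L ((n, g n x), t)"
    if "(((n, x), t), ((n', x'), t')) \<in> (glue K \<union> (glue K)\<inverse>)\<^sup>*" for n' x' t'
  proof -
    let ?h = "\<lambda>((n, x), t). ((n, g n x), t)"
    have "(?h ((n, x), t), ?h q) \<in> (glue L \<union> (glue L)\<inverse>)\<^sup>*"
      if "(((n, x), t), q) \<in> (glue K \<union> (glue K)\<inverse>)\<^sup>*" for q
      using that
    proof (induction rule: rtrancl_induct)
      case (step y z)
      have "(?h p, ?h q) \<in> glue L" if "(p, q) \<in> glue K" for p q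
        using that unfolding glue_def by (auto simp: comm g)
      then have "(?h y, ?h z) \<in> glue L \<union> (glue L)\<inverse>" using step(2) by blast
      with step.IH show ?case by (rule rtrancl_into_rtrancl)
    qed simp
    from this[OF that] show ?thesis unfolding cell_class_eq_iff[symmetric] by simp
  qed
  show ?thesis unfolding realization_map_def
  proof (rule SUP_eq_const, goal_cases)
    case 1
    have "((n, x), t) \<in> cell_class K ((n, x), t)" by (simp add: cell_class_def)
    then show ?case by blast
  next
    case (2 p)
    obtain n' x' t' where p: "p = ((n', x'), t')" by (metis surj_pair)
    have "(((n, x), t), ((n', x'), t')) \<in> (glue K \<union> (glue K)\<inverse>)\<^sup>*"
      using 2 unfolding p cell_class_def by (rule ImageE) simp
    from eq[OF this] show ?case unfolding p by simp
  qed
qed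

text \<open>The bijection of path components of the realizations, translated to simplices: every
  path component meets a cell, and path components of cell points correspond to classes of
  \<open>slinked\<close>.\<close>

lemma
  assumes K: "act_closed K" and L: "act_closed L"
    and comm: "\<And>m n \<theta> x. \<theta> \<in> Delta m n \<Longrightarrow> x \<in> simp K n \<Longrightarrow> g m (act K m n \<theta> x) = act L m n \<theta> (g n x)"
    and g: "\<And>n x. x \<in> simp K n \<Longrightarrow> g n x \<in> simp L n"
    and weq: "sset_weak_equivalence K L g"
  shows weak_equivalence_slinked_surj:
      "y \<in> simp L n \<Longrightarrow> \<exists>m x. x \<in> simp K m \<and> ((n, y), (m, g m x)) \<in> slinked L"
    and weak_equivalence_slinked_inj:
      "x \<in> simp K m \<Longrightarrow> x' \<in> simp K m' \<Longrightarrow> ((m, g m x), (m', g m' x')) \<in> slinked L \<Longrightarrow>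
        ((m, x), (m', x')) \<in> slinked K"
proof -
  let ?X = "realization K" and ?Y = "realization L" and ?f = "realization_map L g"
  have f: "?f (cell_class K ((n, x), t)) = cell_class L ((n, g n x), t)" for n x t
    by (rule realization_map_cell_class[OF K]) (simp_all add: comm g)
  have cont: "continuous_map ?X ?Y ?f"
    and bij: "bij_betw (\<lambda>c. \<Union>a\<in>c. path_component_of_set ?Y (?f a)) (path_components_of ?X) (path_components_of ?Y)"
    using weq unfolding sset_weak_equivalence_def weak_homotopy_equivalence_def by auto
  \<comment> \<open>The union over a path component is a single path component, since a continuous
    map sends points joined by a path to points joined by a path.\<close>
  have F: "(\<Union>a\<in>path_component_of_set ?X p. path_component_of_set ?Y (?f a)) = path_component_of_set ?Y (?f p)"
    if "p \<in> topspace ?X" for p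
  proof -
    have "path_component_of ?Y (?f p) (?f a)" if "path_component_of ?X p a" for a
      using path_component_of_continuous_image[OF cont that] .
    moreover have "path_component_of ?X p p" using that by (simp add: path_component_of_refl)
    ultimately show ?thesis
      by (auto intro: path_component_of_trans)
  qed
  show "\<exists>m x. x \<in> simp K m \<and> ((n, y), (m, g m x)) \<in> slinked L" if y: "y \<in> simp L n"
  proof -
    obtain t where t: "t \<in> standard_simplex n" using nonempty_standard_simplex by blast
    let ?q = "cell_class L ((n, y), t)"
    have q: "?q \<in> topspace ?Y" using y t by (auto simp: topspace_realization topspace_cells)
    then have "path_component_of_set ?Y ?q \<in> path_components_of ?Y" by (auto simp: path_components_of_def)
    then obtain c where "c \<in> path_components_of ?X" "path_component_of_set ?Y ?q = (\<Union>a\<in>c. path_component_of_set ?Y (?f a))"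
      using bij unfolding bij_betw_def by (metis (no_types, lifting) imageE)
    then obtain p where p: "p \<in> topspace ?X" "path_component_of_set ?Y ?q = path_component_of_set ?Y (?f p)"
      using F by (auto simp: path_components_of_def)
    obtain m x s where x: "p = cell_class K ((m, x), s)" "x \<in> simp K m" "s \<in> standard_simplex m"
      using p(1) by (auto simp: topspace_realization topspace_cells)
    have "?f p \<in> topspace ?Y" using cont p(1) by (auto simp: continuous_map_def)
    then have "path_component_of ?Y ?q (?f p)"
      using p(2) path_component_of_refl[of ?Y "?f p"] by blast
    then have "path_component_of ?Y ?q (cell_class L ((m, g m x), s))"
      unfolding x(1) f .
    from slinked_if_path_component_of[OF this] show ?thesis using x by auto
  qed
  show "((m, x), (m', x')) \<in> slinked K"
    if x: "x \<in> simp K m" "x' \<in> simp K m'" and l: "((m, g m x), (m', g m' x')) \<in> slinked L"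
  proof -
    obtain s s' where s: "s \<in> standard_simplex m" "s' \<in> standard_simplex m'"
      using nonempty_standard_simplex by blast
    let ?p = "cell_class K ((m, x), s)" and ?p' = "cell_class K ((m', x'), s')"
    have p: "?p \<in> topspace ?X" "?p' \<in> topspace ?X"
      using x s by (auto simp: topspace_realization topspace_cells)
    have "path_component_of ?Y (?f ?p) (?f ?p')"
      unfolding f using path_component_of_if_slinked[OF L l g[OF x(1)] s] .
    then have "path_component_of_set ?Y (?f ?p) = path_component_of_set ?Y (?f ?p')"
      by (metis path_component_of_equiv)
    then have "(\<Union>a\<in>path_component_of_set ?X ?p. path_component_of_set ?Y (?f a)) =
        (\<Union>a\<in>path_component_of_set ?X ?p'. path_component_of_set ?Y (?f a))"
      using F[OF p(1)] F[OF p(2)] by simp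
    then have "path_component_of_set ?X ?p = path_component_of_set ?X ?p'"
      using bij p unfolding bij_betw_def inj_on_def path_components_of_def by blast
    then have "path_component_of ?X ?p ?p'"
      using p by (metis mem_Collect_eq path_component_of_refl)
    from slinked_if_path_component_of[OF this] show ?thesis by simp
  qed
qed

section \<open>Morphisms to local objects in a localization\<close>

text \<open>Locality of \<open>Z\<close> with respect to \<open>w\<close> in \<open>\<C>\<close>
  itself: precomposition with \<open>w\<close> is a bijection of sets of arrows to \<open>Z\<close>.
  \<open>hyperbolic\<close> and \<open>C_weq\<close> impose the same condition in a
  localization.\<close>

definition orthogonal_to :: "('o, 'a) category \<Rightarrow> 'a \<Rightarrow> 'o \<Rightarrow> bool" where
  "orthogonal_to \<C> w Z \<longleftrightarrow> (\<forall>\<phi>\<in>Arr \<C>. Dom \<C> \<phi> = Dom \<C> w \<and> Cod \<C> \<phi> = Z \<longrightarrow>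
     (\<exists>!\<psi>. \<psi> \<in> Arr \<C> \<and> Dom \<C> \<psi> = Cod \<C> w \<and> Cod \<C> \<psi> = Z \<and> Comp \<C> \<psi> w = \<phi>))"

text \<open>The record \<open>category\<close> carries no laws, so they are assumed here; the
  results are applied to \<open>sSh\<close> and \<open>sSh_pointed\<close>.\<close>

locale localization =
  fixes \<C> :: "('o, 'a) category" and \<W> :: "'a set"
  assumes Dom_Obj: "f \<in> Arr \<C> \<Longrightarrow> Dom \<C> f \<in> Obj \<C>"
    and Cod_Obj: "f \<in> Arr \<C> \<Longrightarrow> Cod \<C> f \<in> Obj \<C>"
    and Ide_Arr: "X \<in> Obj \<C> \<Longrightarrow> Ide \<C> X \<in> Arr \<C>"
    and Dom_Ide: "X \<in> Obj \<C> \<Longrightarrow> Dom \<C> (Ide \<C> X) = X"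
    and Cod_Ide: "X \<in> Obj \<C> \<Longrightarrow> Cod \<C> (Ide \<C> X) = X"
    and Comp_Arr: "f \<in> Arr \<C> \<Longrightarrow> g \<in> Arr \<C> \<Longrightarrow> Dom \<C> g = Cod \<C> f \<Longrightarrow> Comp \<C> g f \<in> Arr \<C>"
    and Dom_Comp: "f \<in> Arr \<C> \<Longrightarrow> g \<in> Arr \<C> \<Longrightarrow> Dom \<C> g = Cod \<C> f \<Longrightarrow> Dom \<C> (Comp \<C> g f) = Dom \<C> f"
    and Cod_Comp: "f \<in> Arr \<C> \<Longrightarrow> g \<in> Arr \<C> \<Longrightarrow> Dom \<C> g = Cod \<C> f \<Longrightarrow> Cod \<C> (Comp \<C> g f) = Cod \<C> g"
    and Comp_Ide: "f \<in> Arr \<C> \<Longrightarrow> Comp \<C> f (Ide \<C> (Dom \<C> f)) = f"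
    and Ide_Comp: "f \<in> Arr \<C> \<Longrightarrow> Comp \<C> (Ide \<C> (Cod \<C> f)) f = f"
    and Comp_assoc: "f \<in> Arr \<C> \<Longrightarrow> g \<in> Arr \<C> \<Longrightarrow> h \<in> Arr \<C> \<Longrightarrow> Dom \<C> g = Cod \<C> f \<Longrightarrow> Dom \<C> h = Cod \<C> g \<Longrightarrow>
      Comp \<C> h (Comp \<C> g f) = Comp \<C> (Comp \<C> h g) f"
    and weq_Arr: "\<W> \<subseteq> Arr \<C>"
begin

abbreviation zz where "zz \<equiv> zigzag \<C> \<W>"

lemma zz_nil_iff: "zz X [] Y \<longleftrightarrow> X = Y \<and> X \<in> Obj \<C>"
  by (auto elim: zigzag.cases intro: zigzag.intros)

lemma zz_Fwd_iff: "zz X (Fwd f # p) Y \<longleftrightarrow> f \<in> Arr \<C> \<and> X = Dom \<C> f \<and> zz (Cod \<C> f) p Y"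
  by (auto elim: zigzag.cases intro: zigzag.intros)

lemma zz_Inv_iff: "zz X (Inv w # p) Y \<longleftrightarrow> w \<in> \<W> \<and> X = Cod \<C> w \<and> zz (Dom \<C> w) p Y"
  by (auto elim: zigzag.cases intro: zigzag.intros)

lemmas zz_iffs = zz_nil_iff zz_Fwd_iff zz_Inv_iff

lemma zz_target: "zz X p Y \<Longrightarrow> Y \<in> Obj \<C>"
  by (induction rule: zigzag.induct) auto

lemma zz_source: "zz X p Y \<Longrightarrow> X \<in> Obj \<C>"
  by (induction rule: zigzag.induct) (use weq_Arr in \<open>auto intro: Dom_Obj Cod_Obj\<close>)

lemma zz_append_iff: "zz X (p @ q) Z \<longleftrightarrow> (\<exists>Y. zz X p Y \<and> zz Y q Z)"
proof (induction p arbitrary: X)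
  case Nil
  then show ?case using zz_source by (auto simp: zz_iffs)
next
  case (Cons s p)
  then show ?case by (cases s) (auto simp: zz_iffs)
qed

lemma rel_refl: "zz X p Y \<Longrightarrow> (p, p) \<in> loc_rel \<C> \<W> X Y"
  by (simp add: loc_rel_def)

lemma rel_zz: "(p, q) \<in> loc_rel \<C> \<W> X Y \<Longrightarrow> zz X p Y \<and> zz X q Y"
  by (simp add: loc_rel_def)

lemma rel_sym: "(p, q) \<in> loc_rel \<C> \<W> X Y \<Longrightarrow> (q, p) \<in> loc_rel \<C> \<W> X Y"
  unfolding loc_rel_def
  by (smt (verit) case_prodD case_prodI converse_Un converse_converse mem_Collect_eq rtrancl_converseI sup_commute)

lemma rel_trans:
  "(p, q) \<in> loc_rel \<C> \<W> X Y \<Longrightarrow> (q, r) \<in> loc_rel \<C> \<W> X Y \<Longrightarrow> (p, r) \<in> loc_rel \<C> \<W> X Y"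
  unfolding loc_rel_def by (auto intro: rtrancl_trans)

lemma equiv_rel: "equiv {p. zz X p Y} (loc_rel \<C> \<W> X Y)"
  by (rule equivI) (auto intro!: refl_onI symI transI dest: rel_zz rel_sym intro: rel_trans rel_refl)

lemma rel_basic:
  assumes "loc_basic \<C> \<W> a b" "zz X (p @ a @ q) Y" "zz X (p @ b @ q) Y"
  shows "(p @ a @ q, p @ b @ q) \<in> loc_rel \<C> \<W> X Y"
proof -
  have "(p @ a @ q, p @ b @ q) \<in> loc_step \<C> \<W> X Y" using assms unfolding loc_step_def by blast
  then show ?thesis using assms unfolding loc_rel_def by auto
qed

lemma rel_append_left:
  assumes "(p, q) \<in> loc_rel \<C> \<W> Y Z" and "zz X a Y"
  shows "(a @ p, a @ q) \<in> loc_rel \<C> \<W> X Z"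
proof -
  have step: "(a @ p, a @ q) \<in> loc_step \<C> \<W> X Z" if pq: "(p, q) \<in> loc_step \<C> \<W> Y Z" for p q
  proof -
    obtain u v c d where *: "p = u @ c @ v" "q = u @ d @ v" "loc_basic \<C> \<W> c d" "zz Y p Z" "zz Y q Z"
      using pq unfolding loc_step_def by blast
    then have "a @ p = (a @ u) @ c @ v" "a @ q = (a @ u) @ d @ v" "zz X (a @ p) Z" "zz X (a @ q) Z"
      using assms(2) by (auto simp: zz_append_iff)
    then show ?thesis unfolding loc_step_def using *(3)
      by (intro CollectI exI[of _ "a @ u"] exI[of _ v] exI[of _ c] exI[of _ d]) auto
  qed
  have "(p, q) \<in> (loc_step \<C> \<W> Y Z \<union> (loc_step \<C> \<W> Y Z)\<inverse>)\<^sup>*"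
    using assms(1) by (simp add: loc_rel_def)
  then have "(a @ p, a @ q) \<in> (loc_step \<C> \<W> X Z \<union> (loc_step \<C> \<W> X Z)\<inverse>)\<^sup>*"
  proof (induction rule: rtrancl_induct)
    case (step y z)
    then have "(a @ y, a @ z) \<in> loc_step \<C> \<W> X Z \<union> (loc_step \<C> \<W> X Z)\<inverse>"
      using \<open>\<And>q p. (p, q) \<in> loc_step \<C> \<W> Y Z \<Longrightarrow> _\<close> by blast
    with step.IH show ?case by (rule rtrancl_into_rtrancl)
  qed simp
  then show ?thesis using assms rel_zz[OF assms(1)] by (auto simp: loc_rel_def zz_append_iff)
qed

lemma rel_Fwd_Fwd:
  assumes "f \<in> Arr \<C>" "g \<in> Arr \<C>" "Dom \<C> g = Cod \<C> f"
  shows "([Fwd f, Fwd g], [Fwd (Comp \<C> g f)]) \<in> loc_rel \<C> \<W> (Dom \<C> f) (Cod \<C> g)"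
  using rel_basic[OF loc_basic.intros(2)[OF assms], where p = "[]" and q = "[]"] assms
  by (auto simp: zz_iffs Comp_Arr Dom_Comp Cod_Comp Cod_Obj)

text \<open>Consume the zigzag from its \<open>Z\<close> end. A forward step is absorbed by
  composition. At an inverse step of \<open>w\<close>, extend the arrow found so far along
  \<open>w\<close> to some \<open>k\<close>; then \<open>Inv w\<close> cancels against
  \<open>Fwd w\<close> and \<open>Fwd k\<close> remains.\<close>

lemma zigzag_related_arrow:
  assumes ext: "\<And>w \<phi>. w \<in> \<W> \<Longrightarrow> \<phi> \<in> Arr \<C> \<Longrightarrow> Dom \<C> \<phi> = Dom \<C> w \<Longrightarrow> Cod \<C> \<phi> = Z \<Longrightarrow>
      \<exists>\<psi>\<in>Arr \<C>. Dom \<C> \<psi> = Cod \<C> w \<and> Cod \<C> \<psi> = Z \<and> Comp \<C> \<psi> w = \<phi>"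
    and "zz Y p Z"
  shows "\<exists>h\<in>Arr \<C>. Dom \<C> h = Y \<and> Cod \<C> h = Z \<and> (p, [Fwd h]) \<in> loc_rel \<C> \<W> Y Z"
  using assms(2)
proof (induction p arbitrary: Y)
  case Nil
  then have Z: "Y = Z" "Z \<in> Obj \<C>" by (auto simp: zz_iffs)
  then have "([Fwd (Ide \<C> Z)], []) \<in> loc_rel \<C> \<W> Y Z"
    using rel_basic[OF loc_basic.intros(1)[OF Z(2)], where p = "[]" and q = "[]"]
    by (auto simp: zz_iffs Ide_Arr Dom_Ide Cod_Ide)
  then show ?case using Z by (intro bexI[of _ "Ide \<C> Z"]) (auto simp: Ide_Arr Dom_Ide Cod_Ide intro: rel_sym)
next
  case (Cons s p)
  show ?case
  proof (cases s)
    case (Fwd f)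
    then have f: "f \<in> Arr \<C>" "Y = Dom \<C> f" "zz (Cod \<C> f) p Z" using Cons.prems by (auto simp: zz_iffs)
    from Cons.IH[OF f(3)] obtain h where h: "h \<in> Arr \<C>" "Dom \<C> h = Cod \<C> f" "Cod \<C> h = Z"
      "(p, [Fwd h]) \<in> loc_rel \<C> \<W> (Cod \<C> f) Z" by blast
    have "([Fwd f] @ p, [Fwd f] @ [Fwd h]) \<in> loc_rel \<C> \<W> Y Z"
      using h f by (intro rel_append_left) (auto simp: zz_iffs Cod_Obj)
    moreover have "([Fwd f, Fwd h], [Fwd (Comp \<C> h f)]) \<in> loc_rel \<C> \<W> Y Z"
      using rel_Fwd_Fwd[of f h] h f by auto
    ultimately have "(s # p, [Fwd (Comp \<C> h f)]) \<in> loc_rel \<C> \<W> Y Z"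
      using Fwd by (auto intro: rel_trans)
    then show ?thesis using h f by (intro bexI[of _ "Comp \<C> h f"]) (auto simp: Comp_Arr Dom_Comp Cod_Comp)
  next
    case (Inv w)
    then have w: "w \<in> \<W>" "Y = Cod \<C> w" "zz (Dom \<C> w) p Z" using Cons.prems by (auto simp: zz_iffs)
    have wA: "w \<in> Arr \<C>" using w weq_Arr by blast
    from Cons.IH[OF w(3)] obtain h where h: "h \<in> Arr \<C>" "Dom \<C> h = Dom \<C> w" "Cod \<C> h = Z"
      "(p, [Fwd h]) \<in> loc_rel \<C> \<W> (Dom \<C> w) Z" by blast
    obtain k where k: "k \<in> Arr \<C>" "Dom \<C> k = Cod \<C> w" "Cod \<C> k = Z" "Comp \<C> k w = h"
      using ext[OF w(1) h(1-3)] by blast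
    have zI: "zz Y [Inv w] (Dom \<C> w)" using w wA by (auto simp: zz_iffs Dom_Obj)
    have "([Inv w] @ p, [Inv w] @ [Fwd h]) \<in> loc_rel \<C> \<W> Y Z"
      by (rule rel_append_left[OF h(4) zI])
    moreover have "([Inv w] @ [Fwd w, Fwd k], [Inv w] @ [Fwd h]) \<in> loc_rel \<C> \<W> Y Z"
      using rel_append_left[OF rel_Fwd_Fwd[of w k], of Y "[Inv w]"] k wA zI by auto
    moreover have "([] @ [Inv w, Fwd w] @ [Fwd k], [] @ [] @ [Fwd k]) \<in> loc_rel \<C> \<W> Y Z"
      by (rule rel_basic[OF loc_basic.intros(4)[OF w(1)]])
        (use w wA k in \<open>auto simp: zz_iffs intro: Cod_Obj\<close>)
    ultimately have "(s # p, [Fwd k]) \<in> loc_rel \<C> \<W> Y Z"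
      unfolding Inv by (metis append_Cons append_Nil rel_sym rel_trans)
    then show ?thesis using k w by (intro bexI[of _ k]) auto
  qed
qed

text \<open>Let zigzags act on arrows to \<open>Z\<close>, forward steps by precomposition and
  inverse steps by the unique extension. The action respects every generating relation, and a
  one-step zigzag sends the identity of \<open>Z\<close> to its own arrow.\<close>

lemma related_arrows_eq:
  assumes orth: "\<And>w. w \<in> \<W> \<Longrightarrow> orthogonal_to \<C> w Z"
    and fg: "([Fwd f], [Fwd g]) \<in> loc_rel \<C> \<W> Y Z"
  shows "f = g"
proof -
  define P where "P X h \<longleftrightarrow> h \<in> Arr \<C> \<and> Dom \<C> h = X \<and> Cod \<C> h = Z" for X h
  define lift where "lift w h = (THE k. P (Cod \<C> w) k \<and> Comp \<C> k w = h)" for w h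
  \<comment> \<open>the action of a zigzag on the arrows to \<open>Z\<close>\<close>
  define ev where "ev p h = foldr (\<lambda>s h. case s of Fwd f \<Rightarrow> Comp \<C> h f | Inv w \<Rightarrow> lift w h) p h" for p h
  have ev_simps: "ev [] h = h" "ev (Fwd f # p) h = Comp \<C> (ev p h) f" "ev (Inv w # p) h = lift w (ev p h)"
    "ev (p @ q) h = ev p (ev q h)" for f p q w h
    by (auto simp: ev_def)
  have lift: "P (Cod \<C> w) (lift w h) \<and> Comp \<C> (lift w h) w = h" if "w \<in> \<W>" "P (Dom \<C> w) h" for w h
    unfolding lift_def
    by (rule theI', use orth[OF that(1)] that(2) in \<open>unfold orthogonal_to_def P_def\<close>) blast
  have lift_eq: "lift w h = k" if "w \<in> \<W>" "P (Cod \<C> w) k" "Comp \<C> k w = h" for w h k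
  proof -
    have "P (Dom \<C> w) h" using that weq_Arr unfolding P_def by (auto simp: Comp_Arr Dom_Comp Cod_Comp subset_iff)
    then have "\<exists>!\<psi>. P (Cod \<C> w) \<psi> \<and> Comp \<C> \<psi> w = h"
      using orth[OF that(1)] unfolding orthogonal_to_def P_def by (auto simp: conj_assoc)
    then show ?thesis unfolding lift_def using that by (intro the1_equality) auto
  qed
  have ev_P: "P X (ev p h)" if "zz X p Y" "P Y h" for X p Y h
    using that
  proof (induction p arbitrary: X)
    case (Cons s p)
    then show ?case
      by (cases s) (auto simp: zz_iffs ev_simps lift, auto simp: P_def Comp_Arr Dom_Comp Cod_Comp)
  qed (auto simp: zz_iffs ev_simps)
  have basic: "ev a h = ev b h" if "loc_basic \<C> \<W> a b" "zz X a Y" "P Y h" for a b X Y h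
    using that(1)
  proof cases
    case (1 X')
    then show ?thesis using that by (auto simp: zz_iffs ev_simps Cod_Ide P_def Comp_Ide)
  next
    case (2 f g)
    then show ?thesis using that by (auto simp: zz_iffs ev_simps P_def Comp_assoc)
  next
    \<comment> \<open>A step followed by its inverse acts trivially because the extension restricts
      back; the opposite order, treated next, needs uniqueness of extensions.\<close>
    case (3 w)
    then show ?thesis using that lift by (auto simp: zz_iffs ev_simps)
  next
    case (4 w)
    then show ?thesis using that lift_eq by (auto simp: zz_iffs ev_simps)
  qed
  have Z: "Z \<in> Obj \<C>" using fg rel_zz zz_target by blast
  then have PZ: "P Z (Ide \<C> Z)" by (simp add: P_def Ide_Arr Dom_Ide Cod_Ide)
  have step: "ev p (Ide \<C> Z) = ev q (Ide \<C> Z)" if pq: "(p, q) \<in> loc_step \<C> \<W> Y Z" for p q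
  proof -
    obtain u v c d where *: "p = u @ c @ v" "q = u @ d @ v" "loc_basic \<C> \<W> c d" "zz Y p Z"
      using pq unfolding loc_step_def by blast
    then obtain Y1 Y2 where "zz Y u Y1" "zz Y1 c Y2" "zz Y2 v Z" by (auto simp: zz_append_iff)
    then show ?thesis using * basic ev_P[OF _ PZ] by (auto simp: ev_simps)
  qed
  have "([Fwd f], [Fwd g]) \<in> (loc_step \<C> \<W> Y Z \<union> (loc_step \<C> \<W> Y Z)\<inverse>)\<^sup>*"
    using fg by (simp add: loc_rel_def)
  then have "ev [Fwd f] (Ide \<C> Z) = ev [Fwd g] (Ide \<C> Z)"
    by (induction rule: rtrancl_induct) (use step in force)+
  moreover have "f \<in> Arr \<C>" "Cod \<C> f = Z" "g \<in> Arr \<C>" "Cod \<C> g = Z"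
    using rel_zz[OF fg] by (auto simp: zz_iffs)
  ultimately show ?thesis using Ide_Comp[of f] Ide_Comp[of g] by (simp add: ev_simps)
qed

text \<open>The union in \<open>loc_precomp\<close> does not depend on representatives, because the
  relation on zigzags is a congruence.\<close>

lemma precomp_class:
  assumes f: "f \<in> Arr \<C>" and p: "zz (Cod \<C> f) p Z"
  shows "loc_precomp \<C> \<W> f Z (loc_rel \<C> \<W> (Cod \<C> f) Z `` {p}) = loc_rel \<C> \<W> (Dom \<C> f) Z `` {Fwd f # p}"
proof -
  have "loc_rel \<C> \<W> (Dom \<C> f) Z `` {Fwd f # q} = loc_rel \<C> \<W> (Dom \<C> f) Z `` {Fwd f # p}"
    if "(p, q) \<in> loc_rel \<C> \<W> (Cod \<C> f) Z" for q
  proof -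
    have "([Fwd f] @ p, [Fwd f] @ q) \<in> loc_rel \<C> \<W> (Dom \<C> f) Z"
      by (rule rel_append_left[OF that]) (use f in \<open>auto simp: zz_iffs Cod_Obj\<close>)
    then show ?thesis using equiv_class_eq[OF equiv_rel] by fastforce
  qed
  then show ?thesis unfolding loc_precomp_def using rel_refl[OF p] by blast
qed

text \<open>When \<open>Z\<close> is local for \<open>\<W>\<close>, each morphism to
  \<open>Z\<close> in the localization comes from exactly one arrow of \<open>\<C>\<close>, and
  \<open>loc_precomp\<close> becomes composition with \<open>f\<close>. Surjectivity then gives the
  extension, injectivity its uniqueness.\<close>

lemma orthogonal_if_bij_precomp:
  assumes orth: "\<And>w. w \<in> \<W> \<Longrightarrow> orthogonal_to \<C> w Z"
    and f: "f \<in> Arr \<C>"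
    and bij: "bij_betw (loc_precomp \<C> \<W> f Z) (loc_hom \<C> \<W> (Cod \<C> f) Z) (loc_hom \<C> \<W> (Dom \<C> f) Z)"
  shows "orthogonal_to \<C> f Z"
  unfolding orthogonal_to_def
proof (intro ballI impI, elim conjE)
  fix \<phi> assume \<phi>: "\<phi> \<in> Arr \<C>" "Dom \<C> \<phi> = Dom \<C> f" "Cod \<C> \<phi> = Z"
  let ?R = "loc_rel \<C> \<W> (Dom \<C> f) Z" and ?R' = "loc_rel \<C> \<W> (Cod \<C> f) Z"
  have ext: "\<exists>\<psi>\<in>Arr \<C>. Dom \<C> \<psi> = Cod \<C> w \<and> Cod \<C> \<psi> = Z \<and> Comp \<C> \<psi> w = \<phi>"
    if "w \<in> \<W>" "\<phi> \<in> Arr \<C>" "Dom \<C> \<phi> = Dom \<C> w" "Cod \<C> \<phi> = Z" for w \<phi>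
    using orth[OF that(1)] that unfolding orthogonal_to_def by blast
  have pre: "loc_precomp \<C> \<W> f Z (?R' `` {[Fwd \<psi>]}) = ?R `` {[Fwd (Comp \<C> \<psi> f)]}"
    if "\<psi> \<in> Arr \<C>" "Dom \<C> \<psi> = Cod \<C> f" "Cod \<C> \<psi> = Z" for \<psi>
  proof -
    have "zz (Cod \<C> f) [Fwd \<psi>] Z" using that by (auto simp: zz_iffs Cod_Obj)
    moreover have "?R `` {[Fwd f, Fwd \<psi>]} = ?R `` {[Fwd (Comp \<C> \<psi> f)]}"
      using rel_Fwd_Fwd[of f \<psi>] that f equiv_class_eq[OF equiv_rel] by auto
    ultimately show ?thesis using precomp_class[OF f] by auto
  qed
  show "\<exists>!\<psi>. \<psi> \<in> Arr \<C> \<and> Dom \<C> \<psi> = Cod \<C> f \<and> Cod \<C> \<psi> = Z \<and> Comp \<C> \<psi> f = \<phi>"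
  proof (rule ex_ex1I)
    have zphi: "zz (Dom \<C> f) [Fwd \<phi>] Z" using \<phi> by (auto simp: zz_iffs Cod_Obj)
    then have "?R `` {[Fwd \<phi>]} \<in> loc_hom \<C> \<W> (Dom \<C> f) Z"
      by (auto simp: loc_hom_def intro: quotientI)
    then obtain c where "c \<in> loc_hom \<C> \<W> (Cod \<C> f) Z" "loc_precomp \<C> \<W> f Z c = ?R `` {[Fwd \<phi>]}"
      using bij unfolding bij_betw_def by (metis imageE)
    then obtain p where p: "zz (Cod \<C> f) p Z" "loc_precomp \<C> \<W> f Z (?R' `` {p}) = ?R `` {[Fwd \<phi>]}"
      unfolding loc_hom_def by (auto elim: quotientE)
    obtain \<psi> where \<psi>: "\<psi> \<in> Arr \<C>" "Dom \<C> \<psi> = Cod \<C> f" "Cod \<C> \<psi> = Z" "(p, [Fwd \<psi>]) \<in> ?R'"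
      using zigzag_related_arrow[OF ext p(1)] by blast
    have "?R' `` {p} = ?R' `` {[Fwd \<psi>]}" using equiv_class_eq[OF equiv_rel \<psi>(4)] .
    then have "?R `` {[Fwd (Comp \<C> \<psi> f)]} = ?R `` {[Fwd \<phi>]}" using pre[OF \<psi>(1-3)] p(2) by simp
    then have "([Fwd (Comp \<C> \<psi> f)], [Fwd \<phi>]) \<in> ?R"
      using eq_equiv_class[OF _ equiv_rel] zphi by auto
    then have "Comp \<C> \<psi> f = \<phi>" by (rule related_arrows_eq[rotated]) (rule orth)
    then show "\<exists>\<psi>. \<psi> \<in> Arr \<C> \<and> Dom \<C> \<psi> = Cod \<C> f \<and> Cod \<C> \<psi> = Z \<and> Comp \<C> \<psi> f = \<phi>"
      using \<psi> by blast
  next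
    fix \<psi> \<psi>'
    assume 1: "\<psi> \<in> Arr \<C> \<and> Dom \<C> \<psi> = Cod \<C> f \<and> Cod \<C> \<psi> = Z \<and> Comp \<C> \<psi> f = \<phi>"
      and 2: "\<psi>' \<in> Arr \<C> \<and> Dom \<C> \<psi>' = Cod \<C> f \<and> Cod \<C> \<psi>' = Z \<and> Comp \<C> \<psi>' f = \<phi>"
    have mem: "?R' `` {[Fwd k]} \<in> loc_hom \<C> \<W> (Cod \<C> f) Z"
      if "k \<in> Arr \<C> \<and> Dom \<C> k = Cod \<C> f \<and> Cod \<C> k = Z \<and> Comp \<C> k f = \<phi>" for k
      using that by (auto simp: loc_hom_def zz_iffs Cod_Obj intro!: quotientI)
    have "?R' `` {[Fwd \<psi>]} = ?R' `` {[Fwd \<psi>']}"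
      using bij mem[OF 1] mem[OF 2] pre 1 2 unfolding bij_betw_def inj_on_def by metis
    moreover have "zz (Cod \<C> f) [Fwd \<psi>'] Z" using 2 by (auto simp: zz_iffs Cod_Obj)
    ultimately have "([Fwd \<psi>], [Fwd \<psi>']) \<in> ?R'" using eq_equiv_class[OF _ equiv_rel] by blast
    then show "\<psi> = \<psi>'" by (rule related_arrows_eq[rotated]) (rule orth)
  qed
qed

text \<open>Every zigzag is related to an arrow, and there is just one arrow. Meant for the pointed
  category, with \<open>t\<close> the constant map.\<close>

lemma loc_hom_singleton:
  assumes ext: "\<And>w \<phi>. w \<in> \<W> \<Longrightarrow> \<phi> \<in> Arr \<C> \<Longrightarrow> Dom \<C> \<phi> = Dom \<C> w \<Longrightarrow> Cod \<C> \<phi> = Z \<Longrightarrow>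
      \<exists>\<psi>\<in>Arr \<C>. Dom \<C> \<psi> = Cod \<C> w \<and> Cod \<C> \<psi> = Z \<and> Comp \<C> \<psi> w = \<phi>"
    and t: "t \<in> Arr \<C>" "Dom \<C> t = Y" "Cod \<C> t = Z"
    and uniq: "\<And>h. h \<in> Arr \<C> \<Longrightarrow> Dom \<C> h = Y \<Longrightarrow> Cod \<C> h = Z \<Longrightarrow> h = t"
  shows "loc_hom \<C> \<W> Y Z = {loc_class \<C> \<W> t}"
proof -
  have zt: "zz Y [Fwd t] Z" using t by (auto simp: zz_iffs Cod_Obj)
  have "loc_rel \<C> \<W> Y Z `` {p} = loc_class \<C> \<W> t" if "zz Y p Z" for p
  proof -
    obtain h where "h \<in> Arr \<C>" "Dom \<C> h = Y" "Cod \<C> h = Z" "(p, [Fwd h]) \<in> loc_rel \<C> \<W> Y Z"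
      using zigzag_related_arrow[OF ext \<open>zz Y p Z\<close>] by blast
    then show ?thesis
      using uniq[of h] equiv_class_eq[OF equiv_rel] t unfolding loc_class_def by auto
  qed
  then show ?thesis using zt unfolding loc_hom_def quotient_def by auto
qed

end

section \<open>Sections of presheaves over open subspaces\<close>

text \<open>Pullback along \<open>g\<close> of a section over \<open>V'\<close> to a section over
  \<open>V\<close>. Both \<open>rst_open\<close> and \<open>rst\<close> are instances, so that their
  interchange laws all come from the one composition law \<open>pull_pull\<close>.\<close>

definition pull :: "'u presheaf \<Rightarrow> cspace \<Rightarrow> cspace \<Rightarrow> cmap \<Rightarrow> complex set \<Rightarrow> complex set \<Rightarrow> 'u \<Rightarrow> 'u" where
  "pull F X Y g V V' = rst F (open_sub X V) (open_sub Y V') (rrestr X Y g V V')"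

lemma presheaf_val:
  "is_presheaf F \<Longrightarrow> complex_space U \<Longrightarrow> complex_space V \<Longrightarrow> f \<in> rhom U V \<Longrightarrow> a \<in> val F V \<Longrightarrow>
    rst F U V f a \<in> val F U"
  unfolding is_presheaf_def by (elim conjE) blast

lemma presheaf_id: "is_presheaf F \<Longrightarrow> complex_space U \<Longrightarrow> a \<in> val F U \<Longrightarrow> rst F U U (rid U) a = a"
  unfolding is_presheaf_def by (elim conjE) blast

lemma presheaf_comp:
  "is_presheaf F \<Longrightarrow> complex_space U \<Longrightarrow> complex_space V \<Longrightarrow> complex_space W \<Longrightarrow>
    f \<in> rhom U V \<Longrightarrow> g \<in> rhom V W \<Longrightarrow> a \<in> val F W \<Longrightarrow>
    rst F U W (rcomp U V W g f) a = rst F U V f (rst F V W g a)"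
  unfolding is_presheaf_def by (elim conjE) blast

lemma sheaf_presheaf: "sheaf F \<Longrightarrow> is_presheaf F"
  by (simp add: sheaf_def)

lemma points_open: "points U \<in> opens U"
  by simp

lemma preim_rid: "V \<in> opens U \<Longrightarrow> preim U (fst (rid U)) V = V"
  using openin_subset by (fastforce simp: preim_def rid_def)

lemma rid_rhom: "complex_space U \<Longrightarrow> rid U \<in> rhom U U"
  by (rule rhom_id[OF complex_space_precringed])

lemma complex_rcomp:
  "complex_space U \<Longrightarrow> complex_space V \<Longrightarrow> complex_space W \<Longrightarrow> f \<in> rhom U V \<Longrightarrow> g \<in> rhom V W \<Longrightarrow>
    rcomp U V W g f \<in> rhom U W"
  by (intro rcomp_in_rhom complex_space_precringed)

lemma pull_val:
  assumes "is_presheaf F" "complex_space X" "complex_space Y" "g \<in> rhom X Y" "V \<in> opens X" "V' \<in> opens Y"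
    "V \<subseteq> preim X (fst g) V'" "a \<in> val F (open_sub Y V')"
  shows "pull F X Y g V V' a \<in> val F (open_sub X V)"
  unfolding pull_def using assms
  by (intro presheaf_val rrestr_in_rhom complex_space_open_sub complex_space_precringed)

lemma pull_pull:
  assumes "is_presheaf F" "complex_space X" "complex_space Y" "complex_space Z" "g \<in> rhom X Y" "h \<in> rhom Y Z"
    "V \<in> opens X" "V' \<in> opens Y" "V'' \<in> opens Z"
    "V \<subseteq> preim X (fst g) V'" "V' \<subseteq> preim Y (fst h) V''" "a \<in> val F (open_sub Z V'')"
  shows "pull F X Y g V V' (pull F Y Z h V' V'' a) = pull F X Z (rcomp X Y Z h g) V V'' a"
proof -
  note c = assms(2-4)[THEN complex_space_precringed]
  show ?thesis
    unfolding pull_def rcomp_rrestr[OF c assms(5-11), symmetric]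
    by (rule presheaf_comp[symmetric, OF assms(1)])
      (intro rrestr_in_rhom complex_space_open_sub assms c)+
qed

lemma rst_open_eq_pull:
  "V \<in> opens U \<Longrightarrow> V' \<in> opens U \<Longrightarrow> rst_open F U V V' = pull F U U (rid U) V V'"
  by (simp add: pull_def incl_eq_rrestr)

lemma pull_points:
  "complex_space X \<Longrightarrow> complex_space Y \<Longrightarrow> g \<in> rhom X Y \<Longrightarrow> pull F X Y g (points X) (points Y) = rst F X Y g"
  by (simp add: pull_def rrestr_points complex_space_precringed)

lemma rst_open_val:
  assumes "is_presheaf F" "complex_space U" "V \<in> opens U" "V' \<in> opens U" "V \<subseteq> V'" "a \<in> val F (open_sub U V')"
  shows "rst_open F U V V' a \<in> val F (open_sub U V)"
  unfolding rst_open_eq_pull[OF assms(3,4)]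
  by (rule pull_val) (use assms in \<open>simp_all add: rid_rhom preim_rid\<close>)

lemma rst_open_id:
  assumes "is_presheaf F" "complex_space U" "V \<in> opens U" "a \<in> val F (open_sub U V)"
  shows "rst_open F U V V a = a"
  unfolding rid_open_sub[OF complex_space_precringed[OF assms(2)] assms(3), symmetric]
  by (rule presheaf_id[OF assms(1) complex_space_open_sub[OF assms(2,3)] assms(4)])

lemma rst_open_pull:
  assumes "is_presheaf F" "complex_space X" "complex_space Y" "g \<in> rhom X Y"
    "W \<in> opens X" "V \<in> opens X" "V' \<in> opens Y" "W \<subseteq> V" "V \<subseteq> preim X (fst g) V'" "a \<in> val F (open_sub Y V')"
  shows "rst_open F X W V (pull F X Y g V V' a) = pull F X Y g W V' a"
proof -
  have "rcomp X X Y g (rid X) = g" by (rule rcomp_rid) (use assms in \<open>auto intro: complex_space_precringed\<close>)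
  then show ?thesis unfolding rst_open_eq_pull[OF assms(5,6)]
    by (subst pull_pull[OF assms(1,2,2,3) rid_rhom[OF assms(2)] assms(4-7)])
      (use assms in \<open>simp_all add: preim_rid\<close>)
qed

lemma pull_rst_open:
  assumes "is_presheaf F" "complex_space X" "complex_space Y" "g \<in> rhom X Y"
    "V \<in> opens X" "W \<in> opens Y" "V' \<in> opens Y" "V \<subseteq> preim X (fst g) W" "W \<subseteq> V'" "a \<in> val F (open_sub Y V')"
  shows "pull F X Y g V W (rst_open F Y W V' a) = pull F X Y g V V' a"
proof -
  have "rcomp X Y Y (rid Y) g = g" by (rule rid_rcomp) (use assms in \<open>auto intro: complex_space_precringed\<close>)
  then show ?thesis unfolding rst_open_eq_pull[OF assms(6,7)]
    by (subst pull_pull[OF assms(1,2,3,3,4) rid_rhom[OF assms(3)] assms(5-8)])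
      (use assms in \<open>simp_all add: preim_rid\<close>)
qed

lemma rst_open_rst_open:
  assumes "is_presheaf F" "complex_space U" "V'' \<in> opens U" "V' \<in> opens U" "V \<in> opens U" "V'' \<subseteq> V'" "V' \<subseteq> V"
    "a \<in> val F (open_sub U V)"
  shows "rst_open F U V'' V' (rst_open F U V' V a) = rst_open F U V'' V a"
  unfolding rst_open_eq_pull[OF assms(4,5)] rst_open_eq_pull[OF assms(3,5)]
  by (rule rst_open_pull) (use assms in \<open>simp_all add: rid_rhom preim_rid\<close>)

lemma incl_open_sub:
  "V \<in> opens U \<Longrightarrow> W' \<subseteq> V \<Longrightarrow> incl (open_sub U V) W W' = incl U W W'"
  by (simp add: incl_def Int_absorb1)

lemma rst_open_open_sub:
  "V \<in> opens U \<Longrightarrow> W \<subseteq> V \<Longrightarrow> W' \<subseteq> V \<Longrightarrow> rst_open F (open_sub U V) W W' = rst_open F U W W'"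
  by (simp add: incl_open_sub Int_absorb1)

section \<open>Separation and gluing\<close>

lemma sheaf_glueD:
  assumes "sheaf F" "complex_space U" "\<V> \<subseteq> opens U" "\<Union>\<V> = points U"
    "\<And>V. V \<in> \<V> \<Longrightarrow> s V \<in> val F (open_sub U V)"
    "\<And>V W. V \<in> \<V> \<Longrightarrow> W \<in> \<V> \<Longrightarrow> rst_open F U (V \<inter> W) V (s V) = rst_open F U (V \<inter> W) W (s W)"
  shows "\<exists>!a. a \<in> val F U \<and> (\<forall>V\<in>\<V>. rst_open F U V (points U) a = s V)"
proof -
  from assms(1) have "\<forall>U \<V> s. complex_space U \<and> \<V> \<subseteq> opens U \<and> \<Union>\<V> = points U \<and>
        (\<forall>V\<in>\<V>. s V \<in> val F (open_sub U V)) \<and>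
        (\<forall>V\<in>\<V>. \<forall>W\<in>\<V>. rst_open F U (V \<inter> W) V (s V) = rst_open F U (V \<inter> W) W (s W)) \<longrightarrow>
        (\<exists>!a. a \<in> val F U \<and> (\<forall>V\<in>\<V>. rst_open F U V (points U) a = s V))"
    unfolding sheaf_def by (elim conjE)
  from this[rule_format, of U \<V> s] assms(2-6) show ?thesis by blast
qed

text \<open>Take the cover by all open sets on which \<open>a\<close> and \<open>b\<close> agree:
  both glue the same family.\<close>

lemma sheaf_separated:
  assumes F: "sheaf F" and U: "complex_space U" and ab: "a \<in> val F U" "b \<in> val F U"
    and loc: "\<And>u. u \<in> points U \<Longrightarrow> \<exists>V\<in>opens U. u \<in> V \<and> rst_open F U V (points U) a = rst_open F U V (points U) b"
  shows "a = b"
proof -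
  let ?\<V> = "{V \<in> opens U. rst_open F U V (points U) a = rst_open F U V (points U) b}"
  let ?s = "\<lambda>V. rst_open F U V (points U) a"
  note P = sheaf_presheaf[OF F]
  have sub: "V \<subseteq> points U" if "V \<in> opens U" for V using that openin_subset by blast
  have un: "\<Union>?\<V> = points U" using loc sub by blast
  have aU: "a \<in> val F (open_sub U (points U))" using ab(1) by simp
  have ex1: "\<exists>!c. c \<in> val F U \<and> (\<forall>V\<in>?\<V>. rst_open F U V (points U) c = ?s V)"
  proof (rule sheaf_glueD[OF F U _ un])
    show "?s V \<in> val F (open_sub U V)" if "V \<in> ?\<V>" for V
      using that by (intro rst_open_val[OF P U _ points_open sub aU]) auto
    show "rst_open F U (V \<inter> W) V (?s V) = rst_open F U (V \<inter> W) W (?s W)" if "V \<in> ?\<V>" "W \<in> ?\<V>" for V W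
    proof -
      have o: "V \<in> opens U" "W \<in> opens U" "V \<inter> W \<in> opens U" using that by auto
      show ?thesis
        using rst_open_rst_open[OF P U o(3) o(1) points_open Int_lower1 sub[OF o(1)] aU]
          rst_open_rst_open[OF P U o(3) o(2) points_open Int_lower2 sub[OF o(2)] aU] by simp
    qed
  qed auto
  show ?thesis
    using the1_equality[OF ex1, of a] the1_equality[OF ex1, of b] ab by simp
qed

lemma sheaf_separated_open:
  assumes F: "sheaf F" and U: "complex_space U" and V: "V \<in> opens U"
    and ab: "a \<in> val F (open_sub U V)" "b \<in> val F (open_sub U V)"
    and loc: "\<And>u. u \<in> V \<Longrightarrow> \<exists>W\<in>opens U. u \<in> W \<and> W \<subseteq> V \<and> rst_open F U W V a = rst_open F U W V b"
  shows "a = b"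
proof (rule sheaf_separated[OF F complex_space_open_sub[OF U V] ab])
  fix u assume "u \<in> points (open_sub U V)"
  then have "u \<in> V" using points_open_sub[OF V] by simp
  then obtain W where W: "W \<in> opens U" "u \<in> W" "W \<subseteq> V" "rst_open F U W V a = rst_open F U W V b"
    using loc by blast
  then have "rst_open F (open_sub U V) W (points (open_sub U V)) a = rst_open F (open_sub U V) W (points (open_sub U V)) b"
    using rst_open_open_sub[OF V W(3) subset_refl, of F] unfolding points_open_sub[OF V] by simp
  moreover have "W \<in> opens (open_sub U V)" using W opens_open_sub[OF V] by blast
  ultimately show "\<exists>W\<in>opens (open_sub U V). u \<in> W \<and>
      rst_open F (open_sub U V) W (points (open_sub U V)) a = rst_open F (open_sub U V) W (points (open_sub U V)) b"
    using W(2) by blast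
qed

text \<open>Uniqueness makes arbitrarily chosen local solutions of \<open>P\<close> agree on
  overlaps. The result satisfies \<open>P\<close> locally; passing from there to a global statement
  is left to the property at hand, such as \<open>compat_local\<close>.\<close>

lemma sheaf_glue_predicate:
  assumes F: "sheaf F" and U: "complex_space U"
    and ex: "\<And>u. u \<in> points U \<Longrightarrow> \<exists>V\<in>opens U. u \<in> V \<and> (\<exists>s\<in>val F (open_sub U V). P V s)"
    and restr: "\<And>V W s. V \<in> opens U \<Longrightarrow> W \<in> opens U \<Longrightarrow> W \<subseteq> V \<Longrightarrow> s \<in> val F (open_sub U V) \<Longrightarrow> P V s \<Longrightarrow>
      P W (rst_open F U W V s)"
    and uniq: "\<And>V s t. V \<in> opens U \<Longrightarrow> s \<in> val F (open_sub U V) \<Longrightarrow> t \<in> val F (open_sub U V) \<Longrightarrow>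
      P V s \<Longrightarrow> P V t \<Longrightarrow> s = t"
  shows "\<exists>a\<in>val F U. \<forall>u\<in>points U. \<exists>V\<in>opens U. u \<in> V \<and> P V (rst_open F U V (points U) a)"
proof -
  note pre = sheaf_presheaf[OF F]
  let ?\<V> = "{V \<in> opens U. \<exists>s\<in>val F (open_sub U V). P V s}"
  obtain s where s: "\<And>V. V \<in> ?\<V> \<Longrightarrow> s V \<in> val F (open_sub U V) \<and> P V (s V)"
  proof
    show "(SOME s. s \<in> val F (open_sub U V) \<and> P V s) \<in> val F (open_sub U V) \<and> P V (SOME s. s \<in> val F (open_sub U V) \<and> P V s)"
      if "V \<in> ?\<V>" for V
      by (rule someI_ex) (use that in blast)
  qed
  have sub: "V \<subseteq> points U" if "V \<in> opens U" for V using that openin_subset by blast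
  have un: "\<Union>?\<V> = points U"
  proof
    show "\<Union>?\<V> \<subseteq> points U" using sub by (intro Union_least) simp
    show "points U \<subseteq> \<Union>?\<V>"
    proof
      fix u assume "u \<in> points U"
      from ex[OF this] obtain V where "V \<in> ?\<V>" "u \<in> V" by auto
      then show "u \<in> \<Union>?\<V>" by (rule UnionI)
    qed
  qed
  have "\<exists>!a. a \<in> val F U \<and> (\<forall>V\<in>?\<V>. rst_open F U V (points U) a = s V)"
  proof (rule sheaf_glueD[OF F U _ un])
    show "s V \<in> val F (open_sub U V)" if "V \<in> ?\<V>" for V using s[OF that] by blast
    show "rst_open F U (V \<inter> W) V (s V) = rst_open F U (V \<inter> W) W (s W)" if V: "V \<in> ?\<V>" and W: "W \<in> ?\<V>" for V W
    proof -
      have o: "V \<in> opens U" "W \<in> opens U" "V \<inter> W \<in> opens U" using V W by auto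
      show ?thesis
      proof (rule uniq[OF o(3)])
        show "rst_open F U (V \<inter> W) V (s V) \<in> val F (open_sub U (V \<inter> W))"
          using s[OF V] by (intro rst_open_val[OF pre U o(3,1)]) auto
        show "rst_open F U (V \<inter> W) W (s W) \<in> val F (open_sub U (V \<inter> W))"
          using s[OF W] by (intro rst_open_val[OF pre U o(3,2)]) auto
        show "P (V \<inter> W) (rst_open F U (V \<inter> W) V (s V))" using s[OF V] by (intro restr[OF o(1,3)]) auto
        show "P (V \<inter> W) (rst_open F U (V \<inter> W) W (s W))" using s[OF W] by (intro restr[OF o(2,3)]) auto
      qed
    qed
  qed auto
  then obtain a where a: "a \<in> val F U" "\<forall>V\<in>?\<V>. rst_open F U V (points U) a = s V" by blast
  have "\<forall>u\<in>points U. \<exists>V\<in>opens U. u \<in> V \<and> P V (rst_open F U V (points U) a)"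
  proof
    fix u assume "u \<in> points U"
    then have "u \<in> \<Union>?\<V>" unfolding un .
    then obtain V where V: "V \<in> ?\<V>" "u \<in> V" by (rule UnionE)
    have "P V (rst_open F U V (points U) a)" using bspec[OF a(2) V(1)] s[OF V(1)] by simp
    then show "\<exists>V\<in>opens U. u \<in> V \<and> P V (rst_open F U V (points U) a)"
      using V by (intro bexI[of _ V]) auto
  qed
  then show ?thesis using a(1) by blast
qed

section \<open>Germs and stalks\<close>

lemma germ_eqI:
  assumes F: "is_presheaf F" and U: "complex_space U"
    and V: "V \<in> opens U" "s \<in> val F (open_sub U V)" and V': "V' \<in> opens U" "s' \<in> val F (open_sub U V')"
    and W: "W \<in> opens U" "u \<in> W" "W \<subseteq> V \<inter> V'" "rst_open F U W V s = rst_open F U W V' s'"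
  shows "germ F U u V s = germ F U u V' s'"
proof -
  have *: "germ F U u V s \<subseteq> germ F U u V' s'"
    if V: "V \<in> opens U" "s \<in> val F (open_sub U V)" and V': "V' \<in> opens U" "s' \<in> val F (open_sub U V')"
    and W: "W \<in> opens U" "u \<in> W" "W \<subseteq> V \<inter> V'" "rst_open F U W V s = rst_open F U W V' s'" for V V' s s' W
  proof (clarsimp simp: germ_def)
    fix T t Q assume T: "openin (space_top U) T" "u \<in> T" "t \<in> val F (open_sub U T)"
      and Q: "openin (space_top U) Q" "u \<in> Q" "Q \<subseteq> V" "Q \<subseteq> T" "rst_open F U Q V s = rst_open F U Q T t"
    have o: "W \<inter> Q \<in> opens U" "T \<in> opens U" "Q \<in> opens U" using W Q T by auto
    have "rst_open F U (W \<inter> Q) V' s' = rst_open F U (W \<inter> Q) W (rst_open F U W V' s')"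
      using W(3) by (intro rst_open_rst_open[OF F U o(1) W(1) V'(1) _ _ V'(2), symmetric]) auto
    also have "\<dots> = rst_open F U (W \<inter> Q) V s"
      unfolding W(4)[symmetric] using W(3) by (intro rst_open_rst_open[OF F U o(1) W(1) V(1) _ _ V(2)]) auto
    also have "\<dots> = rst_open F U (W \<inter> Q) Q (rst_open F U Q V s)"
      using Q(3) by (intro rst_open_rst_open[OF F U o(1) o(3) V(1) _ _ V(2), symmetric]) auto
    also have "\<dots> = rst_open F U (W \<inter> Q) T t"
      unfolding Q(5) using Q(4) by (intro rst_open_rst_open[OF F U o(1) o(3) o(2) _ _ T(3)]) auto
    finally show "\<exists>R. openin (space_top U) R \<and> u \<in> R \<and> R \<subseteq> V' \<and> R \<subseteq> T \<and> rst_open F U R V' s' = rst_open F U R T t"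
      using o W Q by (intro exI[of _ "W \<inter> Q"]) auto
  qed
  have W': "W \<subseteq> V' \<inter> V" using W(3) by blast
  show ?thesis
    by (rule antisym[OF *[OF V V' W] *[OF V' V W(1,2) W' W(4)[symmetric]]])
qed

lemma germ_self: "V \<in> opens U \<Longrightarrow> u \<in> V \<Longrightarrow> s \<in> val F (open_sub U V) \<Longrightarrow> (V, s) \<in> germ F U u V s"
  unfolding germ_def by blast

lemma germ_eqD:
  assumes "germ F U u V s = germ F U u V' s'" "V' \<in> opens U" "u \<in> V'" "s' \<in> val F (open_sub U V')"
  shows "\<exists>W\<in>opens U. u \<in> W \<and> W \<subseteq> V \<inter> V' \<and> rst_open F U W V s = rst_open F U W V' s'"
proof -
  have "(V', s') \<in> germ F U u V s" unfolding assms(1) by (rule germ_self) (use assms in auto)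
  then show ?thesis unfolding germ_def by blast
qed

lemma germ_mem:
  assumes "(V', s') \<in> germ F U u V s" "is_presheaf F" "complex_space U" "V \<in> opens U" "s \<in> val F (open_sub U V)"
  shows "V' \<in> opens U" "u \<in> V'" "s' \<in> val F (open_sub U V')" "germ F U u V' s' = germ F U u V s"
proof -
  show *: "V' \<in> opens U" "u \<in> V'" "s' \<in> val F (open_sub U V')" using assms(1) by (auto simp: germ_def)
  obtain W where "W \<in> opens U" "u \<in> W" "W \<subseteq> V \<inter> V'" "rst_open F U W V s = rst_open F U W V' s'"
    using assms(1) unfolding germ_def by blast
  then show "germ F U u V' s' = germ F U u V s"
    by (intro germ_eqI[symmetric, OF assms(2-5) *(1,3)])
qed

lemma germ_rst_open:
  assumes "is_presheaf F" "complex_space U" "V \<in> opens U" "W \<in> opens U" "W \<subseteq> V" "u \<in> W" "s \<in> val F (open_sub U V)"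
  shows "germ F U u W (rst_open F U W V s) = germ F U u V s"
proof (rule germ_eqI[OF assms(1,2,4) _ assms(3,7,4,6)])
  show v: "rst_open F U W V s \<in> val F (open_sub U W)" by (rule rst_open_val[OF assms(1,2,4,3,5,7)])
  show "rst_open F U W W (rst_open F U W V s) = rst_open F U W V s" by (rule rst_open_id[OF assms(1,2,4) v])
qed (use assms in auto)

text \<open>Maps on stalks are encoded as unions over all representatives of a germ; naturality
  makes the union a single germ. \<open>T\<close> moves neighbourhoods: it is the identity for
  simplicial operators and maps of sheaves, and the preimage for \<open>stalk_pull\<close>.\<close>

lemma germ_bind:
  assumes F: "is_presheaf F" and U: "complex_space U" and G: "is_presheaf G" and U': "complex_space U'"
    and T: "\<And>V. V \<in> opens U \<Longrightarrow> T V \<in> opens U'" "\<And>V. u \<in> V \<Longrightarrow> u' \<in> T V" "\<And>V W. W \<subseteq> V \<Longrightarrow> T W \<subseteq> T V"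
    and val: "\<And>V s. V \<in> opens U \<Longrightarrow> s \<in> val F (open_sub U V) \<Longrightarrow> \<eta> V s \<in> val G (open_sub U' (T V))"
    and nat: "\<And>V W s. V \<in> opens U \<Longrightarrow> W \<in> opens U \<Longrightarrow> W \<subseteq> V \<Longrightarrow> s \<in> val F (open_sub U V) \<Longrightarrow>
      \<eta> W (rst_open F U W V s) = rst_open G U' (T W) (T V) (\<eta> V s)"
    and V: "V \<in> opens U" "u \<in> V" "s \<in> val F (open_sub U V)"
  shows "(\<Union>(V, s)\<in>germ F U u V s. germ G U' u' (T V) (\<eta> V s)) = germ G U' u' (T V) (\<eta> V s)"
proof (rule SUP_eq_const, goal_cases)
  case 1
  show ?case using germ_self[OF V] by blast
next
  case (2 p)
  obtain V' s' where p: "p = (V', s')" by (cases p)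
  note m = germ_mem[OF 2[unfolded p] F U V(1,3)]
  obtain W where W: "W \<in> opens U" "u \<in> W" "W \<subseteq> V' \<inter> V" "rst_open F U W V' s' = rst_open F U W V s"
    using germ_eqD[OF m(4) V] by blast
  have WV: "W \<subseteq> V" "W \<subseteq> V'" using W(3) by auto
  have "germ G U' u' (T V') (\<eta> V' s') = germ G U' u' (T V) (\<eta> V s)"
  proof (rule germ_eqI[OF G U' T(1)[OF m(1)] val[OF m(1,3)] T(1)[OF V(1)] val[OF V(1,3)] T(1)[OF W(1)] T(2)[OF W(2)]])
    show "T W \<subseteq> T V' \<inter> T V" using T(3)[OF WV(1)] T(3)[OF WV(2)] by blast
    show "rst_open G U' (T W) (T V') (\<eta> V' s') = rst_open G U' (T W) (T V) (\<eta> V s)"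
      unfolding nat[OF m(1) W(1) WV(2) m(3), symmetric] nat[OF V(1) W(1) WV(1) V(3), symmetric] W(4) ..
  qed
  then show ?case unfolding p by simp
qed

section \<open>Operators, maps and pullbacks on stalks\<close>

lemma simplicial_sheaf_level: "simplicial_sheaf F \<Longrightarrow> sheaf (lvl F n)"
  unfolding simplicial_sheaf_def by (elim conjE) blast

lemma simplicial_sheaf_presheaf: "simplicial_sheaf F \<Longrightarrow> is_presheaf (lvl F n)"
  by (rule sheaf_presheaf[OF simplicial_sheaf_level])

lemma sop_val:
  "simplicial_sheaf F \<Longrightarrow> \<theta> \<in> Delta m n \<Longrightarrow> complex_space U \<Longrightarrow> a \<in> val (lvl F n) U \<Longrightarrow>
    sop F m n \<theta> U a \<in> val (lvl F m) U"
  unfolding simplicial_sheaf_def by (elim conjE) blast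

lemma sop_rst:
  "simplicial_sheaf F \<Longrightarrow> \<theta> \<in> Delta m n \<Longrightarrow> complex_space U \<Longrightarrow> complex_space V \<Longrightarrow> f \<in> rhom U V \<Longrightarrow>
    a \<in> val (lvl F n) V \<Longrightarrow> sop F m n \<theta> U (rst (lvl F n) U V f a) = rst (lvl F m) U V f (sop F m n \<theta> V a)"
  unfolding simplicial_sheaf_def by (elim conjE) blast

lemma simplicial_mapD:
  assumes "simplicial_map h"
  shows map_dom: "simplicial_sheaf (fst h)" and map_cod: "simplicial_sheaf (fst (snd h))"
    and map_extend: "extend (fst h) (cmp h) = cmp h"
    and map_val: "complex_space U \<Longrightarrow> a \<in> val (lvl (fst h) n) U \<Longrightarrow> cmp h n U a \<in> val (lvl (fst (snd h)) n) U"
    and map_rst: "complex_space U \<Longrightarrow> complex_space V \<Longrightarrow> f \<in> rhom U V \<Longrightarrow> a \<in> val (lvl (fst h) n) V \<Longrightarrow>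
      cmp h n U (rst (lvl (fst h) n) U V f a) = rst (lvl (fst (snd h)) n) U V f (cmp h n V a)"
    and map_sop: "\<theta> \<in> Delta m n \<Longrightarrow> complex_space U \<Longrightarrow> a \<in> val (lvl (fst h) n) U \<Longrightarrow>
      cmp h m U (sop (fst h) m n \<theta> U a) = sop (fst (snd h)) m n \<theta> U (cmp h n U a)"
proof -
  obtain F G \<eta> where h: "h = (F, G, \<eta>)" by (cases h)
  note * = assms[unfolded h simplicial_map_def split]
  show "simplicial_sheaf (fst h)" "simplicial_sheaf (fst (snd h))" "extend (fst h) (cmp h) = cmp h"
    using * unfolding h by simp_all
  show "complex_space U \<Longrightarrow> a \<in> val (lvl (fst h) n) U \<Longrightarrow> cmp h n U a \<in> val (lvl (fst (snd h)) n) U"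
    using * unfolding h fst_conv snd_conv by blast
  show "complex_space U \<Longrightarrow> complex_space V \<Longrightarrow> f \<in> rhom U V \<Longrightarrow> a \<in> val (lvl (fst h) n) V \<Longrightarrow>
      cmp h n U (rst (lvl (fst h) n) U V f a) = rst (lvl (fst (snd h)) n) U V f (cmp h n V a)"
    using * unfolding h fst_conv snd_conv by blast
  show "\<theta> \<in> Delta m n \<Longrightarrow> complex_space U \<Longrightarrow> a \<in> val (lvl (fst h) n) U \<Longrightarrow>
      cmp h m U (sop (fst h) m n \<theta> U a) = sop (fst (snd h)) m n \<theta> U (cmp h n U a)"
    using * unfolding h fst_conv snd_conv by blast
qed

lemma incl_rhom:
  assumes "complex_space U" "V \<in> opens U" "V' \<in> opens U" "V \<subseteq> V'"
  shows "incl U V V' \<in> rhom (open_sub U V) (open_sub U V')"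
  unfolding incl_eq_rrestr[OF assms(2,3)]
  by (rule rrestr_in_rhom) (use assms in \<open>auto simp: complex_space_precringed rid_rhom preim_rid\<close>)

lemma stalk_simp_iff:
  "c \<in> simp (stalk F U u) n \<longleftrightarrow> (\<exists>V\<in>opens U. \<exists>s\<in>val (lvl F n) (open_sub U V). u \<in> V \<and> c = germ (lvl F n) U u V s)"
  unfolding stalk_def by auto

lemma stalk_act_germ:
  assumes F: "simplicial_sheaf F" and U: "complex_space U" and \<theta>: "\<theta> \<in> Delta m n"
    and V: "V \<in> opens U" "u \<in> V" "s \<in> val (lvl F n) (open_sub U V)"
  shows "act (stalk F U u) m n \<theta> (germ (lvl F n) U u V s) = germ (lvl F m) U u V (sop F m n \<theta> (open_sub U V) s)"
  unfolding stalk_def sset.simps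
  by (rule germ_bind[where T = "\<lambda>V. V" and \<eta> = "\<lambda>V s. sop F m n \<theta> (open_sub U V) s",
        OF simplicial_sheaf_presheaf[OF F] U simplicial_sheaf_presheaf[OF F] U _ _ _ _ _ V])
    (auto intro!: sop_val[OF F \<theta>] sop_rst[OF F \<theta>] complex_space_open_sub[OF U] incl_rhom[OF U])

lemma stalk_map_germ:
  assumes h: "simplicial_map h" and U: "complex_space U"
    and V: "V \<in> opens U" "u \<in> V" "s \<in> val (lvl (fst h) n) (open_sub U V)"
  shows "stalk_map h U u n (germ (lvl (fst h) n) U u V s) = germ (lvl (fst (snd h)) n) U u V (cmp h n (open_sub U V) s)"
proof -
  have "Cod sSh h = fst (snd h)" by (simp add: sSh_def)
  then show ?thesis unfolding stalk_map_def
    by (simp only:) (rule germ_bind[where T = "\<lambda>V. V" and \<eta> = "\<lambda>V s. cmp h n (open_sub U V) s",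
        OF simplicial_sheaf_presheaf[OF map_dom[OF h]] U simplicial_sheaf_presheaf[OF map_cod[OF h]] U _ _ _ _ _ V],
     auto intro!: map_val[OF h] map_rst[OF h] complex_space_open_sub[OF U] incl_rhom[OF U])
qed

lemma stalk_simp_germ:
  "V \<in> opens U \<Longrightarrow> u \<in> V \<Longrightarrow> s \<in> val (lvl F n) (open_sub U V) \<Longrightarrow> germ (lvl F n) U u V s \<in> simp (stalk F U u) n"
  unfolding stalk_simp_iff by blast

lemma act_closed_stalk:
  assumes F: "simplicial_sheaf F" and U: "complex_space U"
  shows "act_closed (stalk F U u)"
  unfolding act_closed_def
proof (intro allI impI, elim conjE)
  fix m n \<theta> c assume \<theta>: "\<theta> \<in> Delta m n" and "c \<in> simp (stalk F U u) n"
  then obtain V s where V: "V \<in> opens U" "u \<in> V" "s \<in> val (lvl F n) (open_sub U V)" and c: "c = germ (lvl F n) U u V s"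
    unfolding stalk_simp_iff by blast
  show "act (stalk F U u) m n \<theta> c \<in> simp (stalk F U u) m"
    unfolding c stalk_act_germ[OF F U \<theta> V]
    by (rule stalk_simp_germ[OF V(1,2) sop_val[OF F \<theta> complex_space_open_sub[OF U V(1)] V(3)]])
qed

lemma stalk_map_simp:
  assumes h: "simplicial_map h" and U: "complex_space U" and c: "c \<in> simp (stalk (fst h) U u) n"
  shows "stalk_map h U u n c \<in> simp (stalk (fst (snd h)) U u) n"
proof -
  obtain V s where V: "V \<in> opens U" "u \<in> V" "s \<in> val (lvl (fst h) n) (open_sub U V)" and c: "c = germ (lvl (fst h) n) U u V s"
    using c unfolding stalk_simp_iff by blast
  show ?thesis unfolding c stalk_map_germ[OF h U V]
    by (rule stalk_simp_germ[OF V(1,2) map_val[OF h complex_space_open_sub[OF U V(1)] V(3)]])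
qed

lemma stalk_map_act:
  assumes h: "simplicial_map h" and U: "complex_space U" and \<theta>: "\<theta> \<in> Delta m n"
    and c: "c \<in> simp (stalk (fst h) U u) n"
  shows "stalk_map h U u m (act (stalk (fst h) U u) m n \<theta> c) = act (stalk (fst (snd h)) U u) m n \<theta> (stalk_map h U u n c)"
proof -
  obtain V s where V: "V \<in> opens U" "u \<in> V" "s \<in> val (lvl (fst h) n) (open_sub U V)" and c: "c = germ (lvl (fst h) n) U u V s"
    using c unfolding stalk_simp_iff by blast
  note O = complex_space_open_sub[OF U V(1)]
  show ?thesis
    unfolding c stalk_act_germ[OF map_dom[OF h] U \<theta> V] stalk_map_germ[OF h U V]
      stalk_map_germ[OF h U V(1,2) sop_val[OF map_dom[OF h] \<theta> O V(3)]]
      stalk_act_germ[OF map_cod[OF h] U \<theta> V(1,2) map_val[OF h O V(3)]] map_sop[OF h \<theta> O V(3)] ..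
qed

text \<open>The map from the stalk at \<open>fst g u\<close> to the stalk at \<open>u\<close>
  induced by \<open>g\<close>. It carries witnesses for lifts from \<open>Y\<close> to
  \<open>X\<close>, which makes lifting natural in the space.\<close>

definition stalk_pull :: "'u ssheaf \<Rightarrow> cspace \<Rightarrow> cspace \<Rightarrow> cmap \<Rightarrow> complex \<Rightarrow> nat \<Rightarrow>
    (complex set \<times> 'u) set \<Rightarrow> (complex set \<times> 'u) set" where
  "stalk_pull F X Y g u n c =
     (\<Union>(V, s)\<in>c. germ (lvl F n) X u (preim X (fst g) V) (pull (lvl F n) X Y g (preim X (fst g) V) V s))"

lemma stalk_pull_germ:
  assumes F: "simplicial_sheaf F" and X: "complex_space X" and Y: "complex_space Y" and g: "g \<in> rhom X Y"
    and u: "u \<in> points X" and V: "V \<in> opens Y" "fst g u \<in> V" "s \<in> val (lvl F n) (open_sub Y V)"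
  shows "stalk_pull F X Y g u n (germ (lvl F n) Y (fst g u) V s) =
    germ (lvl F n) X u (preim X (fst g) V) (pull (lvl F n) X Y g (preim X (fst g) V) V s)"
  unfolding stalk_pull_def
proof (rule germ_bind[where T = "\<lambda>V. preim X (fst g) V" and \<eta> = "\<lambda>V s. pull (lvl F n) X Y g (preim X (fst g) V) V s",
        OF simplicial_sheaf_presheaf[OF F] Y simplicial_sheaf_presheaf[OF F] X _ _ _ _ _ V])
  note P = simplicial_sheaf_presheaf[OF F]
  show "preim X (fst g) V \<in> opens X" if "V \<in> opens Y" for V using rhom_preim_open[OF g that] .
  show "u \<in> preim X (fst g) V" if "fst g u \<in> V" for V using u that by (simp add: preim_def)
  show mono: "preim X (fst g) W \<subseteq> preim X (fst g) V" if "W \<subseteq> V" for V W using that by (auto simp: preim_def)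
  show "pull (lvl F n) X Y g (preim X (fst g) V) V s \<in> val (lvl F n) (open_sub X (preim X (fst g) V))"
    if "V \<in> opens Y" "s \<in> val (lvl F n) (open_sub Y V)" for V s
    by (rule pull_val[OF P X Y g rhom_preim_open[OF g that(1)] that(1) subset_refl that(2)])
  show "pull (lvl F n) X Y g (preim X (fst g) W) W (rst_open (lvl F n) Y W V s) =
      rst_open (lvl F n) X (preim X (fst g) W) (preim X (fst g) V) (pull (lvl F n) X Y g (preim X (fst g) V) V s)"
    if V: "V \<in> opens Y" "W \<in> opens Y" "W \<subseteq> V" "s \<in> val (lvl F n) (open_sub Y V)" for V W s
    unfolding pull_rst_open[OF P X Y g rhom_preim_open[OF g V(2)] V(2,1) subset_refl V(3,4)]
      rst_open_pull[OF P X Y g rhom_preim_open[OF g V(2)] rhom_preim_open[OF g V(1)] V(1) mono[OF V(3)] subset_refl V(4)] ..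
qed

lemma sop_pull:
  assumes F: "simplicial_sheaf F" and \<theta>: "\<theta> \<in> Delta m n" and X: "complex_space X" and Y: "complex_space Y" and g: "g \<in> rhom X Y"
    and V: "V \<in> opens X" "V' \<in> opens Y" "V \<subseteq> preim X (fst g) V'" "s \<in> val (lvl F n) (open_sub Y V')"
  shows "sop F m n \<theta> (open_sub X V) (pull (lvl F n) X Y g V V' s) = pull (lvl F m) X Y g V V' (sop F m n \<theta> (open_sub Y V') s)"
  unfolding pull_def
  by (rule sop_rst[OF F \<theta> complex_space_open_sub[OF X V(1)] complex_space_open_sub[OF Y V(2)] _ V(4)])
    (intro rrestr_in_rhom complex_space_precringed X Y g V)

lemma map_pull:
  assumes h: "simplicial_map h" and X: "complex_space X" and Y: "complex_space Y" and g: "g \<in> rhom X Y"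
    and V: "V \<in> opens X" "V' \<in> opens Y" "V \<subseteq> preim X (fst g) V'" "s \<in> val (lvl (fst h) n) (open_sub Y V')"
  shows "cmp h n (open_sub X V) (pull (lvl (fst h) n) X Y g V V' s) = pull (lvl (fst (snd h)) n) X Y g V V' (cmp h n (open_sub Y V') s)"
  unfolding pull_def
  by (rule map_rst[OF h complex_space_open_sub[OF X V(1)] complex_space_open_sub[OF Y V(2)] _ V(4)])
    (intro rrestr_in_rhom complex_space_precringed X Y g V)

lemma
  assumes F: "simplicial_sheaf F" and X: "complex_space X" and Y: "complex_space Y" and g: "g \<in> rhom X Y"
    and u: "u \<in> points X" and c: "c \<in> simp (stalk F Y (fst g u)) n"
  shows stalk_pull_simp: "stalk_pull F X Y g u n c \<in> simp (stalk F X u) n"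
    and stalk_pull_act: "\<theta> \<in> Delta m n \<Longrightarrow> stalk_pull F X Y g u m (act (stalk F Y (fst g u)) m n \<theta> c) =
      act (stalk F X u) m n \<theta> (stalk_pull F X Y g u n c)"
proof -
  obtain V s where V: "V \<in> opens Y" "fst g u \<in> V" "s \<in> val (lvl F n) (open_sub Y V)" and c: "c = germ (lvl F n) Y (fst g u) V s"
    using c unfolding stalk_simp_iff by blast
  have p: "preim X (fst g) V \<in> opens X" "u \<in> preim X (fst g) V"
    using rhom_preim_open[OF g V(1)] u V(2) by (auto simp: preim_def)
  have v: "pull (lvl F n) X Y g (preim X (fst g) V) V s \<in> val (lvl F n) (open_sub X (preim X (fst g) V))"
    by (rule pull_val[OF simplicial_sheaf_presheaf[OF F] X Y g p(1) V(1) subset_refl V(3)])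
  show "stalk_pull F X Y g u n c \<in> simp (stalk F X u) n"
    unfolding c stalk_pull_germ[OF F X Y g u V] by (rule stalk_simp_germ[OF p v])
  show "stalk_pull F X Y g u m (act (stalk F Y (fst g u)) m n \<theta> c) =
      act (stalk F X u) m n \<theta> (stalk_pull F X Y g u n c)" if \<theta>: "\<theta> \<in> Delta m n"
    unfolding c stalk_act_germ[OF F Y \<theta> V] stalk_pull_germ[OF F X Y g u V] stalk_act_germ[OF F X \<theta> p v]
      sop_pull[OF F \<theta> X Y g p(1) V(1) subset_refl V(3)]
    by (rule stalk_pull_germ[OF F X Y g u V(1,2) sop_val[OF F \<theta> complex_space_open_sub[OF Y V(1)] V(3)]])
qed

lemma stalk_map_pull:
  assumes h: "simplicial_map h" and X: "complex_space X" and Y: "complex_space Y" and g: "g \<in> rhom X Y"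
    and u: "u \<in> points X" and c: "c \<in> simp (stalk (fst h) Y (fst g u)) n"
  shows "stalk_map h X u n (stalk_pull (fst h) X Y g u n c) = stalk_pull (fst (snd h)) X Y g u n (stalk_map h Y (fst g u) n c)"
proof -
  obtain V s where V: "V \<in> opens Y" "fst g u \<in> V" "s \<in> val (lvl (fst h) n) (open_sub Y V)" and c: "c = germ (lvl (fst h) n) Y (fst g u) V s"
    using c unfolding stalk_simp_iff by blast
  have p: "preim X (fst g) V \<in> opens X" "u \<in> preim X (fst g) V"
    using rhom_preim_open[OF g V(1)] u V(2) by (auto simp: preim_def)
  have v: "pull (lvl (fst h) n) X Y g (preim X (fst g) V) V s \<in> val (lvl (fst h) n) (open_sub X (preim X (fst g) V))"
    by (rule pull_val[OF simplicial_sheaf_presheaf[OF map_dom[OF h]] X Y g p(1) V(1) subset_refl V(3)])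
  show ?thesis
    unfolding c stalk_pull_germ[OF map_dom[OF h] X Y g u V] stalk_map_germ[OF h Y V] stalk_map_germ[OF h X p v]
      map_pull[OF h X Y g p(1) V(1) subset_refl V(3)]
    by (rule stalk_pull_germ[symmetric, OF map_cod[OF h] X Y g u V(1,2) map_val[OF h complex_space_open_sub[OF Y V(1)] V(3)]])
qed

lemma slinked_map:
  assumes l: "((n, x), (m, y)) \<in> slinked K"
    and comm: "\<And>m n \<theta> x. \<theta> \<in> Delta m n \<Longrightarrow> x \<in> simp K n \<Longrightarrow> g m (act K m n \<theta> x) = act L m n \<theta> (g n x)"
    and val: "\<And>n x. x \<in> simp K n \<Longrightarrow> g n x \<in> simp L n"
  shows "((n, g n x), (m, g m y)) \<in> slinked L"
  using l
proof (induction rule: slinked_induct)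
  case base
  show ?case by (rule slinked_refl)
next
  case (down k l \<theta> z)
  have "((k, g k (act K k l \<theta> z)), (l, g l z)) \<in> slinked L"
    unfolding comm[OF down(1,2)] by (rule slinked_act[OF down(1) val[OF down(2)]])
  then show ?case using down(3) slinked_sym slinked_trans by blast
next
  case (up k l \<theta> z)
  have "((k, g k (act K k l \<theta> z)), (l, g l z)) \<in> slinked L"
    unfolding comm[OF up(1,2)] by (rule slinked_act[OF up(1) val[OF up(2)]])
  then show ?case using up(3) slinked_trans by blast
qed

lemma const_ssheaf_simps [simp]: "lvl (const_ssheaf X) n = X" "sop (const_ssheaf X) m n \<theta> U a = a"
  by (simp_all add: const_ssheaf_def)

text \<open>All simplicial operators of the target are identities, so the value does not change
  along any link of a chain.\<close>

lemma stalk_map_slinked: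
  assumes h: "simplicial_map h" and X: "fst (snd h) = const_ssheaf X" and U: "complex_space U"
    and l: "((n, c), (m, d)) \<in> slinked (stalk (fst h) U u)"
  shows "stalk_map h U u m d = stalk_map h U u n c"
proof -
  have *: "stalk_map h U u k (act (stalk (fst h) U u) k l \<theta> z) = stalk_map h U u l z"
    if \<theta>: "\<theta> \<in> Delta k l" and z: "z \<in> simp (stalk (fst h) U u) l" for k l \<theta> z
  proof -
    obtain V s where V: "V \<in> opens U" "u \<in> V" "s \<in> val X (open_sub U V)" and c: "stalk_map h U u l z = germ X U u V s"
      using stalk_map_simp[OF h U z] unfolding stalk_simp_iff X by auto
    have S: "simplicial_sheaf (const_ssheaf X)" using map_cod[OF h] X by simp
    show ?thesis unfolding stalk_map_act[OF h U \<theta> z] X c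
      using stalk_act_germ[OF S U \<theta> V(1,2), of s] V(3) by simp
  qed
  show ?thesis
    using l by (induction rule: slinked_induct) (simp_all add: *)
qed

section \<open>Lifting maps to a sheaf along simplicial weak equivalences\<close>

text \<open>An extension problem: \<open>\<phi>\<close> is to be extended along the weak equivalence
  \<open>f\<close> to a map from the target of \<open>f\<close>. The unique solution is assembled
  from \<open>lift\<close> below.\<close>

locale weq_lifting =
  fixes f \<phi> :: "'u sarrow" and X :: "'u presheaf"
  assumes weq: "f \<in> simplicial_weq" and \<phi>: "simplicial_map \<phi>" and \<phi>_dom: "fst \<phi> = fst f"
    and \<phi>_cod: "fst (snd \<phi>) = const_ssheaf X"
begin

abbreviation A where "A \<equiv> fst f"
abbreviation B where "B \<equiv> fst (snd f)"

lemma f: "simplicial_map f"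
  using weq by (simp add: simplicial_weq_def sSh_def)

lemma A: "simplicial_sheaf A" by (rule map_dom[OF f])
lemma B: "simplicial_sheaf B" by (rule map_cod[OF f])
lemma cX: "simplicial_sheaf (const_ssheaf X)" using map_cod[OF \<phi>] \<phi>_cod by simp
lemma X: "sheaf X" using simplicial_sheaf_level[OF cX] by simp

lemmas preX = sheaf_presheaf[OF X]
lemmas preB = simplicial_sheaf_presheaf[OF B]

lemma stalk_weq:
  assumes "complex_space U" "u \<in> points U"
  shows "sset_weak_equivalence (stalk A U u) (stalk B U u) (stalk_map f U u)"
proof -
  have "\<forall>U u. complex_space U \<and> u \<in> points U \<longrightarrow> sset_weak_equivalence (stalk A U u) (stalk B U u) (stalk_map f U u)"
    using weq unfolding simplicial_weq_def by (simp add: sSh_def)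
  then show ?thesis using assms by blast
qed

lemma stalk_surj:
  assumes U: "complex_space U" "u \<in> points U" and y: "y \<in> simp (stalk B U u) n"
  shows "\<exists>m x. x \<in> simp (stalk A U u) m \<and> ((n, y), (m, stalk_map f U u m x)) \<in> slinked (stalk B U u)"
  by (rule weak_equivalence_slinked_surj[OF act_closed_stalk[OF A U(1)] act_closed_stalk[OF B U(1)] _ _ stalk_weq[OF U] y])
    (simp_all add: stalk_map_act[OF f U(1)] stalk_map_simp[OF f U(1)])

text \<open>The weak equivalence is injective on components, so the two simplices already lie in one
  component of the stalk of \<open>A\<close>, on which \<open>\<phi>\<close> is constant.\<close>

lemma stalk_inj:
  assumes U: "complex_space U" "u \<in> points U" and x: "x \<in> simp (stalk A U u) m" "x' \<in> simp (stalk A U u) m'"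
    and l: "((m, stalk_map f U u m x), (m', stalk_map f U u m' x')) \<in> slinked (stalk B U u)"
  shows "stalk_map \<phi> U u m x = stalk_map \<phi> U u m' x'"
proof -
  have "((m, x), (m', x')) \<in> slinked (stalk A U u)"
    by (rule weak_equivalence_slinked_inj[OF act_closed_stalk[OF A U(1)] act_closed_stalk[OF B U(1)] _ _ stalk_weq[OF U] x l])
      (simp_all add: stalk_map_act[OF f U(1)] stalk_map_simp[OF f U(1)])
  then show ?thesis
    using stalk_map_slinked[OF \<phi> \<phi>_cod U(1), of m x m' x' u] unfolding \<phi>_dom by simp
qed

text \<open>The lift \<open>z\<close> of \<open>\<phi>\<close> at \<open>y\<close> is pinned down by its germs: at each point the connected component of
  \<open>y\<close> in the stalk of \<open>B\<close> comes from exactly one component of the stalk of \<open>A\<close>, and on that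
  component the locally constant \<open>\<phi>\<close> takes a single value.\<close>

definition compat :: "cspace \<Rightarrow> complex set \<Rightarrow> nat \<Rightarrow> 'u \<Rightarrow> 'u \<Rightarrow> bool" where
  "compat U V n y z \<longleftrightarrow> (\<forall>u\<in>V. \<forall>m. \<forall>x\<in>simp (stalk A U u) m.
     ((n, germ (lvl B n) U u V y), (m, stalk_map f U u m x)) \<in> slinked (stalk B U u) \<longrightarrow>
     germ X U u V z = stalk_map \<phi> U u m x)"

lemma compatD:
  "compat U V n y z \<Longrightarrow> u \<in> V \<Longrightarrow> x \<in> simp (stalk A U u) m \<Longrightarrow>
    ((n, germ (lvl B n) U u V y), (m, stalk_map f U u m x)) \<in> slinked (stalk B U u) \<Longrightarrow>
    germ X U u V z = stalk_map \<phi> U u m x"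
  unfolding compat_def by blast

lemma point: "V \<in> opens U \<Longrightarrow> u \<in> V \<Longrightarrow> u \<in> points U"
  using openin_subset by blast

text \<open>One witness at each point suffices: any other witness at that point gives the same value
  of \<open>\<phi>\<close> by \<open>stalk_inj\<close>.\<close>

lemma compatI1:
  assumes U: "complex_space U" and V: "V \<in> opens U"
    and ex: "\<And>u. u \<in> V \<Longrightarrow> \<exists>m x. x \<in> simp (stalk A U u) m \<and>
      ((n, germ (lvl B n) U u V y), (m, stalk_map f U u m x)) \<in> slinked (stalk B U u) \<and>
      germ X U u V z = stalk_map \<phi> U u m x"
  shows "compat U V n y z"
  unfolding compat_def
proof (intro ballI allI impI)
  fix u m x assume u: "u \<in> V" and x: "x \<in> simp (stalk A U u) m"
    and l: "((n, germ (lvl B n) U u V y), (m, stalk_map f U u m x)) \<in> slinked (stalk B U u)"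
  obtain m' x' where x': "x' \<in> simp (stalk A U u) m'"
    "((n, germ (lvl B n) U u V y), (m', stalk_map f U u m' x')) \<in> slinked (stalk B U u)"
    "germ X U u V z = stalk_map \<phi> U u m' x'" using ex[OF u] by blast
  have "stalk_map \<phi> U u m' x' = stalk_map \<phi> U u m x"
    by (rule stalk_inj[OF U point[OF V u] x'(1) x slinked_trans[OF slinked_sym[OF x'(2)] l]])
  then show "germ X U u V z = stalk_map \<phi> U u m x" using x'(3) by simp
qed

lemma compat_ex:
  assumes U: "complex_space U" and V: "V \<in> opens U" and y: "y \<in> val (lvl B n) (open_sub U V)"
    and c: "compat U V n y z" and u: "u \<in> V"
  shows "\<exists>m x. x \<in> simp (stalk A U u) m \<and>
      ((n, germ (lvl B n) U u V y), (m, stalk_map f U u m x)) \<in> slinked (stalk B U u) \<and>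
      germ X U u V z = stalk_map \<phi> U u m x"
  using stalk_surj[OF U point[OF V u] stalk_simp_germ[OF V u y]] compatD[OF c u] by blast

text \<open>Surjectivity on components supplies a witness at every point, and it fixes the germ of
  the lift there; sections of a sheaf are determined by their germs.\<close>

lemma compat_unique:
  assumes U: "complex_space U" and V: "V \<in> opens U" and y: "y \<in> val (lvl B n) (open_sub U V)"
    and z: "z \<in> val X (open_sub U V)" "z' \<in> val X (open_sub U V)"
    and c: "compat U V n y z" "compat U V n y z'"
  shows "z = z'"
proof (rule sheaf_separated_open[OF X U V z])
  fix u assume u: "u \<in> V"
  obtain m x where x: "x \<in> simp (stalk A U u) m"
      "((n, germ (lvl B n) U u V y), (m, stalk_map f U u m x)) \<in> slinked (stalk B U u)"
    using compat_ex[OF U V y c(1) u] by blast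
  have "germ X U u V z = germ X U u V z'"
    using compatD[OF c(1) u x] compatD[OF c(2) u x] by simp
  from germ_eqD[OF this V u z(2)] show "\<exists>W\<in>opens U. u \<in> W \<and> W \<subseteq> V \<and> rst_open X U W V z = rst_open X U W V z'"
    by auto
qed

lemma compat_restrict:
  assumes U: "complex_space U" and V: "V \<in> opens U" "W \<in> opens U" "W \<subseteq> V"
    and y: "y \<in> val (lvl B n) (open_sub U V)" and z: "z \<in> val X (open_sub U V)" and c: "compat U V n y z"
  shows "compat U W n (rst_open (lvl B n) U W V y) (rst_open X U W V z)"
  unfolding compat_def
proof (intro ballI allI impI)
  fix u m x assume u: "u \<in> W" and x: "x \<in> simp (stalk A U u) m"
    and l: "((n, germ (lvl B n) U u W (rst_open (lvl B n) U W V y)), (m, stalk_map f U u m x)) \<in> slinked (stalk B U u)"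
  have uV: "u \<in> V" using u V by blast
  show "germ X U u W (rst_open X U W V z) = stalk_map \<phi> U u m x"
    using compatD[OF c uV x] l unfolding germ_rst_open[OF preX U V u z] germ_rst_open[OF preB U V u y] by simp
qed

lemma compat_local:
  assumes U: "complex_space U" and V: "V \<in> opens U"
    and y: "y \<in> val (lvl B n) (open_sub U V)" and z: "z \<in> val X (open_sub U V)"
    and loc: "\<And>u. u \<in> V \<Longrightarrow> \<exists>W\<in>opens U. u \<in> W \<and> W \<subseteq> V \<and> compat U W n (rst_open (lvl B n) U W V y) (rst_open X U W V z)"
  shows "compat U V n y z"
  unfolding compat_def
proof (intro ballI allI impI)
  fix u m x assume u: "u \<in> V" and x: "x \<in> simp (stalk A U u) m"
    and l: "((n, germ (lvl B n) U u V y), (m, stalk_map f U u m x)) \<in> slinked (stalk B U u)"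
  obtain W where W: "W \<in> opens U" "u \<in> W" "W \<subseteq> V" and c: "compat U W n (rst_open (lvl B n) U W V y) (rst_open X U W V z)"
    using loc[OF u] by blast
  show "germ X U u V z = stalk_map \<phi> U u m x"
    using compatD[OF c W(2) x] l
    unfolding germ_rst_open[OF preX U V W(1,3,2) z] germ_rst_open[OF preB U V W(1,3,2) y] by simp
qed

text \<open>\<open>compat\<close> sees \<open>y\<close> only through the components of its germs, so
  the same \<open>z\<close> serves every section in the same components, even at another simplicial
  level.\<close>

lemma compat_slinked:
  assumes c: "compat U V n y z"
    and l: "\<And>u. u \<in> V \<Longrightarrow> ((n, germ (lvl B n) U u V y), (n', germ (lvl B n') U u V y')) \<in> slinked (stalk B U u)"
  shows "compat U V n' y' z"
  unfolding compat_def
proof (intro ballI allI impI)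
  fix u m x assume u: "u \<in> V" and x: "x \<in> simp (stalk A U u) m"
    and l': "((n', germ (lvl B n') U u V y'), (m, stalk_map f U u m x)) \<in> slinked (stalk B U u)"
  show "germ X U u V z = stalk_map \<phi> U u m x"
    by (rule compatD[OF c u x slinked_trans[OF l[OF u] l']])
qed

lemma slinked_sop:
  assumes U: "complex_space U" and \<theta>: "\<theta> \<in> Delta k l" and V: "V \<in> opens U" "u \<in> V"
    and y: "y \<in> val (lvl B l) (open_sub U V)"
  shows "((k, germ (lvl B k) U u V (sop B k l \<theta> (open_sub U V) y)), (l, germ (lvl B l) U u V y)) \<in> slinked (stalk B U u)"
  using slinked_act[OF \<theta> stalk_simp_germ[OF V y]] unfolding stalk_act_germ[OF B U \<theta> V y] .

lemma compat_sop_iff: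
  assumes U: "complex_space U" and \<theta>: "\<theta> \<in> Delta k l" and V: "V \<in> opens U"
    and y: "y \<in> val (lvl B l) (open_sub U V)"
  shows "compat U V k (sop B k l \<theta> (open_sub U V) y) z \<longleftrightarrow> compat U V l y z"
  using compat_slinked[OF _ slinked_sop[OF U \<theta> V _ y]] compat_slinked[OF _ slinked_sym[OF slinked_sop[OF U \<theta> V _ y]]] by blast

lemma compat_f:
  assumes U: "complex_space U" and V: "V \<in> opens U" and a: "a \<in> val (lvl A n) (open_sub U V)"
  shows "compat U V n (cmp f n (open_sub U V) a) (cmp \<phi> n (open_sub U V) a)"
proof (rule compatI1[OF U V], intro exI conjI)
  fix u assume u: "u \<in> V"
  have a': "a \<in> val (lvl (fst \<phi>) n) (open_sub U V)" using a \<phi>_dom by simp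
  show "germ (lvl A n) U u V a \<in> simp (stalk A U u) n" by (rule stalk_simp_germ[OF V u a])
  show "((n, germ (lvl B n) U u V (cmp f n (open_sub U V) a)), (n, stalk_map f U u n (germ (lvl A n) U u V a))) \<in> slinked (stalk B U u)"
    unfolding stalk_map_germ[OF f U V u a] by (rule slinked_refl)
  show "germ X U u V (cmp \<phi> n (open_sub U V) a) = stalk_map \<phi> U u n (germ (lvl A n) U u V a)"
    using stalk_map_germ[OF \<phi> U V u a'] unfolding \<phi>_dom \<phi>_cod by simp
qed

text \<open>The local lifts are carried along a chain of simplicial operators in the stalk that ends in the
  image of \<open>A\<close>; every step shrinks the neighbourhood.\<close>

lemma compat_exists_chain:
  assumes U: "complex_space U" "u \<in> points U" and x: "x \<in> simp (stalk A U u) m"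
    and l: "((m, stalk_map f U u m x), (k, c)) \<in> slinked (stalk B U u)"
  shows "\<exists>W\<in>opens U. u \<in> W \<and> (\<exists>y\<in>val (lvl B k) (open_sub U W). c = germ (lvl B k) U u W y \<and>
    (\<exists>z\<in>val X (open_sub U W). compat U W k y z))"
  using l
proof (induction rule: slinked_induct)
  case base
  obtain V a where V: "V \<in> opens U" "u \<in> V" "a \<in> val (lvl A m) (open_sub U V)" and x: "x = germ (lvl A m) U u V a"
    using x unfolding stalk_simp_iff by blast
  note O = complex_space_open_sub[OF U(1) V(1)]
  have a': "a \<in> val (lvl (fst \<phi>) m) (open_sub U V)" using V(3) \<phi>_dom by simp
  have "cmp \<phi> m (open_sub U V) a \<in> val X (open_sub U V)" using map_val[OF \<phi> O a'] \<phi>_cod by simp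
  then show ?case
    using V compat_f[OF U(1) V(1,3)] map_val[OF f O V(3)] stalk_map_germ[OF f U(1) V] unfolding x by blast
next
  case (down k l \<theta> c)
  then obtain W y z where W: "W \<in> opens U" "u \<in> W" and y: "y \<in> val (lvl B l) (open_sub U W)" and c: "c = germ (lvl B l) U u W y"
    and z: "z \<in> val X (open_sub U W)" "compat U W l y z" by blast
  have "act (stalk B U u) k l \<theta> c = germ (lvl B k) U u W (sop B k l \<theta> (open_sub U W) y)"
    unfolding c by (rule stalk_act_germ[OF B U(1) down(1) W y])
  moreover have "sop B k l \<theta> (open_sub U W) y \<in> val (lvl B k) (open_sub U W)"
    by (rule sop_val[OF B down(1) complex_space_open_sub[OF U(1) W(1)] y])
  moreover have "compat U W k (sop B k l \<theta> (open_sub U W) y) z"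
    unfolding compat_sop_iff[OF U(1) down(1) W(1) y] by (rule z(2))
  ultimately show ?case using W z(1) by blast
next
  case (up k l \<theta> c)
  then obtain W y z where W: "W \<in> opens U" "u \<in> W" and y: "y \<in> val (lvl B k) (open_sub U W)"
    and c: "act (stalk B U u) k l \<theta> c = germ (lvl B k) U u W y"
    and z: "z \<in> val X (open_sub U W)" "compat U W k y z" by blast
  obtain V b where V: "V \<in> opens U" "u \<in> V" and b: "b \<in> val (lvl B l) (open_sub U V)" and cb: "c = germ (lvl B l) U u V b"
    using up(2) unfolding stalk_simp_iff by blast
  have "germ (lvl B k) U u V (sop B k l \<theta> (open_sub U V) b) = germ (lvl B k) U u W y"
    using c unfolding cb stalk_act_germ[OF B U(1) up(1) V b] .
  \<comment> \<open>The image of \<open>b\<close> under the operator and the section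
    \<open>y\<close>, which has a lift, agree just near \<open>u\<close>. On \<open>Q\<close> they
    coincide, so the restriction of \<open>b\<close> inherits the restricted lift.\<close>
  from germ_eqD[OF this W y] obtain Q where Q: "Q \<in> opens U" "u \<in> Q" "Q \<subseteq> V" "Q \<subseteq> W"
    and eq: "rst_open (lvl B k) U Q V (sop B k l \<theta> (open_sub U V) b) = rst_open (lvl B k) U Q W y" by auto
  let ?b = "rst_open (lvl B l) U Q V b"
  have b': "?b \<in> val (lvl B l) (open_sub U Q)" by (rule rst_open_val[OF preB U(1) Q(1) V(1) Q(3) b])
  have "sop B k l \<theta> (open_sub U Q) ?b = rst_open (lvl B k) U Q W y"
    unfolding eq[symmetric]
    by (rule sop_rst[OF B up(1) complex_space_open_sub[OF U(1) Q(1)] complex_space_open_sub[OF U(1) V(1)] incl_rhom[OF U(1) Q(1) V(1) Q(3)] b])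
  moreover have "compat U Q k (rst_open (lvl B k) U Q W y) (rst_open X U Q W z)"
    by (rule compat_restrict[OF U(1) W(1) Q(1,4) y z])
  ultimately have "compat U Q l ?b (rst_open X U Q W z)"
    using compat_sop_iff[OF U(1) up(1) Q(1) b'] by simp
  moreover have "rst_open X U Q W z \<in> val X (open_sub U Q)"
    by (rule rst_open_val[OF preX U(1) Q(1) W(1) Q(4) z(1)])
  moreover have "c = germ (lvl B l) U u Q ?b"
    unfolding cb germ_rst_open[OF preB U(1) V(1) Q(1,3,2) b] ..
  ultimately show ?case using Q(1,2) b' by blast
qed

text \<open>Surjectivity on components provides the starting point of the chain in the image of
  \<open>A\<close>. The chain ends at a section with the same germ as \<open>y\<close>, and both are
  cut down to where they agree.\<close>

lemma compat_exists_local: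
  assumes U: "complex_space U" and V: "V \<in> opens U" and y: "y \<in> val (lvl B n) (open_sub U V)" and u: "u \<in> V"
  shows "\<exists>W\<in>opens U. u \<in> W \<and> W \<subseteq> V \<and> (\<exists>z\<in>val X (open_sub U W). compat U W n (rst_open (lvl B n) U W V y) z)"
proof -
  note uU = point[OF V u]
  obtain m x where x: "x \<in> simp (stalk A U u) m"
    "((n, germ (lvl B n) U u V y), (m, stalk_map f U u m x)) \<in> slinked (stalk B U u)"
    using stalk_surj[OF U uU stalk_simp_germ[OF V u y]] by blast
  obtain W y' z where W: "W \<in> opens U" "u \<in> W" and y': "y' \<in> val (lvl B n) (open_sub U W)"
    and eq: "germ (lvl B n) U u V y = germ (lvl B n) U u W y'" and z: "z \<in> val X (open_sub U W)" "compat U W n y' z"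
    using compat_exists_chain[OF U uU x(1) slinked_sym[OF x(2)]] by blast
  obtain Q where Q: "Q \<in> opens U" "u \<in> Q" "Q \<subseteq> V" "Q \<subseteq> W" and eq: "rst_open (lvl B n) U Q V y = rst_open (lvl B n) U Q W y'"
    using germ_eqD[OF eq W y'] by auto
  have "compat U Q n (rst_open (lvl B n) U Q V y) (rst_open X U Q W z)"
    unfolding eq by (rule compat_restrict[OF U W(1) Q(1,4) y' z])
  moreover have "rst_open X U Q W z \<in> val X (open_sub U Q)"
    by (rule rst_open_val[OF preX U Q(1) W(1) Q(4) z(1)])
  ultimately show ?thesis using Q by blast
qed

text \<open>Local lifts glue because \<open>compat_unique\<close> makes them agree on overlaps, and
  the glued section is a lift because \<open>compat\<close> is tested on germs.\<close>

lemma compat_exists: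
  assumes U: "complex_space U" and y: "y \<in> val (lvl B n) U"
  shows "\<exists>z\<in>val X U. compat U (points U) n y z"
proof -
  have y': "y \<in> val (lvl B n) (open_sub U (points U))" using y by simp
  have sub: "V \<subseteq> points U" if "V \<in> opens U" for V using that openin_subset by blast
  have "\<exists>z\<in>val X U. \<forall>u\<in>points U. \<exists>V\<in>opens U. u \<in> V \<and>
      compat U V n (rst_open (lvl B n) U V (points U) y) (rst_open X U V (points U) z)"
  proof (rule sheaf_glue_predicate[OF X U])
    fix u assume "u \<in> points U"
    then show "\<exists>V\<in>opens U. u \<in> V \<and> (\<exists>s\<in>val X (open_sub U V). compat U V n (rst_open (lvl B n) U V (points U) y) s)"
      using compat_exists_local[OF U points_open y'] by blast
  next
    fix V W s assume *: "V \<in> opens U" "W \<in> opens U" "W \<subseteq> V" "s \<in> val X (open_sub U V)"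
      "compat U V n (rst_open (lvl B n) U V (points U) y) s"
    note v = rst_open_val[OF preB U *(1) points_open sub[OF *(1)] y']
    show "compat U W n (rst_open (lvl B n) U W (points U) y) (rst_open X U W V s)"
      using compat_restrict[OF U *(1-3) v *(4,5)]
      unfolding rst_open_rst_open[OF preB U *(2,1) points_open *(3) sub[OF *(1)] y'] .
  next
    fix V s t assume *: "V \<in> opens U" "s \<in> val X (open_sub U V)" "t \<in> val X (open_sub U V)"
      "compat U V n (rst_open (lvl B n) U V (points U) y) s" "compat U V n (rst_open (lvl B n) U V (points U) y) t"
    note v = rst_open_val[OF preB U *(1) points_open sub[OF *(1)] y']
    show "s = t" by (rule compat_unique[OF U *(1) v *(2-5)])
  qed
  then obtain z where z: "z \<in> val X U" and loc: "\<forall>u\<in>points U. \<exists>V\<in>opens U. u \<in> V \<and>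
      compat U V n (rst_open (lvl B n) U V (points U) y) (rst_open X U V (points U) z)" by blast
  have "compat U (points U) n y z"
  proof (rule compat_local[OF U points_open y'])
    show "z \<in> val X (open_sub U (points U))" using z by simp
    show "\<exists>W\<in>opens U. u \<in> W \<and> W \<subseteq> points U \<and> compat U W n (rst_open (lvl B n) U W (points U) y) (rst_open X U W (points U) z)"
      if u: "u \<in> points U" for u
    proof -
      obtain V where V: "V \<in> opens U" "u \<in> V"
        "compat U V n (rst_open (lvl B n) U V (points U) y) (rst_open X U V (points U) z)"
        using bspec[OF loc u] by (elim bexE conjE)
      then show ?thesis using sub[OF V(1)] by (intro bexI[of _ V] conjI)
    qed
  qed
  then show ?thesis using z by blast
qed

definition lift :: "nat \<Rightarrow> cspace \<Rightarrow> 'u \<Rightarrow> 'u" where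
  "lift n U y = (THE z. z \<in> val X U \<and> compat U (points U) n y z)"

lemma compat_unique':
  assumes U: "complex_space U" and y: "y \<in> val (lvl B n) U" and z: "z \<in> val X U" "z' \<in> val X U"
    and c: "compat U (points U) n y z" "compat U (points U) n y z'"
  shows "z = z'"
  by (rule compat_unique[OF U points_open _ _ _ c]) (use y z in simp_all)

lemma lift_eq:
  assumes U: "complex_space U" and y: "y \<in> val (lvl B n) U" and z: "z \<in> val X U" "compat U (points U) n y z"
  shows "lift n U y = z"
  unfolding lift_def by (rule the_equality) (use compat_unique'[OF U y] z in blast)+

lemma lift:
  assumes U: "complex_space U" and y: "y \<in> val (lvl B n) U"
  shows lift_val: "lift n U y \<in> val X U" and lift_compat: "compat U (points U) n y (lift n U y)"
proof -
  obtain z where z: "z \<in> val X U" "compat U (points U) n y z" using compat_exists[OF U y] by blast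
  show "lift n U y \<in> val X U" "compat U (points U) n y (lift n U y)" unfolding lift_eq[OF U y z] using z by auto
qed

lemma lift_f:
  assumes U: "complex_space U" and a: "a \<in> val (lvl A n) U"
  shows "lift n U (cmp f n U a) = cmp \<phi> n U a"
proof (rule lift_eq[OF U map_val[OF f U a]])
  show "cmp \<phi> n U a \<in> val X U" using map_val[OF \<phi> U, of a n] a \<phi>_dom \<phi>_cod by simp
  show "compat U (points U) n (cmp f n U a) (cmp \<phi> n U a)"
    using compat_f[OF U points_open, of a n] a by simp
qed

text \<open>A section and its image under an operator lie in the same components and hence share one
  lift, as required of a simplicial map to a constant target.\<close>

lemma lift_sop:
  assumes U: "complex_space U" and \<theta>: "\<theta> \<in> Delta m n" and y: "y \<in> val (lvl B n) U"
  shows "lift m U (sop B m n \<theta> U y) = lift n U y"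
proof (rule lift_eq[OF U sop_val[OF B \<theta> U y] lift_val[OF U y]])
  show "compat U (points U) m (sop B m n \<theta> U y) (lift n U y)"
    using compat_sop_iff[OF U \<theta> points_open, of y] y lift_compat[OF U y] by simp
qed

text \<open>By \<open>compatI1\<close> one witness at each \<open>u'\<close> is enough: the pullback
  to the stalk at \<open>u'\<close> of a witness at its image point. Pullback preserves components
  and commutes with the maps on stalks.\<close>

lemma lift_rst:
  assumes U: "complex_space U" "complex_space U'" and g: "g \<in> rhom U' U" and y: "y \<in> val (lvl B n) U"
  shows "lift n U' (rst (lvl B n) U' U g y) = rst X U' U g (lift n U y)"
proof (rule lift_eq[OF U(2) presheaf_val[OF preB U(2,1) g y] presheaf_val[OF preX U(2,1) g lift_val[OF U(1) y]]],
    rule compatI1[OF U(2) points_open])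
  fix u' assume u': "u' \<in> points U'"
  let ?u = "fst g u'" and ?z = "lift n U y"
  have u: "?u \<in> points U" using rhom_continuous[OF g] u' by (auto simp: continuous_map_def)
  have pre: "preim U' (fst g) (points U) = points U'"
    using rhom_continuous[OF g] by (auto simp: preim_def continuous_map_def)
  have y': "y \<in> val (lvl B n) (open_sub U (points U))" using y by simp
  have z': "?z \<in> val (lvl (const_ssheaf X) n) (open_sub U (points U))" using lift_val[OF U(1) y] by simp
  obtain m x where x: "x \<in> simp (stalk A U ?u) m"
      "((n, germ (lvl B n) U ?u (points U) y), (m, stalk_map f U ?u m x)) \<in> slinked (stalk B U ?u)"
      "germ X U ?u (points U) ?z = stalk_map \<phi> U ?u m x"
    using compat_ex[OF U(1) points_open y' lift_compat[OF U(1) y] u] by blast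
  let ?x = "stalk_pull A U' U g u' m x"
  have "((n, stalk_pull B U' U g u' n (germ (lvl B n) U ?u (points U) y)),
      (m, stalk_pull B U' U g u' m (stalk_map f U ?u m x))) \<in> slinked (stalk B U' u')"
    by (rule slinked_map[OF x(2)]) (simp_all add: stalk_pull_act[OF B U(2,1) g u'] stalk_pull_simp[OF B U(2,1) g u'])
  then have l: "((n, germ (lvl B n) U' u' (points U') (rst (lvl B n) U' U g y)), (m, stalk_map f U' u' m ?x)) \<in> slinked (stalk B U' u')"
    unfolding stalk_map_pull[OF f U(2,1) g u' x(1)] stalk_pull_germ[OF B U(2,1) g u' points_open u y'] pre pull_points[OF U(2,1) g] .
  have x\<phi>: "x \<in> simp (stalk (fst \<phi>) U ?u) m" using x(1) \<phi>_dom by simp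
  have "germ X U' u' (points U') (rst X U' U g ?z) = stalk_pull (const_ssheaf X) U' U g u' m (germ X U ?u (points U) ?z)"
    using stalk_pull_germ[OF cX U(2,1) g u' points_open u, of ?z m] z'
    unfolding pre const_ssheaf_simps pull_points[OF U(2,1) g] by simp
  also have "\<dots> = stalk_map \<phi> U' u' m ?x"
    unfolding x(3) using stalk_map_pull[OF \<phi> U(2,1) g u' x\<phi>] unfolding \<phi>_cod \<phi>_dom by simp
  finally show "\<exists>m x. x \<in> simp (stalk A U' u') m \<and>
      ((n, germ (lvl B n) U' u' (points U') (rst (lvl B n) U' U g y)), (m, stalk_map f U' u' m x)) \<in> slinked (stalk B U' u') \<and>
      germ X U' u' (points U') (rst X U' U g ?z) = stalk_map \<phi> U' u' m x"
    using l stalk_pull_simp[OF A U(2,1) g u' x(1)] by blast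
qed

text \<open>Any extension \<open>\<psi>\<close> is constant on the components of the stalks of
  \<open>B\<close>, so its germ at \<open>y\<close> can be computed at a witness in the image of
  \<open>f\<close>, where it equals \<open>\<phi>\<close>.\<close>

lemma lift_unique:
  assumes \<psi>: "simplicial_map \<psi>" "fst \<psi> = B" "fst (snd \<psi>) = const_ssheaf X"
    and \<psi>f: "\<And>n U a. complex_space U \<Longrightarrow> a \<in> val (lvl A n) U \<Longrightarrow> cmp \<psi> n U (cmp f n U a) = cmp \<phi> n U a"
    and U: "complex_space U" and y: "y \<in> val (lvl B n) U"
  shows "cmp \<psi> n U y = lift n U y"
proof (rule lift_eq[symmetric, OF U y])
  have yc: "y \<in> val (lvl (fst \<psi>) n) U" using y \<psi>(2) by simp
  show "cmp \<psi> n U y \<in> val X U" using map_val[OF \<psi>(1) U yc] \<psi>(3) by simp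
  show "compat U (points U) n y (cmp \<psi> n U y)"
    unfolding compat_def
  proof (intro ballI allI impI)
    fix u m x assume u: "u \<in> points U" and x: "x \<in> simp (stalk A U u) m"
      and l: "((n, germ (lvl B n) U u (points U) y), (m, stalk_map f U u m x)) \<in> slinked (stalk B U u)"
    obtain V a where V: "V \<in> opens U" "u \<in> V" "a \<in> val (lvl A m) (open_sub U V)" and xa: "x = germ (lvl A m) U u V a"
      using x unfolding stalk_simp_iff by blast
    note O = complex_space_open_sub[OF U V(1)]
    have yc': "y \<in> val (lvl (fst \<psi>) n) (open_sub U (points U))" using yc by simp
    have fc: "cmp f m (open_sub U V) a \<in> val (lvl (fst \<psi>) m) (open_sub U V)" using map_val[OF f O V(3)] \<psi>(2) by simp
    have ac: "a \<in> val (lvl (fst \<phi>) m) (open_sub U V)" using V(3) \<phi>_dom by simp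
    have "germ X U u (points U) (cmp \<psi> n U y) = stalk_map \<psi> U u n (germ (lvl B n) U u (points U) y)"
      using stalk_map_germ[OF \<psi>(1) U points_open u yc'] unfolding \<psi>(2,3) by simp
    also have "\<dots> = stalk_map \<psi> U u m (stalk_map f U u m x)"
      using stalk_map_slinked[OF \<psi>(1,3) U, of n _ m _ u] l unfolding \<psi>(2) by metis
    also have "\<dots> = stalk_map \<phi> U u m x"
      using stalk_map_germ[OF \<psi>(1) U V(1,2) fc] stalk_map_germ[OF \<phi> U V(1,2) ac]
      unfolding xa stalk_map_germ[OF f U V] \<psi>f[OF O V(3)] \<psi>(2,3) \<phi>_dom \<phi>_cod by simp
    finally show "germ X U u (points U) (cmp \<psi> n U y) = stalk_map \<phi> U u m x" .
  qed
qed

end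

section \<open>The category of simplicial sheaves\<close>

lemma sSh_simps [simp]:
  "F \<in> Obj sSh \<longleftrightarrow> simplicial_sheaf F" "f \<in> Arr sSh \<longleftrightarrow> simplicial_map f"
  "Dom sSh f = fst f" "Cod sSh f = fst (snd f)"
  by (simp_all add: sSh_def)

lemma sSh_Ide: "Ide sSh F = (F, F, extend F (\<lambda>n U a. a))"
  and sSh_Comp: "Comp sSh g f = (fst f, fst (snd g), extend (fst f) (\<lambda>n U a. cmp g n U (cmp f n U a)))"
  by (simp_all add: sSh_def)

lemma extend_apply [simp]: "complex_space U \<Longrightarrow> a \<in> val (lvl F n) U \<Longrightarrow> extend F \<eta> n U a = \<eta> n U a"
  by (simp add: extend_def)

lemma extend_extend: "extend F (extend F \<eta>) = extend F \<eta>"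
  unfolding extend_def by (auto intro!: ext simp: restrict_def)

lemma extend_eqI:
  assumes "\<And>n U a. complex_space U \<Longrightarrow> a \<in> val (lvl F n) U \<Longrightarrow> \<eta> n U a = \<eta>' n U a"
  shows "extend F \<eta> = extend F \<eta>'"
  unfolding extend_def by (intro ext) (auto simp: restrict_def assms)

text \<open>\<open>extend\<close> pins down the values away from sections over complex spaces, so
  agreement on those sections is equality of arrows.\<close>

lemma simplicial_map_eqI:
  assumes "simplicial_map f" "simplicial_map g" "fst f = fst g" "fst (snd f) = fst (snd g)"
    and "\<And>n U a. complex_space U \<Longrightarrow> a \<in> val (lvl (fst f) n) U \<Longrightarrow> cmp f n U a = cmp g n U a"
  shows "f = g"
  using extend_eqI[of "fst f" "cmp f" "cmp g"] map_extend[OF assms(1)] map_extend[OF assms(2)] assms(3-5)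
  by (simp add: prod_eq_iff)

lemma simplicial_mapI:
  assumes F: "simplicial_sheaf F" and G: "simplicial_sheaf G"
    and val: "\<And>n U a. complex_space U \<Longrightarrow> a \<in> val (lvl F n) U \<Longrightarrow> \<eta> n U a \<in> val (lvl G n) U"
    and rst: "\<And>n U V f a. complex_space U \<Longrightarrow> complex_space V \<Longrightarrow> f \<in> rhom U V \<Longrightarrow> a \<in> val (lvl F n) V \<Longrightarrow>
      \<eta> n U (rst (lvl F n) U V f a) = rst (lvl G n) U V f (\<eta> n V a)"
    and sop: "\<And>m n \<theta> U a. \<theta> \<in> Delta m n \<Longrightarrow> complex_space U \<Longrightarrow> a \<in> val (lvl F n) U \<Longrightarrow>
      \<eta> m U (sop F m n \<theta> U a) = sop G m n \<theta> U (\<eta> n U a)"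
  shows "simplicial_map (F, G, extend F \<eta>)"
  unfolding simplicial_map_def split
proof (intro conjI allI impI ballI, goal_cases)
  case (4 n U)
  then show ?case using val by (intro Pi_I) simp
next
  case (5 n U V f a)
  then show ?case
    using rst presheaf_val[OF simplicial_sheaf_presheaf[OF F], of U V f a n] by simp
next
  case (6 m n \<theta> U a)
  then show ?case using sop sop_val[OF F, of \<theta> m n U a] by simp
qed (simp_all add: F G extend_extend)

lemma simplicial_map_Comp:
  assumes f: "simplicial_map f" and g: "simplicial_map g" and "fst g = fst (snd f)"
  shows "simplicial_map (Comp sSh g f)"
  unfolding sSh_Comp
proof (rule simplicial_mapI[OF map_dom[OF f] map_cod[OF g]])
  note [simp] = assms(3)[symmetric]
  have fv: "cmp f n U a \<in> val (lvl (fst g) n) U" if "complex_space U" "a \<in> val (lvl (fst f) n) U" for n U a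
    using map_val[OF f that] by simp
  show "cmp g n U (cmp f n U a) \<in> val (lvl (fst (snd g)) n) U"
    if "complex_space U" "a \<in> val (lvl (fst f) n) U" for n U a
    by (rule map_val[OF g that(1) fv[OF that]])
  show "cmp g n U (cmp f n U (rst (lvl (fst f) n) U V h a)) = rst (lvl (fst (snd g)) n) U V h (cmp g n V (cmp f n V a))"
    if "complex_space U" "complex_space V" "h \<in> rhom U V" "a \<in> val (lvl (fst f) n) V" for n U V h a
    using map_rst[OF f that] map_rst[OF g that(1-3) fv[OF that(2,4)]] by simp
  show "cmp g m U (cmp f m U (sop (fst f) m n \<theta> U a)) = sop (fst (snd g)) m n \<theta> U (cmp g n U (cmp f n U a))"
    if "\<theta> \<in> Delta m n" "complex_space U" "a \<in> val (lvl (fst f) n) U" for m n \<theta> U a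
    using map_sop[OF f that] map_sop[OF g that(1,2) fv[OF that(2,3)]] by simp
qed

lemma simplicial_map_Ide: "simplicial_sheaf F \<Longrightarrow> simplicial_map (Ide sSh F)"
  unfolding sSh_Ide by (rule simplicial_mapI) auto

lemma cmp_Comp [simp]:
  "complex_space U \<Longrightarrow> a \<in> val (lvl (fst f) n) U \<Longrightarrow> cmp (Comp sSh g f) n U a = cmp g n U (cmp f n U a)"
  by (simp add: sSh_Comp)

lemma fst_Comp [simp]: "fst (Comp sSh g f) = fst f" "fst (snd (Comp sSh g f)) = fst (snd g)"
  by (simp_all add: sSh_Comp)

lemma cmp_Ide [simp]: "complex_space U \<Longrightarrow> a \<in> val (lvl F n) U \<Longrightarrow> cmp (Ide sSh F) n U a = a"
  by (simp add: sSh_Ide)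

lemma fst_Ide [simp]: "fst (Ide sSh F) = F" "fst (snd (Ide sSh F)) = F"
  by (simp_all add: sSh_Ide)

lemma Comp_Ide_sSh: "simplicial_map f \<Longrightarrow> Comp sSh f (Ide sSh (fst f)) = f"
  by (rule simplicial_map_eqI) (auto intro!: simplicial_map_Comp simplicial_map_Ide dest: map_dom)

lemma Ide_Comp_sSh:
  assumes "simplicial_map f"
  shows "Comp sSh (Ide sSh (fst (snd f))) f = f"
  by (rule simplicial_map_eqI)
    (use assms map_val[OF assms] in \<open>auto intro!: simplicial_map_Comp simplicial_map_Ide dest: map_cod\<close>)

lemma Comp_assoc_sSh:
  assumes "simplicial_map f" "simplicial_map g" "simplicial_map h" "fst g = fst (snd f)" "fst h = fst (snd g)"
  shows "Comp sSh h (Comp sSh g f) = Comp sSh (Comp sSh h g) f"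
  by (rule simplicial_map_eqI)
    (use assms map_val[OF assms(1)] in \<open>auto intro!: simplicial_map_Comp\<close>)

lemma localization_sSh: "W \<subseteq> Arr sSh \<Longrightarrow> localization sSh W"
  by unfold_locales
    (auto simp: map_dom map_cod simplicial_map_Ide simplicial_map_Comp Comp_Ide_sSh Ide_Comp_sSh Comp_assoc_sSh)

lemma simplicial_weq_Arr: "simplicial_weq \<subseteq> Arr sSh"
  by (auto simp: simplicial_weq_def)

lemma simplicial_weq_orthogonal:
  assumes X: "simplicial_sheaf (const_ssheaf X)" and f: "f \<in> simplicial_weq"
  shows "orthogonal_to sSh f (const_ssheaf X)"
  unfolding orthogonal_to_def
proof (intro ballI impI, elim conjE)
  fix \<phi> assume \<phi>: "\<phi> \<in> Arr sSh" "Dom sSh \<phi> = Dom sSh f" "Cod sSh \<phi> = const_ssheaf X"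
  have mf: "simplicial_map f" using f simplicial_weq_Arr by auto
  interpret weq_lifting f \<phi> X
    by unfold_locales (use \<phi> f in simp_all)
  let ?B = "fst (snd f)"
  define \<psi> where "\<psi> = (?B, const_ssheaf X, extend ?B lift)"
  have \<psi>: "simplicial_map \<psi>"
    unfolding \<psi>_def by (rule simplicial_mapI[OF B cX]) (simp_all add: lift_val lift_rst lift_sop)
  have cmp_psi: "cmp \<psi> n U y = lift n U y" if "complex_space U" "y \<in> val (lvl ?B n) U" for n U y
    using that by (simp add: \<psi>_def)
  have comp: "Comp sSh \<psi> f = \<phi>"
    by (rule simplicial_map_eqI)
      (use \<phi>(1) \<psi> mf in \<open>auto intro!: simplicial_map_Comp simp: cmp_psi map_val[OF mf] lift_f \<phi>_dom \<phi>_cod,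
        simp_all add: \<psi>_def\<close>)
  show "\<exists>!\<psi>. \<psi> \<in> Arr sSh \<and> Dom sSh \<psi> = Cod sSh f \<and> Cod sSh \<psi> = const_ssheaf X \<and> Comp sSh \<psi> f = \<phi>"
  proof (rule ex1I[of _ \<psi>])
    show "\<psi> \<in> Arr sSh \<and> Dom sSh \<psi> = Cod sSh f \<and> Cod sSh \<psi> = const_ssheaf X \<and> Comp sSh \<psi> f = \<phi>"
      using \<psi> comp by (simp add: \<psi>_def)
    fix \<rho> assume \<rho>: "\<rho> \<in> Arr sSh \<and> Dom sSh \<rho> = Cod sSh f \<and> Cod sSh \<rho> = const_ssheaf X \<and> Comp sSh \<rho> f = \<phi>"
    show "\<rho> = \<psi>"
    proof (rule simplicial_map_eqI)
      fix n U a assume U: "complex_space U" and a: "a \<in> val (lvl (fst \<rho>) n) U"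
      have "cmp \<rho> n U (cmp f n U a) = cmp \<phi> n U a" if "complex_space U" "a \<in> val (lvl (fst f) n) U" for n U a
        using \<rho> that by (auto simp del: cmp_Comp simp: cmp_Comp[symmetric])
      then have "cmp \<rho> n U a = lift n U a" using \<rho> a U by (intro lift_unique) auto
      then show "cmp \<rho> n U a = cmp \<psi> n U a" using cmp_psi[OF U, of a n] a \<rho> by simp
    qed (use \<rho> \<psi> in \<open>simp_all add: \<psi>_def\<close>)
  qed
qed

text \<open>Serves twice: for the projections in the definition of hyperbolicity, and for the arrows
  of \<open>C_weq\<close>.\<close>

lemma orthogonal_if_bij_Hs_precomp:
  assumes X: "simplicial_sheaf (const_ssheaf X)" and f: "simplicial_map f"
    and bij: "bij_betw (Hs_precomp f (const_ssheaf X)) (Hs_hom (fst (snd f)) (const_ssheaf X)) (Hs_hom (fst f) (const_ssheaf X))"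
  shows "orthogonal_to sSh f (const_ssheaf X)"
  by (rule localization.orthogonal_if_bij_precomp[OF localization_sSh[OF simplicial_weq_Arr] simplicial_weq_orthogonal[OF X]])
    (use f bij in simp_all)

lemma C_weq_orthogonal:
  assumes X: "hyperbolic (const_ssheaf X)" and f: "f \<in> C_weq"
  shows "orthogonal_to sSh f (const_ssheaf X)"
  by (rule orthogonal_if_bij_Hs_precomp)
    (use X f in \<open>auto simp: hyperbolic_def C_weq_def\<close>)

section \<open>Products\<close>

lemma val_sprod: "val (lvl (sprod F G) n) U = {upair a b | a b. a \<in> val (lvl F n) U \<and> b \<in> val (lvl G n) U}"
  by (simp add: sprod_def)

lemma upair_in_sprod [simp]:
  "upair a b \<in> val (lvl (sprod F G) n) U \<longleftrightarrow> a \<in> val (lvl F n) U \<and> b \<in> val (lvl G n) U"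
  by (auto simp: val_sprod upair_inject)

lemma rst_sprod [simp]:
  "rst (lvl (sprod F G) n) U V f (upair a b) = upair (rst (lvl F n) U V f a) (rst (lvl G n) U V f b)"
  by (simp add: sprod_def)

lemma sop_sprod [simp]:
  "sop (sprod F G) m n \<theta> U (upair a b) = upair (sop F m n \<theta> U a) (sop G m n \<theta> U b)"
  by (simp add: sprod_def)

lemma sprodE:
  assumes "z \<in> val (lvl (sprod F G) n) U"
  obtains a b where "z = upair a b" "a \<in> val (lvl F n) U" "b \<in> val (lvl G n) U"
  using assms by (auto simp: val_sprod)

lemma sop_id: "simplicial_sheaf F \<Longrightarrow> complex_space U \<Longrightarrow> a \<in> val (lvl F n) U \<Longrightarrow> sop F n n (\<lambda>i\<in>{..n}. i) U a = a"
  unfolding simplicial_sheaf_def by (elim conjE) blast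

lemma sop_sop:
  assumes "simplicial_sheaf F" "\<psi> \<in> Delta l m" "\<theta> \<in> Delta m n" "complex_space U" "a \<in> val (lvl F n) U"
  shows "sop F l n (\<lambda>i\<in>{..l}. \<theta> (\<psi> i)) U a = sop F l m \<psi> U (sop F m n \<theta> U a)"
proof -
  have "\<forall>l m n \<theta> \<psi> U. \<psi> \<in> Delta l m \<and> \<theta> \<in> Delta m n \<and> complex_space U \<longrightarrow>
      (\<forall>a\<in>val (lvl F n) U. sop F l n (\<lambda>i\<in>{..l}. \<theta> (\<psi> i)) U a = sop F l m \<psi> U (sop F m n \<theta> U a))"
    using assms(1) unfolding simplicial_sheaf_def by (elim conjE)
  from this[rule_format, of \<psi> l m \<theta> n U a] assms(2-5) show ?thesis by simp
qed

lemma simplicial_sheafI: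
  assumes "\<And>n. sheaf (lvl F n)"
    and "\<And>m n \<theta> U a. \<theta> \<in> Delta m n \<Longrightarrow> complex_space U \<Longrightarrow> a \<in> val (lvl F n) U \<Longrightarrow> sop F m n \<theta> U a \<in> val (lvl F m) U"
    and "\<And>m n \<theta> U V f a. \<theta> \<in> Delta m n \<Longrightarrow> complex_space U \<Longrightarrow> complex_space V \<Longrightarrow> f \<in> rhom U V \<Longrightarrow>
      a \<in> val (lvl F n) V \<Longrightarrow> sop F m n \<theta> U (rst (lvl F n) U V f a) = rst (lvl F m) U V f (sop F m n \<theta> V a)"
    and "\<And>n U a. complex_space U \<Longrightarrow> a \<in> val (lvl F n) U \<Longrightarrow> sop F n n (\<lambda>i\<in>{..n}. i) U a = a"
    and "\<And>l m n \<theta> \<psi> U a. \<psi> \<in> Delta l m \<Longrightarrow> \<theta> \<in> Delta m n \<Longrightarrow> complex_space U \<Longrightarrow> a \<in> val (lvl F n) U \<Longrightarrow>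
      sop F l n (\<lambda>i\<in>{..l}. \<theta> (\<psi> i)) U a = sop F l m \<psi> U (sop F m n \<theta> U a)"
  shows "simplicial_sheaf F"
  unfolding simplicial_sheaf_def by (intro conjI allI impI ballI Pi_I; (elim conjE)?; rule assms)

lemma is_presheafI:
  assumes "\<And>U V f a. complex_space U \<Longrightarrow> complex_space V \<Longrightarrow> f \<in> rhom U V \<Longrightarrow> a \<in> val F V \<Longrightarrow> rst F U V f a \<in> val F U"
    and "\<And>U a. complex_space U \<Longrightarrow> a \<in> val F U \<Longrightarrow> rst F U U (rid U) a = a"
    and "\<And>U V W f g a. complex_space U \<Longrightarrow> complex_space V \<Longrightarrow> complex_space W \<Longrightarrow> f \<in> rhom U V \<Longrightarrow> g \<in> rhom V W \<Longrightarrow>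
      a \<in> val F W \<Longrightarrow> rst F U W (rcomp U V W g f) a = rst F U V f (rst F V W g a)"
  shows "is_presheaf F"
  unfolding is_presheaf_def by (intro conjI allI impI ballI Pi_I; (elim conjE)?; rule assms)

lemma sheafI:
  assumes "is_presheaf F"
    and "\<And>U \<V> s. complex_space U \<Longrightarrow> \<V> \<subseteq> opens U \<Longrightarrow> \<Union>\<V> = points U \<Longrightarrow>
      \<forall>V\<in>\<V>. s V \<in> val F (open_sub U V) \<Longrightarrow>
      \<forall>V\<in>\<V>. \<forall>W\<in>\<V>. rst_open F U (V \<inter> W) V (s V) = rst_open F U (V \<inter> W) W (s W) \<Longrightarrow>
      \<exists>!a. a \<in> val F U \<and> (\<forall>V\<in>\<V>. rst_open F U V (points U) a = s V)"
  shows "sheaf F"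
  unfolding sheaf_def by (intro conjI allI impI assms(1); elim conjE; rule assms(2))

lemma sheaf_sprod:
  assumes F: "sheaf (lvl F n)" and G: "sheaf (lvl G n)"
  shows "sheaf (lvl (sprod F G) n)"
proof (rule sheafI)
  note P = sheaf_presheaf[OF F] sheaf_presheaf[OF G]
  show "is_presheaf (lvl (sprod F G) n)"
    by (rule is_presheafI; erule sprodE)
      (simp_all add: presheaf_val[OF P(1)] presheaf_val[OF P(2)] presheaf_id[OF P(1)] presheaf_id[OF P(2)]
        presheaf_comp[OF P(1)] presheaf_comp[OF P(2)])
  fix U \<V> s assume U: "complex_space U" and \<V>: "\<V> \<subseteq> opens U" "\<Union>\<V> = points U"
    and s: "\<forall>V\<in>\<V>. s V \<in> val (lvl (sprod F G) n) (open_sub U V)"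
    and c: "\<forall>V\<in>\<V>. \<forall>W\<in>\<V>. rst_open (lvl (sprod F G) n) U (V \<inter> W) V (s V) = rst_open (lvl (sprod F G) n) U (V \<inter> W) W (s W)"
  have sV: "s V = upair (ufst (s V)) (usnd (s V)) \<and> ufst (s V) \<in> val (lvl F n) (open_sub U V) \<and>
      usnd (s V) \<in> val (lvl G n) (open_sub U V)" if "V \<in> \<V>" for V
    using bspec[OF s that] by (elim sprodE) simp
  have cV: "rst_open (lvl F n) U (V \<inter> W) V (ufst (s V)) = rst_open (lvl F n) U (V \<inter> W) W (ufst (s W)) \<and>
      rst_open (lvl G n) U (V \<inter> W) V (usnd (s V)) = rst_open (lvl G n) U (V \<inter> W) W (usnd (s W))"
    if V: "V \<in> \<V>" and W: "W \<in> \<V>" for V W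
  proof -
    have "rst_open (lvl (sprod F G) n) U (V \<inter> W) V (upair (ufst (s V)) (usnd (s V))) =
        rst_open (lvl (sprod F G) n) U (V \<inter> W) W (upair (ufst (s W)) (usnd (s W)))"
      using c V W sV[OF V] sV[OF W] by auto
    then show ?thesis by (simp add: upair_inject)
  qed
  have 1: "\<exists>!a. a \<in> val (lvl F n) U \<and> (\<forall>V\<in>\<V>. rst_open (lvl F n) U V (points U) a = ufst (s V))"
    by (rule sheaf_glueD[OF F U \<V>]) (use sV cV in blast)+
  have 2: "\<exists>!b. b \<in> val (lvl G n) U \<and> (\<forall>V\<in>\<V>. rst_open (lvl G n) U V (points U) b = usnd (s V))"
    by (rule sheaf_glueD[OF G U \<V>]) (use sV cV in blast)+
  obtain a b where a: "a \<in> val (lvl F n) U" "\<forall>V\<in>\<V>. rst_open (lvl F n) U V (points U) a = ufst (s V)"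
    and b: "b \<in> val (lvl G n) U" "\<forall>V\<in>\<V>. rst_open (lvl G n) U V (points U) b = usnd (s V)"
    using ex1_implies_ex[OF 1] ex1_implies_ex[OF 2] by blast
  show "\<exists>!z. z \<in> val (lvl (sprod F G) n) U \<and> (\<forall>V\<in>\<V>. rst_open (lvl (sprod F G) n) U V (points U) z = s V)"
  proof (rule ex1I[of _ "upair a b"])
    have "rst_open (lvl (sprod F G) n) U V (points U) (upair a b) = s V" if "V \<in> \<V>" for V
      using bspec[OF a(2) that] bspec[OF b(2) that] sV[OF that] by simp
    then show "upair a b \<in> val (lvl (sprod F G) n) U \<and> (\<forall>V\<in>\<V>. rst_open (lvl (sprod F G) n) U V (points U) (upair a b) = s V)"
      using a b by simp
    fix z assume z: "z \<in> val (lvl (sprod F G) n) U \<and> (\<forall>V\<in>\<V>. rst_open (lvl (sprod F G) n) U V (points U) z = s V)"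
    then obtain a' b' where z': "z = upair a' b'" "a' \<in> val (lvl F n) U" "b' \<in> val (lvl G n) U"
      using sprodE by blast
    have e: "rst_open (lvl F n) U V (points U) a' = ufst (s V) \<and> rst_open (lvl G n) U V (points U) b' = usnd (s V)" if "V \<in> \<V>" for V
    proof -
      have "s V = upair (rst_open (lvl F n) U V (points U) a') (rst_open (lvl G n) U V (points U) b')"
        using z that unfolding z'(1) by simp
      then show ?thesis by simp
    qed
    have "a' = a" using the1_equality[OF 1, of a] the1_equality[OF 1, of a'] a z'(2) e by simp
    moreover have "b' = b" using the1_equality[OF 2, of b] the1_equality[OF 2, of b'] b z'(3) e by simp
    ultimately show "z = upair a b" using z' by simp
  qed
qed

lemma simplicial_sheaf_sprod:
  assumes F: "simplicial_sheaf F" and G: "simplicial_sheaf G"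
  shows "simplicial_sheaf (sprod F G)"
  by (rule simplicial_sheafI, rule sheaf_sprod[OF simplicial_sheaf_level[OF F] simplicial_sheaf_level[OF G]]; erule sprodE)
    (simp_all add: sop_val[OF F] sop_val[OF G] sop_rst[OF F] sop_rst[OF G] sop_id[OF F] sop_id[OF G] sop_sop[OF F] sop_sop[OF G])

lemma simplicial_map_proj1:
  "simplicial_sheaf F \<Longrightarrow> simplicial_sheaf G \<Longrightarrow> simplicial_map (proj1 F G)"
  unfolding proj1_def by (rule simplicial_mapI; (erule sprodE)?) (simp_all add: simplicial_sheaf_sprod)

lemma simplicial_map_proj2:
  "simplicial_sheaf F \<Longrightarrow> simplicial_sheaf G \<Longrightarrow> simplicial_map (proj2 F G)"
  unfolding proj2_def by (rule simplicial_mapI; (erule sprodE)?) (simp_all add: simplicial_sheaf_sprod)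

section \<open>Pointed simplicial sheaves\<close>

lemma sSh_pointed_simps [simp]:
  "a \<in> Obj sSh_pointed \<longleftrightarrow> pointed a"
  "Dom sSh_pointed u = fst u" "Cod sSh_pointed u = fst (snd u)"
  "Ide sSh_pointed a = (a, a, Ide sSh (fst (snd a)))"
  "Comp sSh_pointed v u = (fst u, fst (snd v), Comp sSh (snd (snd v)) (snd (snd u)))"
  by (simp_all add: sSh_pointed_def)

lemma Arr_pointed_iff:
  "u \<in> Arr sSh_pointed \<longleftrightarrow> pointed (fst u) \<and> pointed (fst (snd u)) \<and> simplicial_map (snd (snd u)) \<and>
     fst (snd (snd u)) = fst (snd (fst u)) \<and> fst (snd (snd (snd u))) = fst (snd (fst (snd u))) \<and>
     Comp sSh (snd (snd u)) (fst u) = fst (snd u)"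
  by (auto simp: sSh_pointed_def)

lemma pointed_iff: "pointed a \<longleftrightarrow> simplicial_map a \<and> fst a = pt"
  by (simp add: pointed_def)

lemma localization_sSh_pointed: "W \<subseteq> Arr sSh_pointed \<Longrightarrow> localization sSh_pointed W"
proof (unfold_locales, goal_cases)
  case (3 a)
  then show ?case
    by (auto simp: Arr_pointed_iff pointed_iff simplicial_map_Ide map_cod Ide_Comp_sSh)
next
  case (6 f g)
  then show ?case
    using Comp_assoc_sSh[of "fst f" "snd (snd f)" "snd (snd g)"]
    by (auto simp: Arr_pointed_iff pointed_iff simplicial_map_Comp)
next
  case (9 f)
  then show ?case using Comp_Ide_sSh[of "snd (snd f)"] by (simp add: Arr_pointed_iff prod_eq_iff)
next
  case (10 f)
  then show ?case using Ide_Comp_sSh[of "snd (snd f)"] by (simp add: Arr_pointed_iff prod_eq_iff)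
next
  case (11 f g h)
  then show ?case using Comp_assoc_sSh[of "snd (snd f)" "snd (snd g)" "snd (snd h)"] by (simp add: Arr_pointed_iff)
qed (auto simp: Arr_pointed_iff)

lemma val_pt [simp]: "val (lvl pt n) U = {undefined}"
  by (simp add: pt_def final_sheaf_def)

lemma rst_pt [simp]: "rst (lvl pt n) U V f a = a"
  by (simp add: pt_def final_sheaf_def)

lemma sop_pt [simp]: "sop pt m n \<theta> U a = a"
  by (simp add: pt_def)

lemma to_pt_simps [simp]: "fst (to_pt F) = F" "fst (snd (to_pt F)) = pt"
  "complex_space U \<Longrightarrow> a \<in> val (lvl F n) U \<Longrightarrow> cmp (to_pt F) n U a = undefined"
  by (simp_all add: to_pt_def)

lemma simplicial_map_to_pt:
  "simplicial_sheaf F \<Longrightarrow> simplicial_sheaf (pt :: 'u ssheaf) \<Longrightarrow> simplicial_map (to_pt (F :: 'u ssheaf))"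
  unfolding to_pt_def by (rule simplicial_mapI) auto

section \<open>Insensitive simplicial sheaves\<close>

text \<open>The trace that hyperbolicity leaves on maps of sheaves, phrased on sections. The
  arbitrary \<open>Y\<close> is essential for smash products, where one factor is shifted into it;
  with \<open>Y\<close> the point it says that maps from \<open>Q\<close> to \<open>X\<close> are
  constant on each set of sections.\<close>

definition insensitive :: "'u::universe presheaf \<Rightarrow> 'u ssheaf \<Rightarrow> bool" where
  "insensitive X Q \<longleftrightarrow> simplicial_sheaf Q \<and>
     (\<forall>Y \<phi> n U a q q'. simplicial_sheaf Y \<and> simplicial_map \<phi> \<and> fst \<phi> = sprod Y Q \<and> fst (snd \<phi>) = const_ssheaf X \<and>
        complex_space U \<and> a \<in> val (lvl Y n) U \<and> q \<in> val (lvl Q n) U \<and> q' \<in> val (lvl Q n) U \<longrightarrow>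
        cmp \<phi> n U (upair a q) = cmp \<phi> n U (upair a q'))"

lemma insensitiveD:
  "insensitive X Q \<Longrightarrow> simplicial_sheaf Y \<Longrightarrow> simplicial_map \<phi> \<Longrightarrow> fst \<phi> = sprod Y Q \<Longrightarrow>
    fst (snd \<phi>) = const_ssheaf X \<Longrightarrow> complex_space U \<Longrightarrow> a \<in> val (lvl Y n) U \<Longrightarrow> q \<in> val (lvl Q n) U \<Longrightarrow>
    q' \<in> val (lvl Q n) U \<Longrightarrow> cmp \<phi> n U (upair a q) = cmp \<phi> n U (upair a q')"
  unfolding insensitive_def by blast

text \<open>By hyperbolicity \<open>\<phi>\<close> extends along the projection to \<open>Y\<close>,
  that is, it factors through it.\<close>

lemma insensitive_plane:
  fixes X :: "'u::universe presheaf"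
  assumes X: "hyperbolic (const_ssheaf X)" and C: "simplicial_sheaf (plane_sheaf UNIV :: 'u ssheaf)"
  shows "insensitive X (plane_sheaf UNIV)"
  unfolding insensitive_def
proof (intro conjI allI impI, rule C, elim conjE)
  fix Y \<phi> n U and a q q' :: 'u
  let ?C = "plane_sheaf UNIV :: 'u ssheaf"
  assume Y: "simplicial_sheaf Y" and \<phi>: "simplicial_map \<phi>" "fst \<phi> = sprod Y ?C" "fst (snd \<phi>) = const_ssheaf X"
    and U: "complex_space U" and a: "a \<in> val (lvl Y n) U" and q: "q \<in> val (lvl ?C n) U" "q' \<in> val (lvl ?C n) U"
  have o: "orthogonal_to sSh (proj1 Y ?C) (const_ssheaf X)"
    by (rule orthogonal_if_bij_Hs_precomp[OF _ simplicial_map_proj1[OF Y C]])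
      (use X Y in \<open>simp_all add: hyperbolic_def proj1_def\<close>)
  have "\<exists>!\<psi>. \<psi> \<in> Arr sSh \<and> Dom sSh \<psi> = Cod sSh (proj1 Y ?C) \<and> Cod sSh \<psi> = const_ssheaf X \<and>
      Comp sSh \<psi> (proj1 Y ?C) = \<phi>"
    by (rule o[unfolded orthogonal_to_def, THEN bspec, THEN mp]) (use \<phi> in \<open>simp_all add: proj1_def\<close>)
  then obtain \<psi> where \<psi>: "Comp sSh \<psi> (proj1 Y ?C) = \<phi>" by (elim ex1E conjE)
  have "cmp \<phi> n U (upair a q) = cmp \<psi> n U a" if "q \<in> val (lvl ?C n) U" for q
    unfolding \<psi>[symmetric] using U a that by (simp add: proj1_def)
  then show "cmp \<phi> n U (upair a q) = cmp \<phi> n U (upair a q')" using q by simp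
qed

text \<open>The arrow is \<open>\<phi>\<close> after the product of the identity of \<open>Y\<close>
  with \<open>p\<close>.\<close>

lemma simplicial_map_pair_right:
  assumes Y: "simplicial_sheaf Y" and p: "simplicial_map p" and \<phi>: "simplicial_map \<phi>" "fst \<phi> = sprod Y (fst (snd p))"
  shows "simplicial_map (sprod Y (fst p), fst (snd \<phi>),
    extend (sprod Y (fst p)) (\<lambda>n U z. cmp \<phi> n U (upair (ufst z) (cmp p n U (usnd z)))))"
proof (rule simplicial_mapI[OF simplicial_sheaf_sprod[OF Y map_dom[OF p]] map_cod[OF \<phi>(1)]]; erule sprodE)
  have v: "upair a (cmp p n U b) \<in> val (lvl (fst \<phi>) n) U"
    if "complex_space U" "a \<in> val (lvl Y n) U" "b \<in> val (lvl (fst p) n) U" for n U a b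
    using that map_val[OF p that(1,3)] by (simp add: \<phi>(2))
  show "cmp \<phi> n U (upair (ufst z) (cmp p n U (usnd z))) \<in> val (lvl (fst (snd \<phi>)) n) U"
    if "complex_space U" "z = upair a b" "a \<in> val (lvl Y n) U" "b \<in> val (lvl (fst p) n) U" for n U z a b
    using map_val[OF \<phi>(1) that(1) v[OF that(1,3,4)]] that(2) by simp
  show "cmp \<phi> n U (upair (ufst (rst (lvl (sprod Y (fst p)) n) U V f z)) (cmp p n U (usnd (rst (lvl (sprod Y (fst p)) n) U V f z))))
      = rst (lvl (fst (snd \<phi>)) n) U V f (cmp \<phi> n V (upair (ufst z) (cmp p n V (usnd z))))"
    if "complex_space U" "complex_space V" "f \<in> rhom U V" "z = upair a b" "a \<in> val (lvl Y n) V" "b \<in> val (lvl (fst p) n) V" for n U V f z a b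
    using map_rst[OF \<phi>(1) that(1-3) v[OF that(2,5,6)]] map_rst[OF p that(1-3,6)] that(4) by (simp add: \<phi>(2))
  show "cmp \<phi> m U (upair (ufst (sop (sprod Y (fst p)) m n \<theta> U z)) (cmp p m U (usnd (sop (sprod Y (fst p)) m n \<theta> U z))))
      = sop (fst (snd \<phi>)) m n \<theta> U (cmp \<phi> n U (upair (ufst z) (cmp p n U (usnd z))))"
    if "\<theta> \<in> Delta m n" "complex_space U" "z = upair a b" "a \<in> val (lvl Y n) U" "b \<in> val (lvl (fst p) n) U" for m n \<theta> U z a b
    using map_sop[OF \<phi>(1) that(1,2) v[OF that(2,4,5)]] map_sop[OF p that(1,2,5)] that(3) by (simp add: \<phi>(2))
qed

lemma Delta_comp: "\<psi> \<in> Delta l m \<Longrightarrow> \<theta> \<in> Delta m n \<Longrightarrow> (\<lambda>i\<in>{..l}. \<theta> (\<psi> i)) \<in> Delta l n"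
  unfolding Delta_def by (auto simp: mono_on_def PiE_iff)

lemma Delta_id: "(\<lambda>i\<in>{..n}. i) \<in> Delta n n"
  unfolding Delta_def by (auto simp: mono_on_def)

text \<open>\<open>Q\<close> stands for a quotient with base point \<open>b\<close>, and
  \<open>\<phi>\<close> is a map under test that is to be shown not to see its second
  argument.\<close>

locale collapse =
  fixes X :: "'u::universe presheaf" and Y Q :: "'u ssheaf" and b \<phi> :: "'u sarrow"
  assumes Y: "simplicial_sheaf Y" and Q: "simplicial_sheaf Q" and b: "simplicial_map b" "fst b = pt" "fst (snd b) = Q"
    and \<phi>: "simplicial_map \<phi>" "fst \<phi> = sprod Y Q" "fst (snd \<phi>) = const_ssheaf X"
begin

text \<open>The condition on a section has to be imposed on all its pullbacks and simplicial images, since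
  \<open>a\<close> ranges over sections of \<open>Y\<close> that need not come from the same place.  This makes \<open>E\<close> a
  simplicial subsheaf of \<open>Q\<close>.\<close>

definition E :: "'u ssheaf" where
  "E = \<lparr>lvl = (\<lambda>n. \<lparr>val = (\<lambda>U. {q \<in> val (lvl Q n) U. \<forall>m \<theta> V g a. \<theta> \<in> Delta m n \<and> complex_space V \<and> g \<in> rhom V U \<and>
       a \<in> val (lvl Y m) V \<longrightarrow>
       cmp \<phi> m V (upair a (sop Q m n \<theta> V (rst (lvl Q n) V U g q))) = cmp \<phi> m V (upair a (cmp b m V undefined))}),
     rst = rst (lvl Q n)\<rparr>), sop = sop Q\<rparr>"

lemma E_simps [simp]: "rst (lvl E n) = rst (lvl Q n)" "sop E = sop Q"
  by (simp_all add: E_def)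

lemma E_iff: "q \<in> val (lvl E n) U \<longleftrightarrow> q \<in> val (lvl Q n) U \<and> (\<forall>m \<theta> V g a. \<theta> \<in> Delta m n \<and> complex_space V \<and> g \<in> rhom V U \<and>
       a \<in> val (lvl Y m) V \<longrightarrow>
       cmp \<phi> m V (upair a (sop Q m n \<theta> V (rst (lvl Q n) V U g q))) = cmp \<phi> m V (upair a (cmp b m V undefined)))"
  by (simp add: E_def)

lemma EI:
  assumes "q \<in> val (lvl Q n) U"
    and "\<And>m \<theta> V g a. \<theta> \<in> Delta m n \<Longrightarrow> complex_space V \<Longrightarrow> g \<in> rhom V U \<Longrightarrow> a \<in> val (lvl Y m) V \<Longrightarrow>
       cmp \<phi> m V (upair a (sop Q m n \<theta> V (rst (lvl Q n) V U g q))) = cmp \<phi> m V (upair a (cmp b m V undefined))"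
  shows "q \<in> val (lvl E n) U"
  using assms by (simp add: E_iff)

lemma E_Q: "q \<in> val (lvl E n) U \<Longrightarrow> q \<in> val (lvl Q n) U"
  by (simp add: E_iff)

lemma ED:
  "q \<in> val (lvl E n) U \<Longrightarrow> \<theta> \<in> Delta m n \<Longrightarrow> complex_space V \<Longrightarrow> g \<in> rhom V U \<Longrightarrow> a \<in> val (lvl Y m) V \<Longrightarrow>
       cmp \<phi> m V (upair a (sop Q m n \<theta> V (rst (lvl Q n) V U g q))) = cmp \<phi> m V (upair a (cmp b m V undefined))"
  unfolding E_iff by blast

lemma E_base:
  assumes q: "q \<in> val (lvl E n) U" and U: "complex_space U" and a: "a \<in> val (lvl Y n) U"
  shows "cmp \<phi> n U (upair a q) = cmp \<phi> n U (upair a (cmp b n U undefined))"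
  using ED[OF q Delta_id U rid_rhom[OF U] a] sop_id[OF Q U E_Q[OF q]] presheaf_id[OF simplicial_sheaf_presheaf[OF Q] U E_Q[OF q]]
  by simp

lemmas preQ = simplicial_sheaf_presheaf[OF Q]

lemma E_rst:
  assumes U: "complex_space U" "complex_space V" and f: "f \<in> rhom U V" and q: "q \<in> val (lvl E n) V"
  shows "rst (lvl Q n) U V f q \<in> val (lvl E n) U"
proof (rule EI[OF presheaf_val[OF preQ U f E_Q[OF q]]])
  fix m \<theta> W g a assume *: "\<theta> \<in> Delta m n" "complex_space W" "g \<in> rhom W U" "a \<in> val (lvl Y m) W"
  show "cmp \<phi> m W (upair a (sop Q m n \<theta> W (rst (lvl Q n) W U g (rst (lvl Q n) U V f q)))) =
      cmp \<phi> m W (upair a (cmp b m W undefined))"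
    unfolding presheaf_comp[OF preQ *(2) U *(3) f E_Q[OF q], symmetric]
    by (rule ED[OF q *(1,2) complex_rcomp[OF *(2) U *(3) f] *(4)])
qed

lemma E_sop:
  assumes U: "complex_space U" and \<theta>: "\<theta> \<in> Delta m n" and q: "q \<in> val (lvl E n) U"
  shows "sop Q m n \<theta> U q \<in> val (lvl E m) U"
proof (rule EI[OF sop_val[OF Q \<theta> U E_Q[OF q]]])
  fix k \<psi> W g a assume *: "\<psi> \<in> Delta k m" "complex_space W" "g \<in> rhom W U" "a \<in> val (lvl Y k) W"
  show "cmp \<phi> k W (upair a (sop Q k m \<psi> W (rst (lvl Q m) W U g (sop Q m n \<theta> U q)))) =
      cmp \<phi> k W (upair a (cmp b k W undefined))"
    unfolding sop_rst[OF Q \<theta> *(2) U *(3) E_Q[OF q], symmetric]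
      sop_sop[OF Q *(1) \<theta> *(2) presheaf_val[OF preQ *(2) U *(3) E_Q[OF q]], symmetric]
    by (rule ED[OF q Delta_comp[OF *(1) \<theta>] *(2-4)])
qed

lemma base_val: "complex_space U \<Longrightarrow> cmp b n U undefined \<in> val (lvl Q n) U"
  using map_val[OF b(1), of U undefined n] b by simp

lemma base_rst: "complex_space U \<Longrightarrow> complex_space V \<Longrightarrow> f \<in> rhom U V \<Longrightarrow>
    rst (lvl Q n) U V f (cmp b n V undefined) = cmp b n U undefined"
  using map_rst[OF b(1), of U V f undefined n] b by simp

lemma base_sop: "complex_space U \<Longrightarrow> \<theta> \<in> Delta m n \<Longrightarrow>
    sop Q m n \<theta> U (cmp b n U undefined) = cmp b m U undefined"
  using map_sop[OF b(1), of \<theta> m n U undefined] b by simp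

lemma phi_rst:
  assumes "complex_space U" "complex_space V" "f \<in> rhom U V" "a \<in> val (lvl Y n) V" "q \<in> val (lvl Q n) V"
  shows "rst X U V f (cmp \<phi> n V (upair a q)) = cmp \<phi> n U (upair (rst (lvl Y n) U V f a) (rst (lvl Q n) U V f q))"
  using map_rst[OF \<phi>(1) assms(1-3), of "upair a q" n] assms \<phi>(2,3) by simp

lemma phi_val:
  assumes "complex_space U" "a \<in> val (lvl Y n) U" "q \<in> val (lvl Q n) U"
  shows "cmp \<phi> n U (upair a q) \<in> val X U"
  using map_val[OF \<phi>(1) assms(1), of "upair a q" n] assms \<phi>(2,3) by simp

lemma X: "sheaf X"
  using simplicial_sheaf_level[OF map_cod[OF \<phi>(1)]] \<phi>(3) by simp

text \<open>The equations defining \<open>E\<close> hold between sections of the sheaf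
  \<open>X\<close>, so they may be checked locally on \<open>W\<close>, on the preimages of the
  members of the cover.\<close>

lemma E_local:
  assumes U: "complex_space U" and q: "q \<in> val (lvl Q n) U" and \<V>: "\<V> \<subseteq> opens U" "\<Union>\<V> = points U"
    and loc: "\<And>V. V \<in> \<V> \<Longrightarrow> rst_open (lvl Q n) U V (points U) q \<in> val (lvl E n) (open_sub U V)"
  shows "q \<in> val (lvl E n) U"
proof (rule EI[OF q])
  fix m \<theta> W g a assume \<theta>: "\<theta> \<in> Delta m n" and W: "complex_space W" and g: "g \<in> rhom W U" and a: "a \<in> val (lvl Y m) W"
  let ?gq = "rst (lvl Q n) W U g q"
  let ?q = "sop Q m n \<theta> W ?gq" and ?b = "cmp b m W undefined"
  have gq: "?gq \<in> val (lvl Q n) W" by (rule presheaf_val[OF preQ W U g q])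
  have q': "?q \<in> val (lvl Q m) W" by (rule sop_val[OF Q \<theta> W gq])
  show "cmp \<phi> m W (upair a ?q) = cmp \<phi> m W (upair a ?b)"
  proof (rule sheaf_separated[OF X W phi_val[OF W a q'] phi_val[OF W a base_val[OF W]]])
    fix w assume w: "w \<in> points W"
    have "fst g w \<in> points U" using rhom_continuous[OF g] w by (auto simp: continuous_map_def)
    then obtain V where V: "V \<in> \<V>" "fst g w \<in> V" using \<V>(2) by blast
    have Vo: "V \<in> opens U" using V \<V>(1) by blast
    let ?T = "preim W (fst g) V"
    have T: "?T \<in> opens W" by (rule rhom_preim_open[OF g Vo])
    have sub: "?T \<subseteq> points W" "V \<subseteq> points U" using T Vo openin_subset by blast+
    note O = complex_space_open_sub[OF W T]
    have i: "incl W ?T (points W) \<in> rhom (open_sub W ?T) W"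
      using incl_rhom[OF W T points_open sub(1)] by simp
    have pp: "points W \<subseteq> preim W (fst g) (points U)"
      using rhom_continuous[OF g] by (auto simp: preim_def continuous_map_def)
    have qo: "q \<in> val (lvl Q n) (open_sub U (points U))" using q by simp
    \<comment> \<open>Pulling \<open>q\<close> back and then restricting equals restricting
      \<open>q\<close> to \<open>V\<close> and then pulling back along the restricted morphism; in
      the second form the hypothesis on \<open>V\<close> applies.\<close>
    let ?r = "rst (lvl Q n) (open_sub W ?T) W (incl W ?T (points W)) ?gq"
    have "?r = rst_open (lvl Q n) W ?T (points W) (pull (lvl Q n) W U g (points W) (points U) q)"
      unfolding pull_points[OF W U g] by simp
    also have "\<dots> = pull (lvl Q n) W U g ?T (points U) q"
      by (rule rst_open_pull[OF preQ W U g T points_open points_open sub(1) pp qo])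
    also have "\<dots> = pull (lvl Q n) W U g ?T V (rst_open (lvl Q n) U V (points U) q)"
      by (rule pull_rst_open[symmetric, OF preQ W U g T Vo points_open subset_refl sub(2) qo])
    finally have r: "?r = rst (lvl Q n) (open_sub W ?T) (open_sub U V) (rrestr W U g ?T V) (rst_open (lvl Q n) U V (points U) q)"
      unfolding pull_def .
    have rr: "rrestr W U g ?T V \<in> rhom (open_sub W ?T) (open_sub U V)"
      by (intro rrestr_in_rhom complex_space_precringed W U g T Vo subset_refl)
    let ?a = "rst (lvl Y m) (open_sub W ?T) W (incl W ?T (points W)) a"
    have a': "?a \<in> val (lvl Y m) (open_sub W ?T)" by (rule presheaf_val[OF simplicial_sheaf_presheaf[OF Y] O W i a])
    have "rst X (open_sub W ?T) W (incl W ?T (points W)) (cmp \<phi> m W (upair a ?q)) =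
        cmp \<phi> m (open_sub W ?T) (upair ?a (sop Q m n \<theta> (open_sub W ?T) ?r))"
      unfolding phi_rst[OF O W i a q'] sop_rst[OF Q \<theta> O W i gq] ..
    also have "\<dots> = cmp \<phi> m (open_sub W ?T) (upair ?a (cmp b m (open_sub W ?T) undefined))"
      unfolding r by (rule ED[OF loc[OF V(1)] \<theta> O rr a'])
    also have "\<dots> = rst X (open_sub W ?T) W (incl W ?T (points W)) (cmp \<phi> m W (upair a ?b))"
      unfolding phi_rst[OF O W i a base_val[OF W]] base_rst[OF O W i] ..
    finally have "rst_open X W ?T (points W) (cmp \<phi> m W (upair a ?q)) = rst_open X W ?T (points W) (cmp \<phi> m W (upair a ?b))"
      by simp
    moreover have "w \<in> ?T" using w V(2) by (simp add: preim_def)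
    ultimately show "\<exists>T\<in>opens W. w \<in> T \<and> rst_open X W T (points W) (cmp \<phi> m W (upair a ?q)) = rst_open X W T (points W) (cmp \<phi> m W (upair a ?b))"
      using T by blast
  qed
qed

lemma sheaf_E: "sheaf (lvl E n)"
proof (rule sheafI)
  show "is_presheaf (lvl E n)"
    by (rule is_presheafI) (simp_all add: E_rst presheaf_id[OF preQ] presheaf_comp[OF preQ] E_Q)
  fix U \<V> s assume U: "complex_space U" and \<V>: "\<V> \<subseteq> opens U" "\<Union>\<V> = points U"
    and s: "\<forall>V\<in>\<V>. s V \<in> val (lvl E n) (open_sub U V)"
    and c: "\<forall>V\<in>\<V>. \<forall>W\<in>\<V>. rst_open (lvl E n) U (V \<inter> W) V (s V) = rst_open (lvl E n) U (V \<inter> W) W (s W)"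
  have 1: "\<exists>!a. a \<in> val (lvl Q n) U \<and> (\<forall>V\<in>\<V>. rst_open (lvl Q n) U V (points U) a = s V)"
    by (rule sheaf_glueD[OF simplicial_sheaf_level[OF Q] U \<V>]) (use s c in \<open>auto intro: E_Q\<close>)
  then obtain a where a: "a \<in> val (lvl Q n) U" "\<forall>V\<in>\<V>. rst_open (lvl Q n) U V (points U) a = s V" by blast
  have aE: "a \<in> val (lvl E n) U"
    by (rule E_local[OF U a(1) \<V>]) (use a(2) s in simp)
  show "\<exists>!a. a \<in> val (lvl E n) U \<and> (\<forall>V\<in>\<V>. rst_open (lvl E n) U V (points U) a = s V)"
  proof (rule ex1I[of _ a])
    show "a \<in> val (lvl E n) U \<and> (\<forall>V\<in>\<V>. rst_open (lvl E n) U V (points U) a = s V)" using aE a(2) by simp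
    fix c assume "c \<in> val (lvl E n) U \<and> (\<forall>V\<in>\<V>. rst_open (lvl E n) U V (points U) c = s V)"
    then have "c \<in> val (lvl Q n) U \<and> (\<forall>V\<in>\<V>. rst_open (lvl Q n) U V (points U) c = s V)" using E_Q by simp
    then show "c = a" using the1_equality[OF 1, of a] the1_equality[OF 1, of c] a by simp
  qed
qed

lemma simplicial_sheaf_E: "simplicial_sheaf E"
  by (rule simplicial_sheafI)
    (simp_all add: sheaf_E E_sop sop_rst[OF Q] sop_id[OF Q] sop_sop[OF Q] E_Q)

lemma base_E: "complex_space U \<Longrightarrow> cmp b n U undefined \<in> val (lvl E n) U"
  by (rule EI[OF base_val]) (simp_all add: base_rst base_sop)

text \<open>Both legs of the colimit cocone land in \<open>E\<close>, hence induce a map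
  \<open>h\<close> from \<open>Q\<close> to \<open>E\<close>. Followed by the inclusion
  \<open>j\<close> it fixes both legs, so by uniqueness it is the identity of \<open>Q\<close>; thus
  every section of \<open>Q\<close> lies in \<open>E\<close>.\<close>

lemma cocone_in_E:
  assumes push: "is_pushout sSh i (to_pt (fst i)) p b"
    and p: "\<And>n U a z. complex_space U \<Longrightarrow> a \<in> val (lvl Y n) U \<Longrightarrow> z \<in> val (lvl (fst p) n) U \<Longrightarrow>
      cmp \<phi> n U (upair a (cmp p n U z)) = cmp \<phi> n U (upair a (cmp b n U undefined))"
    and U: "complex_space U" and q: "q \<in> val (lvl Q n) U"
  shows "q \<in> val (lvl E n) U"
proof -
  have arr: "simplicial_map i" "simplicial_map (to_pt (fst i))" "simplicial_map p" "fst p = fst (snd i)"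
    "fst (snd p) = Q" "Comp sSh p i = Comp sSh b (to_pt (fst i))"
    using push b(3) unfolding is_pushout_def by simp_all
  have push': "\<forall>r s. r \<in> Arr sSh \<and> s \<in> Arr sSh \<and> Dom sSh r = Cod sSh i \<and> Dom sSh s = Cod sSh (to_pt (fst i)) \<and>
      Cod sSh r = Cod sSh s \<and> Comp sSh r i = Comp sSh s (to_pt (fst i)) \<longrightarrow>
      (\<exists>!h. h \<in> Arr sSh \<and> Dom sSh h = Cod sSh p \<and> Cod sSh h = Cod sSh r \<and> Comp sSh h p = r \<and> Comp sSh h b = s)"
    using push unfolding is_pushout_def by (elim conjE)
  have univ: "\<exists>!h. simplicial_map h \<and> fst h = fst (snd p) \<and> fst (snd h) = fst (snd r) \<and> Comp sSh h p = r \<and> Comp sSh h b = s"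
    if "simplicial_map r" "simplicial_map s" "fst r = fst (snd i)" "fst s = pt"
      "fst (snd r) = fst (snd s)" "Comp sSh r i = Comp sSh s (to_pt (fst i))" for r s
    using push'[rule_format, of r s] that by simp
  have pE: "cmp p n U z \<in> val (lvl E n) U" if U: "complex_space U" and z: "z \<in> val (lvl (fst p) n) U" for n U z
  proof (rule EI)
    show "cmp p n U z \<in> val (lvl Q n) U" using map_val[OF arr(3) U z] arr(5) by simp
    fix m \<theta> V g a assume *: "\<theta> \<in> Delta m n" "complex_space V" "g \<in> rhom V U" "a \<in> val (lvl Y m) V"
    have z': "rst (lvl (fst p) n) V U g z \<in> val (lvl (fst p) n) V"
      by (rule presheaf_val[OF simplicial_sheaf_presheaf[OF map_dom[OF arr(3)]] *(2) U *(3) z])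
    have "sop Q m n \<theta> V (rst (lvl Q n) V U g (cmp p n U z)) = cmp p m V (sop (fst p) m n \<theta> V (rst (lvl (fst p) n) V U g z))"
      using map_rst[OF arr(3) *(2) U *(3) z] map_sop[OF arr(3) *(1,2) z'] arr(5) by simp
    then show "cmp \<phi> m V (upair a (sop Q m n \<theta> V (rst (lvl Q n) V U g (cmp p n U z)))) = cmp \<phi> m V (upair a (cmp b m V undefined))"
      using p[OF *(2,4) sop_val[OF map_dom[OF arr(3)] *(1,2) z']] by simp
  qed
  \<comment> \<open>The legs \<open>p\<close> and \<open>b\<close> with target cut down to
    \<open>E\<close>, and the inclusion \<open>j\<close> of \<open>E\<close> in
    \<open>Q\<close>.\<close>
  define p' where "p' = (fst p, E, extend (fst p) (cmp p))"
  define b' where "b' = (fst b, E, extend (fst b) (cmp b))"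
  define j where "j = (E, Q, extend E (\<lambda>n U a. a))"
  have p': "simplicial_map p'" unfolding p'_def
    by (rule simplicial_mapI[OF map_dom[OF arr(3)] simplicial_sheaf_E pE])
      (use map_rst[OF arr(3)] map_sop[OF arr(3)] arr(5) in simp_all)
  have b': "simplicial_map b'" unfolding b'_def
    by (rule simplicial_mapI) (use map_dom[OF b(1)] b(2) simplicial_sheaf_E base_E base_rst base_sop in auto)
  have j: "simplicial_map j" unfolding j_def
    by (rule simplicial_mapI[OF simplicial_sheaf_E Q]) (simp_all add: E_Q)
  have "Comp sSh p' i = Comp sSh b' (to_pt (fst i))"
  proof (rule simplicial_map_eqI)
    fix n U a assume U: "complex_space U" and "a \<in> val (lvl (fst (Comp sSh p' i)) n) U"
    then have a: "a \<in> val (lvl (fst i) n) U" by simp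
    have ia: "cmp i n U a \<in> val (lvl (fst p) n) U" using map_val[OF arr(1) U a] arr(4) by simp
    have "cmp (Comp sSh p i) n U a = cmp (Comp sSh b (to_pt (fst i))) n U a" using arr(6) by simp
    then show "cmp (Comp sSh p' i) n U a = cmp (Comp sSh b' (to_pt (fst i))) n U a"
      using U a ia by (simp add: p'_def b'_def b(2))
  qed (use arr p' b' b(2) in \<open>auto intro!: simplicial_map_Comp simp: p'_def b'_def\<close>)
  then obtain h where h: "simplicial_map h" "fst h = Q" "fst (snd h) = E" "Comp sSh h p = p'" "Comp sSh h b = b'"
    using univ[OF p' b'] arr(4,5) b(2) unfolding p'_def b'_def by auto
  have "Comp sSh j h = Ide sSh Q"
  proof -
    have "Comp sSh (Comp sSh j h) p = p"
    proof (rule simplicial_map_eqI)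
      fix n U a assume U: "complex_space U" and "a \<in> val (lvl (fst (Comp sSh (Comp sSh j h) p)) n) U"
      then have a: "a \<in> val (lvl (fst p) n) U" by simp
      have pa: "cmp p n U a \<in> val (lvl (fst h) n) U" using map_val[OF arr(3) U a] arr(5) h(2) by simp
      have "cmp (Comp sSh h p) n U a = cmp p n U a" unfolding h(4) using U a by (simp add: p'_def)
      then have hp: "cmp h n U (cmp p n U a) = cmp p n U a" using U a by simp
      then show "cmp (Comp sSh (Comp sSh j h) p) n U a = cmp p n U a"
        using U a pa pE[OF U a] by (simp add: j_def)
    qed (use arr j h in \<open>auto intro!: simplicial_map_Comp simp: j_def\<close>)
    moreover have "Comp sSh (Comp sSh j h) b = b"
    proof (rule simplicial_map_eqI)
      fix n U a assume U: "complex_space U" and "a \<in> val (lvl (fst (Comp sSh (Comp sSh j h) b)) n) U"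
      then have a: "a \<in> val (lvl (fst b) n) U" "a = undefined" using b(2) by simp_all
      have ba: "cmp b n U a \<in> val (lvl (fst h) n) U" using map_val[OF b(1) U a(1)] b(3) h(2) by simp
      have "cmp (Comp sSh h b) n U a = cmp b n U a" unfolding h(5) using U a by (simp add: b'_def)
      then have hb: "cmp h n U (cmp b n U a) = cmp b n U a" using U a by simp
      then show "cmp (Comp sSh (Comp sSh j h) b) n U a = cmp b n U a"
        using U a ba base_E[OF U] by (simp add: j_def)
    qed (use b j h in \<open>auto intro!: simplicial_map_Comp simp: j_def\<close>)
    moreover have "Comp sSh (Ide sSh Q) p = p" "Comp sSh (Ide sSh Q) b = b"
      using Ide_Comp_sSh[OF arr(3)] Ide_Comp_sSh[OF b(1)] arr(5) b(3) by simp_all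
    moreover have "simplicial_map (Comp sSh j h)" using j h by (intro simplicial_map_Comp) (auto simp: j_def)
    moreover have "fst (Comp sSh j h) = Q" "fst (snd (Comp sSh j h)) = Q" using h by (simp_all add: j_def)
    ultimately show ?thesis
      using univ[OF arr(3) b(1) arr(4) b(2) _ arr(6)] arr(5) b(3) simplicial_map_Ide[OF Q] fst_Ide[of Q]
      by metis
  qed
  then have "cmp (Comp sSh j h) n U q = q" using U q by simp
  moreover have "cmp h n U q \<in> val (lvl E n) U" using map_val[OF h(1) U, of q n] h q by simp
  ultimately show ?thesis using U q h(2) by (simp add: j_def)
qed

end

text \<open>Reduces insensitivity of a quotient to sections that come from the space before
  collapsing, which are the only ones with an explicit description.\<close>

lemma insensitive_quotient:
  assumes push: "is_pushout sSh i (to_pt (fst i)) p b"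
    and p: "\<And>Y \<phi> n U a z. simplicial_sheaf Y \<Longrightarrow> simplicial_map \<phi> \<Longrightarrow> fst \<phi> = sprod Y (fst (snd b)) \<Longrightarrow>
      fst (snd \<phi>) = const_ssheaf X \<Longrightarrow> complex_space U \<Longrightarrow> a \<in> val (lvl Y n) U \<Longrightarrow> z \<in> val (lvl (fst p) n) U \<Longrightarrow>
      cmp \<phi> n U (upair a (cmp p n U z)) = cmp \<phi> n U (upair a (cmp b n U undefined))"
  shows "insensitive X (fst (snd b))"
proof -
  have b: "simplicial_map b" "fst b = pt" using push unfolding is_pushout_def by simp_all
  show ?thesis
    unfolding insensitive_def
  proof (intro conjI allI impI, rule map_cod[OF b(1)], elim conjE)
    fix Y \<phi> n U a q q'
    assume Y: "simplicial_sheaf Y" and \<phi>: "simplicial_map \<phi>" "fst \<phi> = sprod Y (fst (snd b))" "fst (snd \<phi>) = const_ssheaf X"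
      and U: "complex_space U" and a: "a \<in> val (lvl Y n) U"
      and q: "q \<in> val (lvl (fst (snd b)) n) U" "q' \<in> val (lvl (fst (snd b)) n) U"
    interpret collapse X Y "fst (snd b)" b \<phi>
      by unfold_locales (use Y \<phi> b map_cod[OF b(1)] in simp_all)
    have "cmp \<phi> n U (upair a r) = cmp \<phi> n U (upair a (cmp b n U undefined))" if "r \<in> val (lvl (fst (snd b)) n) U" for r
      by (rule E_base[OF cocone_in_E[OF push p[OF Y \<phi>] U that] U a])
    then show "cmp \<phi> n U (upair a q) = cmp \<phi> n U (upair a q')" using q by simp
  qed
qed

section \<open>Circles and smash products\<close>

lemma is_pushoutD:
  assumes "is_pushout sSh f g p q"
  shows "simplicial_map f" "simplicial_map g" "simplicial_map p" "simplicial_map q"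
    "fst p = fst (snd f)" "fst q = fst (snd g)" "fst (snd p) = fst (snd q)" "Comp sSh p f = Comp sSh q g"
  using assms unfolding is_pushout_def by simp_all

lemma quotient_collapses:
  assumes push: "is_pushout sSh i (to_pt (fst i)) p b" and U: "complex_space U" and a: "a \<in> val (lvl (fst i) n) U"
  shows "cmp p n U (cmp i n U a) = cmp b n U undefined"
proof -
  have "cmp (Comp sSh p i) n U a = cmp (Comp sSh b (to_pt (fst i))) n U a"
    using is_pushoutD(8)[OF push] by simp
  then show ?thesis using U a by simp
qed

text \<open>A map on a product with the circle, composed with the quotient map, is a map on a
  product with the line. There the second argument may be moved to one of the collapsed points,
  which goes to the base point.\<close>

lemma insensitive_circle:
  fixes X :: "'u::universe presheaf" and s :: "'u sarrow"
  assumes X: "hyperbolic (const_ssheaf X)" and s: "is_circle UNIV z z' s"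
  shows "insensitive X (fst (snd s))"
proof -
  let ?C = "plane_sheaf UNIV :: 'u ssheaf"
  obtain i k :: "'u sarrow" where i: "simplicial_map i" "fst i = pt" and k: "simplicial_map k" "fst k = fst (snd i)" "fst (snd k) = ?C"
    and q: "is_quotient k s"
    using s unfolding is_circle_def is_coproduct_def by auto
  obtain p where push: "is_pushout sSh k (to_pt (fst k)) p s" using q unfolding is_quotient_def by auto
  note P = is_pushoutD[OF push]
  have C: "insensitive X ?C" by (rule insensitive_plane[OF X]) (use map_cod[OF k(1)] k(3) in simp)
  show ?thesis
  proof (rule insensitive_quotient[OF push])
    fix Y \<phi> n U and a c :: 'u
    assume Y: "simplicial_sheaf Y" and \<phi>: "simplicial_map \<phi>" "fst \<phi> = sprod Y (fst (snd s))" "fst (snd \<phi>) = const_ssheaf X"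
      and U: "complex_space U" and a: "a \<in> val (lvl Y n) U" and c: "c \<in> val (lvl (fst p) n) U"
    define \<psi> where "\<psi> = (sprod Y (fst p), fst (snd \<phi>),
      extend (sprod Y (fst p)) (\<lambda>n U z. cmp \<phi> n U (upair (ufst z) (cmp p n U (usnd z)))))"
    have \<psi>: "simplicial_map \<psi>" unfolding \<psi>_def by (rule simplicial_map_pair_right[OF Y P(3) \<phi>(1)]) (use \<phi>(2) P(7) in simp)
    have cmp_psi: "cmp \<psi> n U (upair a d) = cmp \<phi> n U (upair a (cmp p n U d))" if "d \<in> val (lvl (fst p) n) U" for d
      using U a that by (simp add: \<psi>_def)
    have pC: "fst p = ?C" using P(5) k(3) by simp
    \<comment> \<open>\<open>undefined\<close> is the only section of \<open>pt\<close>, so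
      \<open>?e\<close> is one of the two points that are collapsed.\<close>
    let ?e = "cmp i n U undefined"
    have e: "?e \<in> val (lvl (fst k) n) U" using map_val[OF i(1) U, of undefined n] i(2) k(2) by simp
    have ke: "cmp k n U ?e \<in> val (lvl (fst p) n) U" using map_val[OF k(1) U e] P(5) by simp
    have "cmp \<psi> n U (upair a c) = cmp \<psi> n U (upair a (cmp k n U ?e))"
      by (rule insensitiveD[OF C Y \<psi> _ _ U a]) (use c ke pC \<phi>(3) in \<open>simp_all add: \<psi>_def\<close>)
    then show "cmp \<phi> n U (upair a (cmp p n U c)) = cmp \<phi> n U (upair a (cmp s n U undefined))"
      unfolding cmp_psi[OF c] cmp_psi[OF ke] quotient_collapses[OF push U e] .
  qed
qed

text \<open>Composition with the associativity isomorphism of products, so that \<open>A\<close>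
  becomes part of the parameter space.\<close>

lemma simplicial_map_uncurry:
  assumes A: "simplicial_sheaf A" and B: "simplicial_sheaf B" and Y: "simplicial_sheaf Y"
    and \<phi>: "simplicial_map \<phi>" "fst \<phi> = sprod Y (sprod A B)"
  shows "simplicial_map (sprod (sprod Y A) B, fst (snd \<phi>),
    extend (sprod (sprod Y A) B) (\<lambda>n U z. cmp \<phi> n U (upair (ufst (ufst z)) (upair (usnd (ufst z)) (usnd z)))))"
proof (rule simplicial_mapI[OF simplicial_sheaf_sprod[OF simplicial_sheaf_sprod[OF Y A] B] map_cod[OF \<phi>(1)]];
    (erule sprodE)+)
  have v: "upair a (upair b c) \<in> val (lvl (fst \<phi>) n) U"
    if "a \<in> val (lvl Y n) U" "b \<in> val (lvl A n) U" "c \<in> val (lvl B n) U" for n U a b c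
    using that by (simp add: \<phi>(2))
  let ?g = "\<lambda>z. upair (ufst (ufst z)) (upair (usnd (ufst z)) (usnd z))"
  show "cmp \<phi> n U (?g z) \<in> val (lvl (fst (snd \<phi>)) n) U"
    if "complex_space U" "z = upair y c" "c \<in> val (lvl B n) U" "y = upair a b" "a \<in> val (lvl Y n) U" "b \<in> val (lvl A n) U"
    for n U z y a b c
    using map_val[OF \<phi>(1) that(1) v[OF that(5,6,3)]] that(2,4) by simp
  show "cmp \<phi> n U (?g (rst (lvl (sprod (sprod Y A) B) n) U V f z)) = rst (lvl (fst (snd \<phi>)) n) U V f (cmp \<phi> n V (?g z))"
    if "complex_space U" "complex_space V" "f \<in> rhom U V" "z = upair y c" "c \<in> val (lvl B n) V" "y = upair a b"
      "a \<in> val (lvl Y n) V" "b \<in> val (lvl A n) V"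
    for n U V f z y a b c
    using map_rst[OF \<phi>(1) that(1-3) v[OF that(7,8,5)]] that(4,6) by (simp add: \<phi>(2))
  show "cmp \<phi> m U (?g (sop (sprod (sprod Y A) B) m n \<theta> U z)) = sop (fst (snd \<phi>)) m n \<theta> U (cmp \<phi> n U (?g z))"
    if "\<theta> \<in> Delta m n" "complex_space U" "z = upair y c" "c \<in> val (lvl B n) U" "y = upair a b"
      "a \<in> val (lvl Y n) U" "b \<in> val (lvl A n) U"
    for m n \<theta> U z y a b c
    using map_sop[OF \<phi>(1) that(1,2) v[OF that(6,7,4)]] that(3,5) by (simp add: \<phi>(2))
qed

text \<open>With the product of \<open>Y\<close> and \<open>A\<close> as parameter space,
  insensitivity of \<open>B\<close> moves the second coordinate of a point of the product to the
  base point of \<open>B\<close>. The point then lies on the axis \<open>A\<close> of the wedge,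
  which the smash product collapses.\<close>

lemma insensitive_smash:
  fixes X :: "'u::universe presheaf" and a b c :: "'u sarrow"
  assumes B: "insensitive X (fst (snd b))" and smash: "is_smash a b c"
  shows "insensitive X (fst (snd c))"
proof -
  let ?A = "fst (snd a)" and ?B = "fst (snd b)"
  obtain i j w :: "'u sarrow" where pt: "pointed a" "pointed b" and push1: "is_pushout sSh a b i j"
    and w: "simplicial_map w" "fst w = fst (snd i)" "fst (snd w) = sprod ?A ?B"
    and w1: "Comp sSh (proj1 ?A ?B) (Comp sSh w i) = Ide sSh ?A"
    and w2: "Comp sSh (proj2 ?A ?B) (Comp sSh w i) = Comp sSh b (to_pt ?A)" and q: "is_quotient w c"
    using smash unfolding is_smash_def Let_def by auto
  obtain p where push: "is_pushout sSh w (to_pt (fst w)) p c" using q unfolding is_quotient_def by auto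
  note P1 = is_pushoutD[OF push1] and P = is_pushoutD[OF push]
  have sA: "simplicial_sheaf ?A" and sB: "simplicial_sheaf ?B" using map_cod[OF P1(1)] map_cod[OF P1(2)] by simp_all
  have pAB: "fst p = sprod ?A ?B" using P(5) w(3) by simp
  have iA: "fst i = ?A" using P1(5) .
  \<comment> \<open>The arrow \<open>w\<close> is given by its composites with the projections; on
    the summand \<open>A\<close> it is the embedding as first axis.\<close>
  have wi: "cmp w n U (cmp i n U e) = upair e (cmp b n U undefined)" if U: "complex_space U" and e: "e \<in> val (lvl ?A n) U" for n U e
  proof -
    have ie: "cmp i n U e \<in> val (lvl (fst w) n) U" using map_val[OF P1(3) U, of e n] e iA w(2) by simp
    have wie: "cmp w n U (cmp i n U e) \<in> val (lvl (sprod ?A ?B) n) U" using map_val[OF w(1) U ie] w(3) by simp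
    have "cmp (Comp sSh (proj1 ?A ?B) (Comp sSh w i)) n U e = e" unfolding w1 using U e by simp
    then have 1: "ufst (cmp w n U (cmp i n U e)) = e" using U e iA wie by (simp add: proj1_def)
    have "cmp (Comp sSh (proj2 ?A ?B) (Comp sSh w i)) n U e = cmp b n U undefined" unfolding w2 using U e by simp
    then have 2: "usnd (cmp w n U (cmp i n U e)) = cmp b n U undefined" using U e iA wie by (simp add: proj2_def)
    show ?thesis using wie 1 2 by (elim sprodE) simp
  qed
  show ?thesis
  proof (rule insensitive_quotient[OF push])
    fix Y \<phi> n U and y d :: 'u
    assume Y: "simplicial_sheaf Y" and \<phi>: "simplicial_map \<phi>" "fst \<phi> = sprod Y (fst (snd c))" "fst (snd \<phi>) = const_ssheaf X"
      and U: "complex_space U" and y: "y \<in> val (lvl Y n) U" and d: "d \<in> val (lvl (fst p) n) U"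
    define \<psi> where "\<psi> = (sprod Y (fst p), fst (snd \<phi>),
      extend (sprod Y (fst p)) (\<lambda>n U z. cmp \<phi> n U (upair (ufst z) (cmp p n U (usnd z)))))"
    have \<psi>: "simplicial_map \<psi>" unfolding \<psi>_def by (rule simplicial_map_pair_right[OF Y P(3) \<phi>(1)]) (use \<phi>(2) P(7) in simp)
    have psi_dom: "fst \<psi> = sprod Y (sprod ?A ?B)" by (simp add: \<psi>_def pAB)
    define \<rho> where "\<rho> = (sprod (sprod Y ?A) ?B, fst (snd \<psi>),
      extend (sprod (sprod Y ?A) ?B) (\<lambda>n U z. cmp \<psi> n U (upair (ufst (ufst z)) (upair (usnd (ufst z)) (usnd z)))))"
    have \<rho>: "simplicial_map \<rho>" unfolding \<rho>_def by (rule simplicial_map_uncurry[OF sA sB Y \<psi> psi_dom])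
    have cmp_rho: "cmp \<rho> n U (upair (upair y e) g) = cmp \<phi> n U (upair y (cmp p n U (upair e g)))"
      if "e \<in> val (lvl ?A n) U" "g \<in> val (lvl ?B n) U" for e g
      using U y that by (simp add: \<rho>_def \<psi>_def pAB)
    obtain e g where d': "d = upair e g" and e: "e \<in> val (lvl ?A n) U" and g: "g \<in> val (lvl ?B n) U"
      using d unfolding pAB by (rule sprodE)
    have b0: "cmp b n U undefined \<in> val (lvl ?B n) U" using map_val[OF P1(2) U, of undefined n] pt(2) by (simp add: pointed_iff)
    have ye: "upair y e \<in> val (lvl (sprod Y ?A) n) U" using y e by simp
    have ie: "cmp i n U e \<in> val (lvl (fst w) n) U" using map_val[OF P1(3) U, of e n] e iA w(2) by simp
    have "cmp \<rho> n U (upair (upair y e) g) = cmp \<rho> n U (upair (upair y e) (cmp b n U undefined))"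
      by (rule insensitiveD[OF B simplicial_sheaf_sprod[OF Y sA] \<rho> _ _ U ye g b0]) (simp_all add: \<rho>_def \<psi>_def \<phi>(3))
    then have "cmp \<phi> n U (upair y (cmp p n U d)) = cmp \<phi> n U (upair y (cmp p n U (cmp w n U (cmp i n U e))))"
      unfolding cmp_rho[OF e g] cmp_rho[OF e b0] wi[OF U e] d' .
    then show "cmp \<phi> n U (upair y (cmp p n U d)) = cmp \<phi> n U (upair y (cmp c n U undefined))"
      unfolding quotient_collapses[OF push U ie] .
  qed
qed

text \<open>A positive smash power has a circle as its last factor, and
  \<open>insensitive_smash\<close> asks for insensitivity of the last factor.\<close>

lemma insensitive_par_sphere:
  assumes X: "hyperbolic (const_ssheaf X)" and b: "is_par_sphere n b" and n: "n > 0"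
  shows "insensitive X (fst (snd b))"
proof -
  obtain t where t: "is_circle UNIV 0 1 t" "is_smash_power t n b" using b unfolding is_par_sphere_def by blast
  from t(2) n show ?thesis
  proof cases
    case (smash_power_Suc m b')
    show ?thesis by (rule insensitive_smash[OF insensitive_circle[OF X t(1)] smash_power_Suc(3)])
  qed simp
qed

lemma pointed_smash: "is_smash a b c \<Longrightarrow> pointed c"
  unfolding is_smash_def is_quotient_def Let_def by (auto simp: pointed_iff dest: is_pushoutD)

section \<open>Vanishing\<close>

text \<open>Extension along pointed equivalences turns zigzags into pointed maps, and insensitivity
  leaves the constant map as the only one.\<close>

lemma H_pointed_hom_insensitive:
  fixes X :: "'u::universe presheaf" and x s :: "'u sarrow"
  assumes X: "hyperbolic (const_ssheaf X)" and x: "pointed x" "Cod sSh x = const_ssheaf X"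
    and s: "pointed s" and S: "insensitive X (fst (snd s))"
  shows "H_pointed_hom s x = {H_trivial s x}"
  unfolding H_pointed_hom_def H_trivial_def
proof (rule localization.loc_hom_singleton[OF localization_sSh_pointed])
  show "pointed_weq \<subseteq> Arr sSh_pointed" by (auto simp: pointed_weq_def)
next
  fix v u assume v: "v \<in> pointed_weq" and u: "u \<in> Arr sSh_pointed" "Dom sSh_pointed u = Dom sSh_pointed v" "Cod sSh_pointed u = x"
  obtain a b f where vv: "v = (a, b, f)" by (cases v)
  obtain h where uu: "u = (a, x, h)" using u vv by (cases u) auto
  have f: "f \<in> C_weq" "simplicial_map f" "pointed a" "pointed b" "fst f = fst (snd a)" "fst (snd f) = fst (snd b)" "Comp sSh f a = b"
    using v unfolding vv pointed_weq_def by (auto simp: Arr_pointed_iff)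
  have h: "simplicial_map h" "fst h = fst (snd a)" "fst (snd h) = const_ssheaf X" "Comp sSh h a = x"
    using u x(2) unfolding uu by (auto simp: Arr_pointed_iff)
  have "\<exists>!\<psi>. \<psi> \<in> Arr sSh \<and> Dom sSh \<psi> = Cod sSh f \<and> Cod sSh \<psi> = const_ssheaf X \<and> Comp sSh \<psi> f = h"
    by (rule C_weq_orthogonal[OF X f(1), unfolded orthogonal_to_def, THEN bspec, THEN mp]) (use h f in simp_all)
  then obtain \<psi> where \<psi>: "simplicial_map \<psi>" "fst \<psi> = fst (snd f)" "fst (snd \<psi>) = const_ssheaf X" "Comp sSh \<psi> f = h"
    by (elim ex1E conjE) simp
  \<comment> \<open>The unpointed extension is automatically pointed: the base point of the target
    of \<open>f\<close> is the image of that of its source.\<close>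
  have "Comp sSh \<psi> b = x"
    using Comp_assoc_sSh[of a f \<psi>] f \<psi> h(4) by (simp add: pointed_iff)
  then show "\<exists>\<psi>\<in>Arr sSh_pointed. Dom sSh_pointed \<psi> = Cod sSh_pointed v \<and> Cod sSh_pointed \<psi> = x \<and> Comp sSh_pointed \<psi> v = u"
    using f \<psi> x unfolding vv uu by (intro bexI[of _ "(b, x, \<psi>)"]) (simp_all add: Arr_pointed_iff)
next
  let ?S = "fst (snd s)"
  note sm = s[unfolded pointed_iff] and xm = x(1)[unfolded pointed_iff]
  have sS: "simplicial_sheaf ?S" using map_cod sm by blast
  have spt: "simplicial_sheaf (pt :: 'u ssheaf)" using map_dom[of s] sm by simp
  have tp: "simplicial_map (to_pt ?S)" by (rule simplicial_map_to_pt[OF sS spt])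
  have t: "simplicial_map (Comp sSh x (to_pt ?S))" using xm tp by (intro simplicial_map_Comp) simp_all
  have ts: "Comp sSh (Comp sSh x (to_pt ?S)) s = x"
  proof (rule simplicial_map_eqI)
    show "simplicial_map (Comp sSh (Comp sSh x (to_pt ?S)) s)" using t sm tp xm by (intro simplicial_map_Comp) simp_all
    fix n U e assume U: "complex_space U" and "e \<in> val (lvl (fst (Comp sSh (Comp sSh x (to_pt ?S)) s)) n) U"
    then have e: "e \<in> val (lvl (fst s) n) U" "e = undefined" using sm by simp_all
    have "cmp s n U e \<in> val (lvl ?S n) U" by (rule map_val[OF _ U e(1)]) (use sm in simp)
    then show "cmp (Comp sSh (Comp sSh x (to_pt ?S)) s) n U e = cmp x n U e" using U e by simp
  qed (use sm xm in simp_all)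
  show T: "(s, x, Comp sSh x (to_pt (Cod sSh s))) \<in> Arr sSh_pointed"
    using s x(1) t ts by (simp add: Arr_pointed_iff)
  fix u assume u: "u \<in> Arr sSh_pointed" "Dom sSh_pointed u = s" "Cod sSh_pointed u = x"
  then obtain h where uu: "u = (s, x, h)" by (cases u) auto
  have h: "simplicial_map h" "fst h = ?S" "fst (snd h) = const_ssheaf X" "Comp sSh h s = x"
    using u x(2) unfolding uu by (auto simp: Arr_pointed_iff)
  have "h = Comp sSh x (to_pt ?S)"
  proof (rule simplicial_map_eqI[OF h(1) t])
    fix n U q assume U: "complex_space U" and "q \<in> val (lvl (fst h) n) U"
    then have q: "q \<in> val (lvl ?S n) U" using h(2) by simp
    \<comment> \<open>Reads \<open>h\<close> as a map on the product with the point, so that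
      insensitivity applies with \<open>pt\<close> in the role of \<open>Y\<close> and compares
      \<open>q\<close> with the base point.\<close>
    let ?\<phi> = "Comp sSh h (proj2 pt ?S)"
    have s0: "cmp s n U undefined \<in> val (lvl ?S n) U" using map_val[of s U undefined n] sm U by simp
    have \<phi>: "cmp ?\<phi> n U (upair undefined r) = cmp h n U r" if "r \<in> val (lvl ?S n) U" for r
      using U that by (simp add: proj2_def)
    have "cmp ?\<phi> n U (upair undefined q) = cmp ?\<phi> n U (upair undefined (cmp s n U undefined))"
      by (rule insensitiveD[OF S spt _ _ _ U _ q s0])
        (use h simplicial_map_proj2[OF spt sS] in \<open>auto intro!: simplicial_map_Comp simp: proj2_def\<close>)
    then have "cmp h n U q = cmp h n U (cmp s n U undefined)" unfolding \<phi>[OF q] \<phi>[OF s0] .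
    also have "\<dots> = cmp (Comp sSh h s) n U undefined" using U sm by simp
    also have "\<dots> = cmp (Comp sSh x (to_pt ?S)) n U q" unfolding h(4) using U q by simp
    finally show "cmp h n U q = cmp (Comp sSh x (to_pt ?S)) n U q" .
  qed (use h x(2) in simp_all)
  then show "u = (s, x, Comp sSh x (to_pt (Cod sSh s)))" using uu by simp
qed simp_all

theorem theorem4p1:
  fixes X :: "'u::universe presheaf" and x :: "'u sarrow"
  assumes "sheaf X"
    and "hyperbolic (const_ssheaf X)"
    and "pointed x" and "Cod sSh x = const_ssheaf X"
  shows "(\<forall>i j s. j \<le> i \<and> i - j > 0 \<and> is_par_source i j s \<longrightarrow>
            H_pointed_hom s x = {H_trivial s x}) \<and>
         (\<forall>n m z1 z2 s. m > 0 \<and> z1 \<in> ball 0 1 \<and> z2 \<in> ball 0 1 \<and> z1 \<noteq> z2 \<and>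
            is_iper_source z1 z2 n m s \<longrightarrow>
            H_pointed_hom s x = {H_trivial s x})"
proof -
  \<comment> \<open>Both kinds of source are smash products whose second factor is a parabolic
    sphere of positive dimension, \<open>i - j\<close> or \<open>m\<close>; nothing about the first
    factor enters.\<close>
  have "H_pointed_hom s x = {H_trivial s x}" if "is_par_sphere n b" "n > 0" "is_smash a b s" for n a b s
    by (rule H_pointed_hom_insensitive[OF assms(2-4) pointed_smash[OF that(3)]
      insensitive_smash[OF insensitive_par_sphere[OF assms(2) that(1,2)] that(3)]])
  then show ?thesis unfolding is_par_source_def is_iper_source_def by blast
qed

end
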